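(* Let $n\geq 2$ be an integer and let $\varepsilon>0$. Then there exists a constant $C=C(n,\varepsilon)$ so that the following holds. Let $d$ be an integer with $1\leq d<n$, let $0\leq\beta\leq 1$, and let $\delta>0$. Let $\mathbb{T}$ be a set of $\delta$-tubes contained in $B(0,1)\subset\mathbb{R}^n$. Suppose that for every $r\geq\delta$ and every ball $B\subset\mathcal{L}_n$ of radius $r$, $$\#\{T\in\mathbb{T}\colon \ell(T)\in B\}\leq (r/\delta)^{2(d-1)+\beta}.$$ Let $p\in(1,\infty]$ be the exponent whose conjugate exponent is $p'=d+\beta$. Then $$\Big\Vert \sum_{T\in\mathbb{T}}\chi_T\Big\Vert_{p}\leq C\,\delta^{\frac{1-d}{p'}-\varepsilon}\Big(\sum_{T\in\mathbb{T}}|T|\Big)^{1/p}.$$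
   Context: $\mathcal{L}_n$ is the set of (affine) lines in $\mathbb{R}^n$ with the metric $d(\ell,\ell')=|x-x'|+|u\wedge u'|$, where $u$ (resp. $u'$) is a unit vector parallel to $\ell$ (resp. $\ell'$), $x$ (resp. $x'$) is the unique point on $\ell$ (resp. $\ell'$) with $x\perp u$ (resp. $x'\perp u'$), and $|u\wedge u'|$ is the unsigned area of the parallelogram spanned by $u$ and $u'$. Balls in $\mathcal{L}_n$ are taken with respect to this metric. A $\delta$-tube is the $\delta$-neighborhood of a unit line segment in $\mathbb{R}^n$; if $T$ is a $\delta$-tube, $\ell(T)$ is the line coaxial with $T$ (the line containing that segment). $\chi_T$ is the indicator function of $T$, $|T|$ is its Lebesgue measure, and $\Vert\cdot\Vert_p$ is the $L^p(\mathbb{R}^n)$ norm. The conjugate exponent $p'$ satisfies $1/p+1/p'=1$; when $p=\infty$ (i.e. $p'=1$), $1/p=0$ and the factor $(\sum_{T}|T|)^{1/p}$ is read as $1$. *)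

theory Defs
  imports "HOL-Analysis.Analysis" "HOL-Probability.Essential_Supremum"
begin

section \<open>The metric space of affine lines\<close>

definition lines :: "'a::euclidean_space set set" where
  "lines = {l. affine l \<and> aff_dim l = 1}"

text \<open>The unit vector is only determined up to sign; all notions below are invariant under
  this choice, see \<open>line_dist_eq\<close>.\<close>

definition unit_direction :: "'a::euclidean_space set \<Rightarrow> 'a" where
  "unit_direction l = (SOME u. norm u = 1 \<and> affine_parallel (span {u}) l)"

definition foot :: "'a::euclidean_space set \<Rightarrow> 'a" where
  "foot l = (THE x. x \<in> l \<and> orthogonal x (unit_direction l))"

text \<open>\<open>wedge_area u v\<close> is the area of the parallelogram spanned by \<open>u\<close> and \<open>v\<close>, that is, the
  square root of their Gram determinant.\<close>

definition wedge_area :: "'a::euclidean_space \<Rightarrow> 'a \<Rightarrow> real" where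
  "wedge_area u v = sqrt ((u \<bullet> u) * (v \<bullet> v) - (u \<bullet> v)\<^sup>2)"

definition line_dist :: "'a::euclidean_space set \<Rightarrow> 'a set \<Rightarrow> real" where
  "line_dist l l' = norm (foot l - foot l') + wedge_area (unit_direction l) (unit_direction l')"

lemma lines_cases:
  assumes "l \<in> lines"
  obtains u where "norm u = 1" "affine_parallel (span {u}) l"
proof -
  have aff: "affine l" "aff_dim l = 1" using assms by (auto simp: lines_def)
  then obtain a where a: "a \<in> l" by force
  have "l \<noteq> {a}" using aff by force
  then obtain b where b: "b \<in> l" "b \<noteq> a" using a by blast
  have "affine hull {a, b} \<subseteq> l" using a b aff by (simp add: hull_minimal)
  moreover have "aff_dim {a, b} = 1" using b by (simp add: aff_dim_2)
  ultimately have l: "l = affine hull {a, b}"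
    using affine_dim_equal[of "affine hull {a, b}" l] aff by force
  define u where "u = (b - a) /\<^sub>R norm (b - a)"
  have "norm u = 1" using b by (simp add: u_def)
  moreover have "range (\<lambda>k. k *\<^sub>R u) = range (\<lambda>k. k *\<^sub>R (b - a))"
  proof safe
    fix k
    show "k *\<^sub>R u \<in> range (\<lambda>k. k *\<^sub>R (b - a))"
      by (auto simp: u_def)
    have "k *\<^sub>R (b - a) = (k * norm (b - a)) *\<^sub>R u" using b by (simp add: u_def)
    then show "k *\<^sub>R (b - a) \<in> range (\<lambda>k. k *\<^sub>R u)" by blast
  qed
  then have "l = (+) a ` span {u}"
    by (simp only: l affine_hull_2_alt span_singleton) (auto simp: image_image)
  ultimately show ?thesis using that by (auto simp: affine_parallel_def)
qed

lemma parallel_span_iff: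
  "affine_parallel (span {u}) l \<longleftrightarrow> (\<exists>a. l = range (\<lambda>t. a + t *\<^sub>R u))"
  by (auto simp: affine_parallel_def span_singleton image_image)

lemma ex1_foot:
  assumes "norm u = 1" "affine_parallel (span {u}) l"
  shows "\<exists>!x. x \<in> l \<and> orthogonal x u"
proof -
  obtain a where l: "l = range (\<lambda>t. a + t *\<^sub>R u)" using assms by (auto simp: parallel_span_iff)
  have uu: "u \<bullet> u = 1" using assms by (simp add: dot_square_norm)
  show ?thesis
  proof (rule ex1I[of _ "a + (- (a \<bullet> u)) *\<^sub>R u"])
    show "a + (- (a \<bullet> u)) *\<^sub>R u \<in> l \<and> orthogonal (a + (- (a \<bullet> u)) *\<^sub>R u) u"
      unfolding l using uu by (auto simp: orthogonal_def inner_left_distrib simp del: scaleR_minus_left)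
  next
    fix x assume "x \<in> l \<and> orthogonal x u"
    then obtain t where "x = a + t *\<^sub>R u" "a \<bullet> u + t = 0"
      using uu by (auto simp: l orthogonal_def algebra_simps)
    then show "x = a + (- (a \<bullet> u)) *\<^sub>R u"
      by (metis add_eq_0_iff add.commute minus_minus)
  qed
qed

lemma unit_direction:
  assumes "l \<in> lines"
  shows "norm (unit_direction l) = 1" "affine_parallel (span {unit_direction l}) l"
proof -
  have "norm (unit_direction l) = 1 \<and> affine_parallel (span {unit_direction l}) l"
    unfolding unit_direction_def
    by (rule someI_ex) (use lines_cases[OF assms] in blast)
  then show "norm (unit_direction l) = 1" "affine_parallel (span {unit_direction l}) l" by auto
qed

lemma foot:
  assumes "l \<in> lines"
  shows "foot l \<in> l" "orthogonal (foot l) (unit_direction l)"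
  using theI'[OF ex1_foot[OF unit_direction[OF assms]]] by (auto simp: foot_def)

lemma unit_direction_unique:
  assumes "norm u = 1" "affine_parallel (span {u}) l" "norm v = 1" "affine_parallel (span {v}) l"
  shows "v = u \<or> v = - u"
proof -
  have "affine_parallel (span {u}) (span {v})"
    using affine_parallel_assoc[OF assms(2) affine_parallel_commute[OF assms(4)]] .
  then have "span {u} = span {v}" by (intro parallel_subspace) auto
  then have "v \<in> span {u}" by (simp add: span_base)
  then obtain k where "v = k *\<^sub>R u" by (auto simp: span_singleton)
  moreover from this have "\<bar>k\<bar> = 1" using assms by simp
  ultimately show ?thesis by (auto simp: abs_if split: if_splits)
qed

lemma line_dist_eq:
  assumes l: "l \<in> lines" "norm u = 1" "affine_parallel (span {u}) l" "x \<in> l" "orthogonal x u"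
    and l': "l' \<in> lines" "norm u' = 1" "affine_parallel (span {u'}) l'" "x' \<in> l'" "orthogonal x' u'"
  shows "line_dist l l' = norm (x - x') + wedge_area u u'"
proof -
  have *: "foot m = y \<and> (unit_direction m = w \<or> unit_direction m = - w)"
    if m: "m \<in> lines" "norm w = 1" "affine_parallel (span {w}) m" "y \<in> m" "orthogonal y w" for m w y
  proof -
    have d: "unit_direction m = w \<or> unit_direction m = - w"
      using unit_direction_unique[OF m(2,3) unit_direction[OF m(1)]] .
    then have "orthogonal (foot m) w"
      using foot(2)[OF m(1)] by (auto simp: orthogonal_def)
    then have "foot m = y" using ex1_foot[OF m(2,3)] foot(1)[OF m(1)] m by blast
    with d show ?thesis by blast
  qed
  have "wedge_area (- v) w = wedge_area v w" "wedge_area v (- w) = wedge_area v w" for v w :: 'a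
    by (simp_all add: wedge_area_def)
  with *[OF l] *[OF l'] show ?thesis by (auto simp: line_dist_def)
qed

lemma wedge_area_unit:
  assumes "norm u = 1" "norm v = 1"
  shows "wedge_area u v = norm (v - (v \<bullet> u) *\<^sub>R u)"
proof -
  have "u \<bullet> u = 1" "v \<bullet> v = 1" using assms by (auto simp: dot_square_norm)
  then have "(v - (v \<bullet> u) *\<^sub>R u) \<bullet> (v - (v \<bullet> u) *\<^sub>R u) = (u \<bullet> u) * (v \<bullet> v) - (u \<bullet> v)\<^sup>2"
    by (simp add: inner_diff_left inner_diff_right inner_commute[of u v] power2_eq_square)
  then show ?thesis by (simp add: wedge_area_def norm_eq_sqrt_inner)
qed

lemma wedge_area_commute: "wedge_area u v = wedge_area v u"
  by (simp add: wedge_area_def inner_commute mult.commute)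

lemma wedge_area_nonneg: "0 \<le> wedge_area u v"
  unfolding wedge_area_def using Cauchy_Schwarz_ineq[of u v] by simp

lemma wedge_area_triangle:
  assumes "norm u = 1" "norm v = 1" "norm w = 1"
  shows "wedge_area u w \<le> wedge_area u v + wedge_area v w"
proof -
  have uu: "u \<bullet> u = 1" using assms by (simp add: dot_square_norm)
  define k where "k = (w \<bullet> v) * (v \<bullet> u)"
  have "(norm (w - (w \<bullet> u) *\<^sub>R u))\<^sup>2 + (w \<bullet> u - k)\<^sup>2 = (norm (w - k *\<^sub>R u))\<^sup>2"
    unfolding power2_norm_eq_inner using uu
    by (simp add: inner_diff_left inner_diff_right inner_commute[of u w] power2_eq_square algebra_simps)
  then have "norm (w - (w \<bullet> u) *\<^sub>R u) \<le> norm (w - k *\<^sub>R u)"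
    by (smt (verit) norm_ge_zero power2_le_imp_le zero_le_power2)
  also have "w - k *\<^sub>R u = (w - (w \<bullet> v) *\<^sub>R v) + (w \<bullet> v) *\<^sub>R (v - (v \<bullet> u) *\<^sub>R u)"
    by (simp add: k_def algebra_simps)
  also have "norm \<dots> \<le> norm (w - (w \<bullet> v) *\<^sub>R v) + \<bar>w \<bullet> v\<bar> * norm (v - (v \<bullet> u) *\<^sub>R u)"
    by (metis norm_scaleR norm_triangle_ineq)
  also have "\<dots> \<le> norm (w - (w \<bullet> v) *\<^sub>R v) + 1 * norm (v - (v \<bullet> u) *\<^sub>R u)"
    using Cauchy_Schwarz_ineq2[of w v] assms by (intro add_left_mono mult_right_mono) auto
  finally show ?thesis using assms by (simp add: wedge_area_unit)
qed

lemma wedge_area_eq_0: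
  assumes "norm u = 1" "norm v = 1" "wedge_area u v = 0"
  shows "v = u \<or> v = - u"
proof -
  have v: "v = (v \<bullet> u) *\<^sub>R u" using assms by (simp add: wedge_area_unit)
  then have "norm v = \<bar>v \<bullet> u\<bar> * norm u" by (metis norm_scaleR)
  then have "v \<bullet> u = 1 \<or> v \<bullet> u = - 1" using assms by auto
  then show ?thesis using v by auto
qed

lemma span_neg_singleton: "span {- u} = span {u :: 'a::real_vector}"
proof -
  have "- u \<in> span {u}" "u \<in> span {- u}"
    using span_neg[OF span_base[of u "{u}"]] span_neg[OF span_base[of "- u" "{- u}"]] by auto
  then show ?thesis by (simp add: span_eq)
qed

lemma range_line_shift:
  fixes u :: "'a::real_vector"
  assumes "x = a + s *\<^sub>R u"
  shows "range (\<lambda>t. a + t *\<^sub>R u) = range (\<lambda>t. x + t *\<^sub>R u)"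
proof safe
  fix t
  have "a + t *\<^sub>R u = x + (t - s) *\<^sub>R u" using assms by (simp add: algebra_simps)
  then show "a + t *\<^sub>R u \<in> range (\<lambda>t. x + t *\<^sub>R u)" by blast
  have "x + t *\<^sub>R u = a + (s + t) *\<^sub>R u" using assms by (simp add: algebra_simps)
  then show "x + t *\<^sub>R u \<in> range (\<lambda>t. a + t *\<^sub>R u)" by blast
qed

lemma line_eq_foot_direction:
  assumes "l \<in> lines"
  shows "l = range (\<lambda>t. foot l + t *\<^sub>R unit_direction l)"
proof -
  obtain a where l: "l = range (\<lambda>t. a + t *\<^sub>R unit_direction l)"
    using unit_direction(2)[OF assms] by (auto simp: parallel_span_iff)
  then obtain s where s: "foot l = a + s *\<^sub>R unit_direction l" using foot(1)[OF assms] by blast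
  show ?thesis using l range_line_shift[OF s] by simp
qed

interpretation lines: Metric_space lines line_dist
proof
  fix l l' :: "'a set"
  show "0 \<le> line_dist l l'" by (simp add: line_dist_def wedge_area_nonneg)
  show "line_dist l l' = line_dist l' l"
    by (simp add: line_dist_def wedge_area_commute norm_minus_commute)
next
  fix l l' :: "'a set" assume l: "l \<in> lines" "l' \<in> lines"
  show "line_dist l l' = 0 \<longleftrightarrow> l = l'"
  proof
    assume "line_dist l l' = 0"
    then have f: "foot l = foot l'" and w: "wedge_area (unit_direction l) (unit_direction l') = 0"
      using wedge_area_nonneg[of "unit_direction l" "unit_direction l'"]
        norm_ge_zero[of "foot l - foot l'"]
      unfolding line_dist_def by (smt (verit) eq_iff_diff_eq_0 norm_eq_zero)+
    have "unit_direction l' = unit_direction l \<or> unit_direction l' = - unit_direction l"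
      using wedge_area_eq_0[OF _ _ w] unit_direction l by blast
    then have "span {unit_direction l} = span {unit_direction l'}"
      using span_neg_singleton by metis
    then have "affine_parallel (span {unit_direction l}) l'"
      using unit_direction(2)[OF l(2)] by simp
    then obtain a where a: "l' = range (\<lambda>t. a + t *\<^sub>R unit_direction l)"
      by (auto simp: parallel_span_iff)
    then obtain s where s: "foot l = a + s *\<^sub>R unit_direction l"
      using foot(1)[OF l(2)] f by auto
    show "l = l'" using line_eq_foot_direction[OF l(1)] range_line_shift[OF s] a by simp
  next
    assume "l = l'"
    then show "line_dist l l' = 0"
      by (simp add: line_dist_def wedge_area_def power2_eq_square)
  qed
next
  fix l l' l'' :: "'a set" assume l: "l \<in> lines" "l' \<in> lines" "l'' \<in> lines"
  have "norm (foot l - foot l'') \<le> norm (foot l - foot l') + norm (foot l' - foot l'')"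
    by (metis dist_norm dist_triangle)
  with wedge_area_triangle[of "unit_direction l" "unit_direction l'" "unit_direction l''"] l
  show "line_dist l l'' \<le> line_dist l l' + line_dist l' l''"
    by (simp add: line_dist_def unit_direction)
qed


section \<open>Tubes\<close>

definition segment_nbhd :: "real \<Rightarrow> 'a::euclidean_space \<Rightarrow> 'a \<Rightarrow> 'a set" where
  "segment_nbhd \<delta> a b = (\<Union>x\<in>closed_segment a b. ball x \<delta>)"

definition is_tube :: "real \<Rightarrow> 'a::euclidean_space set \<Rightarrow> bool" where
  "is_tube \<delta> T \<longleftrightarrow> (\<exists>a b. dist a b = 1 \<and> T = segment_nbhd \<delta> a b)"

text \<open>A tube, as a set of points, determines its radius and its axis
  (\<open>segment_nbhd_inject\<close>), so the description below is definite: see \<open>coaxial_line_eq\<close>.\<close>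

definition coaxial_line :: "'a::euclidean_space set \<Rightarrow> 'a set" where
  "coaxial_line T = (THE l. \<exists>\<delta>>0. \<exists>a b. dist a b = 1 \<and> T = segment_nbhd \<delta> a b
                              \<and> l = affine hull {a, b})"

lemma Sup_inner_segment_nbhd:
  assumes v: "norm v = 1" and "\<delta> > 0"
  shows "(SUP x\<in>segment_nbhd \<delta> a b. x \<bullet> v) = max (a \<bullet> v) (b \<bullet> v) + \<delta>"
proof (rule cSup_eq)
  fix y assume "y \<in> (\<lambda>x. x \<bullet> v) ` segment_nbhd \<delta> a b"
  then obtain c x where c: "c \<in> closed_segment a b" "dist c x < \<delta>" "y = x \<bullet> v"
    by (auto simp: segment_nbhd_def)
  obtain t where t: "0 \<le> t" "t \<le> 1" "c = (1 - t) *\<^sub>R a + t *\<^sub>R b"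
    using c by (auto simp: closed_segment_def)
  have "c \<bullet> v = (1 - t) * (a \<bullet> v) + t * (b \<bullet> v)" by (simp add: t inner_add_left)
  also have "\<dots> \<le> (1 - t) * max (a \<bullet> v) (b \<bullet> v) + t * max (a \<bullet> v) (b \<bullet> v)"
    using t by (intro add_mono mult_left_mono) auto
  also have "\<dots> = max (a \<bullet> v) (b \<bullet> v)" by (simp add: algebra_simps)
  finally have 1: "c \<bullet> v \<le> max (a \<bullet> v) (b \<bullet> v)" .
  have "(x - c) \<bullet> v \<le> norm (x - c) * norm v" by (rule norm_cauchy_schwarz)
  then have "x \<bullet> v - c \<bullet> v \<le> \<delta>" using c v by (simp add: inner_diff_left dist_norm norm_minus_commute)
  with 1 c show "y \<le> max (a \<bullet> v) (b \<bullet> v) + \<delta>" by linarith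
next
  fix y assume y: "\<And>z. z \<in> (\<lambda>x. x \<bullet> v) ` segment_nbhd \<delta> a b \<Longrightarrow> z \<le> y"
  have vv: "v \<bullet> v = 1" using v by (simp add: dot_square_norm)
  have *: "c \<bullet> v + \<delta> \<le> y" if c: "c \<in> closed_segment a b" for c
  proof (rule dense_le)
    fix z assume z: "z < c \<bullet> v + \<delta>"
    define s where "s = max 0 (z - c \<bullet> v)"
    have s: "0 \<le> s" "s < \<delta>" using z assms by (auto simp: s_def)
    have "c + s *\<^sub>R v \<in> segment_nbhd \<delta> a b"
      using c s v by (auto simp: segment_nbhd_def dist_norm intro!: bexI[of _ c])
    then have "(c + s *\<^sub>R v) \<bullet> v \<le> y" using y by blast
    then show "z \<le> y" using vv by (simp add: inner_add_left s_def)
  qed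
  from *[of a] *[of b] show "max (a \<bullet> v) (b \<bullet> v) + \<delta> \<le> y" by auto
qed

lemma segment_nbhd_inject:
  assumes eq: "segment_nbhd \<delta> a b = segment_nbhd \<delta>' a' b'"
    and ab: "dist a b = 1" "dist a' b' = 1" and pos: "\<delta> > 0" "\<delta>' > 0"
  shows "\<delta> = \<delta>' \<and> {a, b} = {a', b'}"
proof -
  have h: "max (a \<bullet> v) (b \<bullet> v) + \<delta> = max (a' \<bullet> v) (b' \<bullet> v) + \<delta>'" if "norm v = 1" for v
    using Sup_inner_segment_nbhd[OF that pos(1), of a b]
      Sup_inner_segment_nbhd[OF that pos(2), of a' b'] eq by simp
  have width: "\<bar>(b - a) \<bullet> v\<bar> + 2 * \<delta> = \<bar>(b' - a') \<bullet> v\<bar> + 2 * \<delta>'" if "norm v = 1" for v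
    using h[OF that] h[of "- v"] that by (auto simp: inner_diff_left max_def abs_if split: if_splits)
  have mid: "(a + b) \<bullet> v = (a' + b') \<bullet> v" if "norm v = 1" for v
    using h[OF that] h[of "- v"] that by (auto simp: inner_add_left max_def split: if_splits)
  define w w' where "w = b - a" and "w' = b' - a'"
  have n: "norm w = 1" "norm w' = 1"
    using ab by (auto simp: w_def w'_def dist_norm norm_minus_commute)
  then have ww: "w \<bullet> w = 1" "w' \<bullet> w' = 1" by (auto simp: dot_square_norm)
  have cs: "\<bar>w \<bullet> w'\<bar> \<le> 1" using Cauchy_Schwarz_ineq2[of w w'] n by simp
  have e: "1 + 2 * \<delta> = \<bar>w' \<bullet> w\<bar> + 2 * \<delta>'" "\<bar>w \<bullet> w'\<bar> + 2 * \<delta> = 1 + 2 * \<delta>'"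
    using width[of w] width[of w'] n ww by (auto simp flip: w_def w'_def)
  have d: "\<delta> = \<delta>'" using e cs by (simp add: inner_commute)
  with e have "\<bar>w \<bullet> w'\<bar> = 1" by simp
  then have "wedge_area w w' = 0"
    using ww by (auto simp: wedge_area_def abs_if split: if_splits)
  then have w: "w' = w \<or> w' = - w" using wedge_area_eq_0 n by blast
  have s: "a + b = a' + b'"
  proof (rule ccontr)
    assume ne: "a + b \<noteq> a' + b'"
    define z where "z = (a + b) - (a' + b')"
    have "norm (z /\<^sub>R norm z) = 1" using ne by (simp add: z_def)
    from mid[OF this] have "z \<bullet> (z /\<^sub>R norm z) = 0"
      by (subst (1) z_def) (simp only: inner_diff_left diff_self)
    then have "z \<bullet> z = 0" using ne by (simp add: z_def)
    with ne show False by (simp add: z_def)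
  qed
  have 2: "2 *\<^sub>R a = (a + b) - w" "2 *\<^sub>R b = (a + b) + w"
       "2 *\<^sub>R a' = (a' + b') - w'" "2 *\<^sub>R b' = (a' + b') + w'"
    by (simp_all add: w_def w'_def scaleR_2)
  from w have "(2 *\<^sub>R a = 2 *\<^sub>R a' \<and> 2 *\<^sub>R b = 2 *\<^sub>R b') \<or> (2 *\<^sub>R a = 2 *\<^sub>R b' \<and> 2 *\<^sub>R b = 2 *\<^sub>R a')"
    unfolding 2 s by auto
  then have "{a, b} = {a', b'}" by auto
  with d show ?thesis by blast
qed

lemma coaxial_line_eq:
  assumes "dist a b = 1" "\<delta> > 0"
  shows "coaxial_line (segment_nbhd \<delta> a b) = affine hull {a, b}"
  unfolding coaxial_line_def
proof (rule the_equality)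
  show "\<exists>\<delta>'>0. \<exists>a' b'. dist a' b' = 1 \<and> segment_nbhd \<delta> a b = segment_nbhd \<delta>' a' b'
      \<and> affine hull {a, b} = affine hull {a', b'}"
    using assms by blast
next
  fix l assume "\<exists>\<delta>'>0. \<exists>a' b'. dist a' b' = 1 \<and> segment_nbhd \<delta> a b = segment_nbhd \<delta>' a' b'
      \<and> l = affine hull {a', b'}"
  then show "l = affine hull {a, b}"
    using segment_nbhd_inject assms by metis
qed


section \<open>The Lp norm with respect to Lebesgue measure\<close>

text \<open>The exponent ranges over \<open>(0, \<infinity>]\<close>, and the value \<open>\<infinity>\<close> is allowed.\<close>

definition Lp_norm :: "ennreal \<Rightarrow> ('a::euclidean_space \<Rightarrow> real) \<Rightarrow> ennreal" where
  "Lp_norm p f =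
    (if p = \<infinity> then esssup lebesgue (\<lambda>x. ennreal \<bar>f x\<bar>)
     else let I = (\<integral>\<^sup>+x. ennreal (\<bar>f x\<bar> powr enn2real p) \<partial>lebesgue)
          in if I = \<infinity> then \<infinity> else ennreal (enn2real I powr (1 / enn2real p)))"

end

theory Submission
  imports Defs
begin

text \<open>Put \<open>\<sigma> = 2 * (d - 1) + \<beta>\<close>, the exponent of the spacing hypothesis, and let \<open>q\<close> be the exponent of the
  norm.  Two relations drive the proof: \<open>\<sigma> * (q - 1) = 1 + (d - 1) * (q - 1)\<close>, and \<open>q \<ge> 1 + 1 / d\<close>.
  The argument is the multilinear-to-linear scheme of Bourgain and Guth, carried out in a discrete model
  in which all integrals are finite sums.

  \<^bold>\<open>The model.\<close>  Tubes are sorted by the coordinate in which their direction is largest.  Within one class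
  that coordinate serves as a time \<open>t\<close>, a line becomes a graph \<open>t \<mapsto> a + t * v\<close> with bounded \<open>a\<close> and \<open>v\<close>, and
  lying in the tube becomes the condition \<open>\<bar>x i - a i - t * v i\<bar> \<le> \<delta>\<close> in each remaining coordinate.  Space is
  replaced by a grid of mesh \<open>\<delta>\<close>.  The affine maps \<open>x \<mapsto> K * (x - \<alpha> - t * \<omega>)\<close> turn this configuration at
  width \<open>\<delta>\<close> into one at width \<open>K * \<delta>\<close> and preserve both hypotheses of the model, \<open>spread\<close> for points and
  \<open>spaced\<close> for lines.  This allows an induction from \<open>K * \<delta>\<close> to \<open>\<delta>\<close> (\<open>discrete_Kakeya\<close>), with a factor \<open>K\<close>
  that depends only on \<open>\<epsilon>\<close> and the dimension.

  \<^bold>\<open>The dichotomy\<close> (\<open>broad_or_narrow\<close>).  At a narrow point half of the lines have directions within \<open>1 / K\<close>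
  of a plane of dimension \<open>d - 1\<close>, hence in \<open>O(K ^ (d - 1))\<close> cells of side \<open>1 / K\<close>.  Splitting the lines into
  these cells costs \<open>K powr ((d - 1) * (q - 1))\<close> by convexity.  Rescaling a cell to unit size replaces
  \<open>\<delta>\<close> by \<open>K * \<delta>\<close> in the induction hypothesis, which wins back exactly this power and a further
  \<open>K powr (\<epsilon> * q)\<close> that absorbs the constants.

  At a broad point there are \<open>d + 1\<close> directions that span a nondegenerate simplex, and near each of them a fixed
  proportion of the lines through the point.  A multilinear Kakeya inequality for \<open>d + 1\<close> families
  (\<open>transversal_families_bound\<close>) then controls the sum of \<open>f powr (1 + 1 / d)\<close> over the broad points, \<open>f\<close>
  being the multiplicity, by the power \<open>1 + 1 / d\<close> of the number of lines.  Since \<open>f\<close> is at most the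
  number of lines, the exponent rises from \<open>1 + 1 / d\<close> to \<open>q\<close> for free, and the spacing hypothesis at radius \<open>1\<close>
  bounds the number of lines by a multiple of \<open>\<delta> powr - \<sigma>\<close>; by the first relation this is what is needed.

  \<^bold>\<open>The multilinear inequality\<close> (\<open>multilinear_Kakeya_grid\<close>) is proved as by Guth.  In suitable linear coordinates
  the tubes of the \<open>j\<close>-th family are almost parallel to the \<open>j\<close>-th axis.  Inside a box that is \<open>m\<close> times larger
  than a grid cell such a tube meets a bounded number of columns of cells, so a discrete Loomis-Whitney
  inequality (\<open>Finner_grid\<close>) shows that coarsening the grid by \<open>m\<close> costs only a constant factor.  There are
  about \<open>log m (1 / \<delta>)\<close> steps, and for large \<open>m\<close> the total loss is at most \<open>\<delta> powr - \<epsilon>\<close>.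

  The exponent \<open>\<infinity>\<close> occurs only for \<open>d = 1\<close> and \<open>\<beta> = 0\<close>, when the hypothesis allows at most one tube.\<close>

section \<open>Hoelder and Finner inequalities for finite sums\<close>

text \<open>Hoelder's inequality with equal exponents.  After normalising the sums of the \<open>g j\<close> to \<open>1\<close> all values are at
  most \<open>1\<close>, so lowering the exponent \<open>c\<close> to \<open>1 / card J\<close> only increases the left-hand side, and the
  arithmetic-geometric mean inequality applies pointwise.\<close>

lemma sum_prod_powr_le_prod_sum_powr:
  fixes g :: "'j \<Rightarrow> 'z \<Rightarrow> real" and c :: real
  assumes "finite S" "finite J" "J \<noteq> {}" and nonneg: "\<And>j z. j \<in> J \<Longrightarrow> z \<in> S \<Longrightarrow> 0 \<le> g j z"
    and c: "0 < c" "1 \<le> c * card J"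
  shows "(\<Sum>z\<in>S. \<Prod>j\<in>J. g j z powr c) \<le> (\<Prod>j\<in>J. (\<Sum>z\<in>S. g j z) powr c)"
proof (cases "\<exists>j\<in>J. (\<Sum>z\<in>S. g j z) = 0")
  case True
  then obtain j where j: "j \<in> J" "(\<Sum>z\<in>S. g j z) = 0" by blast
  then have "g j z = 0" if "z \<in> S" for z
    using that nonneg \<open>finite S\<close> by (simp add: sum_nonneg_eq_0_iff)
  then have "(\<Prod>j\<in>J. g j z powr c) = 0" if "z \<in> S" for z
    using that j \<open>finite J\<close> by (auto intro!: prod_zero)
  then show ?thesis by (simp add: prod_nonneg)
next
  case False
  define G where "G j = (\<Sum>z\<in>S. g j z)" for j
  have G: "0 < G j" if "j \<in> J" for j
    using False that sum_nonneg[of S "g j"] nonneg by (force simp: G_def less_le)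
  define a where "a j z = g j z / G j" for j z
  have le: "g j z \<le> G j" if "j \<in> J" "z \<in> S" for j z
    unfolding G_def using that \<open>finite S\<close> nonneg by (intro member_le_sum) auto
  have a: "0 \<le> a j z" "a j z \<le> 1" if "j \<in> J" "z \<in> S" for j z
    using that G[of j] nonneg[of j z] le[of j z] by (auto simp: a_def)
  have card: "card J > 0" using assms by (simp add: card_gt_0_iff)
  have amgm: "(\<Prod>j\<in>J. a j z powr c) \<le> (\<Sum>j\<in>J. a j z / card J)" if "z \<in> S" for z
  proof -
    have "(\<Prod>j\<in>J. a j z powr c) \<le> (\<Prod>j\<in>J. a j z powr (1 / card J))"
      using a that c card by (intro prod_mono conjI powr_mono') (auto simp: field_simps)
    also have "\<dots> = (\<Prod>j\<in>J. a j z) powr (1 / card J)"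
      using a that by (subst prod_powr_distrib) auto
    also have "\<dots> \<le> (\<Sum>j\<in>J. a j z / card J)"
      using a that assms by (intro arith_geom_mean) auto
    finally show ?thesis .
  qed
  have "(\<Sum>z\<in>S. \<Prod>j\<in>J. g j z powr c) = (\<Sum>z\<in>S. \<Prod>j\<in>J. (G j * a j z) powr c)"
    using G by (intro sum.cong prod.cong) (force simp: a_def)+
  also have "\<dots> = (\<Sum>z\<in>S. \<Prod>j\<in>J. G j powr c * a j z powr c)"
    using G a by (intro sum.cong prod.cong powr_mult) (auto simp: less_imp_le)
  also have "\<dots> = (\<Prod>j\<in>J. G j powr c) * (\<Sum>z\<in>S. \<Prod>j\<in>J. a j z powr c)"
    by (simp add: prod.distrib sum_distrib_left)
  also have "\<dots> \<le> (\<Prod>j\<in>J. G j powr c) * (\<Sum>z\<in>S. \<Sum>j\<in>J. a j z / card J)"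
    by (intro mult_left_mono sum_mono amgm prod_nonneg) auto
  also have "(\<Sum>z\<in>S. \<Sum>j\<in>J. a j z / card J) = (\<Sum>j\<in>J. (\<Sum>z\<in>S. g j z) / G j / card J)"
    by (subst sum.swap) (simp add: a_def sum_divide_distrib)
  also have "\<dots> = (\<Sum>j\<in>J. 1 / card J)"
    using G by (intro sum.cong refl) (force simp: G_def)
  also have "\<dots> = 1" using card by simp
  finally show ?thesis by (simp add: G_def)
qed

text \<open>The coordinates outside \<open>J\<close> are frozen at \<open>Q0\<close>, so that the coordinates can be summed out one at a time.\<close>

definition grid_box :: "'c set \<Rightarrow> int set \<Rightarrow> ('c \<Rightarrow> int) \<Rightarrow> ('c \<Rightarrow> int) set" where
  "grid_box J A Q0 = {Q. (\<forall>i\<in>J. Q i \<in> A) \<and> (\<forall>i. i \<notin> J \<longrightarrow> Q i = Q0 i)}"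

lemma grid_box_insert:
  assumes "i \<notin> J"
  shows "grid_box (insert i J) A Q0 = (\<Union>z\<in>A. grid_box J A (Q0(i := z)))"
proof (intro set_eqI iffI)
  fix Q assume Q: "Q \<in> grid_box (insert i J) A Q0"
  then have "Q \<in> grid_box J A (Q0(i := Q i))" "Q i \<in> A"
    by (auto simp: grid_box_def)
  then show "Q \<in> (\<Union>z\<in>A. grid_box J A (Q0(i := z)))" by blast
next
  fix Q assume "Q \<in> (\<Union>z\<in>A. grid_box J A (Q0(i := z)))"
  then obtain z where z: "z \<in> A" "Q \<in> grid_box J A (Q0(i := z))" by blast
  moreover have "Q i = z" using z assms by (auto simp: grid_box_def)
  ultimately show "Q \<in> grid_box (insert i J) A Q0"
    using assms by (auto simp: grid_box_def split: if_splits)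
qed

lemma finite_grid_box: "finite J \<Longrightarrow> finite A \<Longrightarrow> finite (grid_box J A Q0)"
proof (induction J arbitrary: Q0 rule: finite_induct)
  case empty
  have "grid_box {} A Q0 = {Q0}" by (auto simp: grid_box_def)
  then show ?case by simp
next
  case (insert i J)
  then show ?case by (simp add: grid_box_insert)
qed

lemma sum_grid_box_insert:
  assumes "finite J" "finite A" "i \<notin> J"
  shows "(\<Sum>Q\<in>grid_box (insert i J) A Q0. f Q) = (\<Sum>z\<in>A. \<Sum>Q\<in>grid_box J A (Q0(i := z)). f Q)"
  unfolding grid_box_insert[OF assms(3)]
proof (rule sum.UNION_disjoint)
  show "\<forall>z\<in>A. \<forall>z'\<in>A. z \<noteq> z' \<longrightarrow> grid_box J A (Q0(i := z)) \<inter> grid_box J A (Q0(i := z')) = {}"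
    using assms(3) by (force simp: grid_box_def)
qed (use assms in \<open>auto simp: finite_grid_box\<close>)

text \<open>For \<open>c = 1 / (card M - 1)\<close> and \<open>M = J\<close> this is the Loomis-Whitney inequality.  The further coordinates in
  \<open>J - M\<close>, on which every \<open>g j\<close> may depend, do no harm: summing out a coordinate is one application of
  Hoelder's inequality to the functions that depend on it.  Their number is \<open>card M - 1\<close> for a coordinate
  in \<open>M\<close> and \<open>card M\<close> otherwise, and both numbers times \<open>c\<close> are at least \<open>1\<close>.\<close>

lemma Finner_grid:
  fixes g :: "'c \<Rightarrow> ('c \<Rightarrow> int) \<Rightarrow> real" and c :: real
  assumes "finite J" "finite A" "finite M" and c: "0 < c" "1 \<le> c * (real (card M) - 1)"
    and nonneg: "\<And>j Q. 0 \<le> g j Q"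
    and indep: "\<And>j Q z. j \<in> M \<Longrightarrow> g j (Q(j := z)) = g j Q"
  shows "(\<Sum>Q\<in>grid_box J A Q0. \<Prod>j\<in>M. g j Q powr c)
       \<le> (\<Prod>j\<in>M. (\<Sum>Q\<in>grid_box (J - {j}) A Q0. g j Q) powr c)"
  using \<open>finite J\<close>
proof (induction J arbitrary: Q0 rule: finite_induct)
  case empty
  have "grid_box {} A Q0 = {Q0}" by (auto simp: grid_box_def)
  then show ?case by simp
next
  case (insert i J)
  define h where "h j z = (\<Sum>Q\<in>grid_box (J - {j}) A (Q0(i := z)). g j Q)" for j z
  have h_nonneg: "0 \<le> h j z" for j z by (simp add: h_def sum_nonneg nonneg)
  have h_sum: "(\<Sum>Q\<in>grid_box (insert i J - {j}) A Q0. g j Q) = (\<Sum>z\<in>A. h j z)" if "j \<noteq> i" for j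
  proof -
    have "insert i J - {j} = insert i (J - {j})" using that by auto
    then show ?thesis
      unfolding h_def using insert.hyps \<open>finite A\<close> by (simp add: sum_grid_box_insert)
  qed
  have h_const: "h i z = (\<Sum>Q\<in>grid_box J A Q0. g i Q)" if "i \<in> M" for z
  proof -
    have "grid_box J A Q0 = (\<lambda>Q. Q(i := Q0 i)) ` grid_box J A (Q0(i := z))"
    proof (intro set_eqI iffI)
      fix Q assume "Q \<in> grid_box J A Q0"
      then have "Q(i := z) \<in> grid_box J A (Q0(i := z))" "Q = (Q(i := z))(i := Q0 i)"
        using insert.hyps by (auto simp: grid_box_def fun_eq_iff)
      then show "Q \<in> (\<lambda>Q. Q(i := Q0 i)) ` grid_box J A (Q0(i := z))" by blast
    qed (use insert.hyps in \<open>auto simp: grid_box_def\<close>)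
    moreover have "inj_on (\<lambda>Q. Q(i := Q0 i)) (grid_box J A (Q0(i := z)))"
    proof (rule inj_onI)
      fix Q Q' assume Q: "Q \<in> grid_box J A (Q0(i := z))" "Q' \<in> grid_box J A (Q0(i := z))"
        and eq: "Q(i := Q0 i) = Q'(i := Q0 i)"
      have "Q i = Q' i" using Q insert.hyps by (auto simp: grid_box_def)
      then show "Q = Q'" using eq by (metis fun_upd_idem_iff fun_upd_upd)
    qed
    ultimately have "(\<Sum>Q\<in>grid_box J A Q0. g i Q) = (\<Sum>Q\<in>grid_box J A (Q0(i := z)). g i (Q(i := Q0 i)))"
      by (simp add: sum.reindex)
    also have "\<dots> = h i z" using insert.hyps by (simp add: h_def indep[OF that])
    finally show ?thesis by simp
  qed
  \<comment> \<open>The new coordinate \<open>i\<close> is summed last: induction for each of its values, then Hoelder in that value.\<close>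
  have "(\<Sum>Q\<in>grid_box (insert i J) A Q0. \<Prod>j\<in>M. g j Q powr c)
      = (\<Sum>z\<in>A. \<Sum>Q\<in>grid_box J A (Q0(i := z)). \<Prod>j\<in>M. g j Q powr c)"
    using insert.hyps \<open>finite A\<close> by (simp add: sum_grid_box_insert)
  also have "\<dots> \<le> (\<Sum>z\<in>A. \<Prod>j\<in>M. h j z powr c)"
    unfolding h_def by (intro sum_mono insert.IH)
  also have "\<dots> \<le> (\<Prod>j\<in>M. (\<Sum>Q\<in>grid_box (insert i J - {j}) A Q0. g j Q) powr c)"
  proof (cases "i \<in> M")
    case True
    have cardM: "real (card (M - {i})) = real (card M) - 1"
      using True \<open>finite M\<close> card_gt_0_iff[of M] by (auto simp: of_nat_diff Suc_le_eq)
    define G where "G = (\<Sum>Q\<in>grid_box J A Q0. g i Q) powr c"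
    have "M - {i} \<noteq> {}" using c cardM by (metis card.empty mult_zero_right not_one_le_zero of_nat_0)
    then have hold: "(\<Sum>z\<in>A. \<Prod>j\<in>M - {i}. h j z powr c) \<le> (\<Prod>j\<in>M - {i}. (\<Sum>z\<in>A. h j z) powr c)"
      using c cardM \<open>finite M\<close> \<open>finite A\<close> h_nonneg by (intro sum_prod_powr_le_prod_sum_powr) auto
    have "(\<Sum>z\<in>A. \<Prod>j\<in>M. h j z powr c) = G * (\<Sum>z\<in>A. \<Prod>j\<in>M - {i}. h j z powr c)"
      unfolding sum_distrib_left G_def
      using True \<open>finite M\<close> h_const by (intro sum.cong refl) (simp add: prod.remove)
    also have "\<dots> \<le> G * (\<Prod>j\<in>M - {i}. (\<Sum>z\<in>A. h j z) powr c)"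
      using hold by (intro mult_left_mono) (auto simp: G_def)
    also have "\<dots> = G * (\<Prod>j\<in>M - {i}. (\<Sum>Q\<in>grid_box (insert i J - {j}) A Q0. g j Q) powr c)"
      by (simp add: h_sum)
    also have "\<dots> = (\<Prod>j\<in>M. (\<Sum>Q\<in>grid_box (insert i J - {j}) A Q0. g j Q) powr c)"
      using True \<open>finite M\<close> insert.hyps by (simp add: prod.remove G_def)
    finally show ?thesis .
  next
    case False
    have "1 \<le> c * real (card M)" using c by (simp add: algebra_simps)
    moreover have "M \<noteq> {}" using c by auto
    ultimately have "(\<Sum>z\<in>A. \<Prod>j\<in>M. h j z powr c) \<le> (\<Prod>j\<in>M. (\<Sum>z\<in>A. h j z) powr c)"
      using c \<open>finite M\<close> \<open>finite A\<close> h_nonneg by (intro sum_prod_powr_le_prod_sum_powr) auto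
    also have "\<dots> = (\<Prod>j\<in>M. (\<Sum>Q\<in>grid_box (insert i J - {j}) A Q0. g j Q) powr c)"
      using False by (intro prod.cong refl) (metis h_sum)
    finally show ?thesis .
  qed
  finally show ?case .
qed

text \<open>Convexity of the power function; the zero terms are split off because convexity is applied on the positive reals.\<close>

lemma sum_powr_le:
  fixes y :: "'a \<Rightarrow> real"
  assumes "finite Z" "1 \<le> p" "\<And>z. z \<in> Z \<Longrightarrow> 0 \<le> y z"
  shows "(\<Sum>z\<in>Z. y z) powr p \<le> real (card Z) powr (p - 1) * (\<Sum>z\<in>Z. y z powr p)"
proof -
  define Y where "Y = {z \<in> Z. y z \<noteq> 0}"
  have Y: "finite Y" "Y \<subseteq> Z" using assms by (auto simp: Y_def)
  have eq: "(\<Sum>z\<in>Z. y z) = (\<Sum>z\<in>Y. y z)" "(\<Sum>z\<in>Z. y z powr p) = (\<Sum>z\<in>Y. y z powr p)"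
    using assms by (auto simp: Y_def intro!: sum.mono_neutral_right)
  show ?thesis
  proof (cases "Y = {}")
    case True
    then show ?thesis using eq by simp
  next
    case False
    then have card: "real (card Y) > 0" using Y by (simp add: card_gt_0_iff)
    have "(\<Sum>z\<in>Y. (1 / card Y) *\<^sub>R y z) powr p \<le> (\<Sum>z\<in>Y. (1 / card Y) * y z powr p)"
      using Y False assms card
      by (intro convex_on_sum[OF _ _ powr_convex]) (auto simp: Y_def less_le)
    then have "((\<Sum>z\<in>Y. y z) / card Y) powr p \<le> (\<Sum>z\<in>Y. y z powr p) / card Y"
      by (simp add: sum_divide_distrib)
    moreover have "0 \<le> (\<Sum>z\<in>Y. y z)" using Y assms by (intro sum_nonneg) auto
    ultimately have "(\<Sum>z\<in>Y. y z) powr p / card Y powr p \<le> (\<Sum>z\<in>Y. y z powr p) / card Y"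
      by (simp add: powr_divide)
    then have "(\<Sum>z\<in>Y. y z) powr p \<le> card Y powr (p - 1) * (\<Sum>z\<in>Y. y z powr p)"
      using card by (simp add: powr_diff field_simps)
    also have "\<dots> \<le> card Z powr (p - 1) * (\<Sum>z\<in>Y. y z powr p)"
      using assms Y by (intro mult_right_mono powr_mono2) (auto intro!: sum_nonneg card_mono)
    finally show ?thesis by (simp add: eq)
  qed
qed

lemma card_grid_box_le:
  assumes "finite J" "finite A"
  shows "card (grid_box J A Q0) \<le> card A ^ card J"
  using assms(1)
proof (induction J arbitrary: Q0 rule: finite_induct)
  case empty
  have "grid_box {} A Q0 = {Q0}" by (auto simp: grid_box_def)
  then show ?case by simp
next
  case (insert i J)
  have "card (grid_box (insert i J) A Q0) \<le> (\<Sum>z\<in>A. card (grid_box J A (Q0(i := z))))"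
    unfolding grid_box_insert[OF insert.hyps(2)] using assms by (intro card_UN_le) auto
  also have "\<dots> \<le> (\<Sum>z\<in>A. card A ^ card J)" by (intro sum_mono insert.IH)
  finally show ?case using insert.hyps by simp
qed

lemma card_int_box_le:
  fixes Q0 :: "'c \<Rightarrow> int"
  assumes "finite J" "\<And>Q i. Q \<in> S \<Longrightarrow> i \<in> J \<Longrightarrow> \<bar>Q i - Q0 i\<bar> \<le> int r"
    and "\<And>Q i. Q \<in> S \<Longrightarrow> i \<notin> J \<Longrightarrow> Q i = 0"
  shows "finite S \<and> card S \<le> (2 * r + 1) ^ card J"
proof -
  let ?B = "grid_box J {- int r..int r} (\<lambda>_. 0)"
  have fin: "finite ?B" using assms by (simp add: finite_grid_box)
  have inj: "inj_on (\<lambda>Q i. if i \<in> J then Q i - Q0 i else 0) S"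
  proof (rule inj_onI)
    fix Q Q' assume Q: "Q \<in> S" "Q' \<in> S"
      "(\<lambda>i. if i \<in> J then Q i - Q0 i else 0) = (\<lambda>i. if i \<in> J then Q' i - Q0 i else 0)"
    then have "Q i = Q' i" for i
      using assms(3)[of Q i] assms(3)[of Q' i] by (cases "i \<in> J") (auto dest: fun_cong[of _ _ i])
    then show "Q = Q'" by auto
  qed
  have sub: "(\<lambda>Q i. if i \<in> J then Q i - Q0 i else 0) ` S \<subseteq> ?B"
  proof safe
    fix Q assume "Q \<in> S"
    then have "- int r \<le> Q i - Q0 i \<and> Q i - Q0 i \<le> int r" if "i \<in> J" for i
      using assms(2)[of Q i] that by (auto simp: abs_le_iff)
    then show "(\<lambda>i. if i \<in> J then Q i - Q0 i else 0) \<in> ?B"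
      by (auto simp: grid_box_def)
  qed
  have "card S \<le> card ?B" using card_inj_on_le[OF inj sub fin] .
  also have "\<dots> \<le> card {- int r..int r} ^ card J" using assms by (intro card_grid_box_le) auto
  also have "card {- int r..int r} = 2 * r + 1" by simp
  finally show ?thesis using finite_subset[OF sub fin] finite_image_iff[OF inj] by auto
qed

section \<open>Multilinear Kakeya by induction on scales\<close>

lemma abs_floor_diff_le:
  fixes x y :: real
  assumes "\<bar>x - y\<bar> \<le> real r"
  shows "\<bar>\<lfloor>x\<rfloor> - \<lfloor>y\<rfloor>\<bar> \<le> int r + 1"
  using assms by linarith

lemma abs_diff_divide_le_iff:
  fixes x y :: real
  assumes "0 < r"
  shows "\<bar>x / r - y / r\<bar> \<le> b \<longleftrightarrow> \<bar>x - y\<bar> \<le> b * r"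
proof -
  have "x / r - y / r = (x - y) / r" by (simp add: diff_divide_distrib)
  then have "\<bar>x / r - y / r\<bar> = \<bar>x - y\<bar> / r" using assms by (simp add: abs_divide)
  then show ?thesis using assms by (simp add: pos_divide_le_eq)
qed

lemma real_card_filter: "finite A \<Longrightarrow> real (card {x \<in> A. Q x}) = (\<Sum>x\<in>A. of_bool (Q x))"
  by (simp add: Collect_conj_eq)

text \<open>Guth's induction on scales.  The coordinates in \<open>M\<close> are the axes of the families; the coordinates in \<open>J - M\<close>
  vary slowly along all tubes.  At scale \<open>s\<close> the grid has cells of side \<open>\<delta> * m ^ s\<close>, and the quantity \<open>S s\<close>
  sums over all cells the product of the numbers of tubes that meet the cell, to the power \<open>c\<close>.  The sum in the
  claim is at most \<open>E * S 0\<close>, one step multiplies \<open>S\<close> by a constant, and at the top scale there is a bounded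
  number of cells.\<close>

lemma multilinear_Kakeya_grid:
  fixes \<Phi> :: "'p \<Rightarrow> 'c \<Rightarrow> real" and inc :: "'l \<Rightarrow> 'p \<Rightarrow> bool" and F :: "'c \<Rightarrow> 'l set"
    and c \<delta> E :: real and m b s :: nat
  assumes fin: "finite P" "finite J" "M \<subseteq> J" "\<And>j. j \<in> M \<Longrightarrow> finite (F j)"
    and c: "0 < c" "c * (real (card M) - 1) = 1" and "0 < \<delta>" "1 \<le> m" "0 \<le> E"
    and axial: "\<And>j l p p' i. \<lbrakk>j \<in> M; l \<in> F j; p \<in> P; p' \<in> P; inc l p; inc l p'; i \<in> J; i \<noteq> j\<rbrakk>
        \<Longrightarrow> \<bar>\<Phi> p i - \<Phi> p' i\<bar> \<le> \<bar>\<Phi> p j - \<Phi> p' j\<bar> / m + b * \<delta>"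
    and cell: "\<And>Q. card {p \<in> P. \<forall>i\<in>J. \<lfloor>\<Phi> p i / \<delta>\<rfloor> = Q i} \<le> E"
    and range: "\<And>p i. p \<in> P \<Longrightarrow> i \<in> J \<Longrightarrow> \<bar>\<Phi> p i\<bar> \<le> \<delta> * m ^ s"
  shows "(\<Sum>p\<in>P. \<Prod>j\<in>M. real (card {l \<in> F j. inc l p}) powr c)
    \<le> E * ((real ((2 * b + 5) ^ card J)) ^ 2) ^ s * 3 ^ card J * (\<Prod>j\<in>M. real (card (F j)) powr c)"
proof -
  define \<kappa> where "\<kappa> s p = (\<lambda>i. if i \<in> J then \<lfloor>\<Phi> p i / (\<delta> * m ^ s)\<rfloor> else 0)" for s p
  define N where "N s j Q = real (card {l \<in> F j. \<exists>p\<in>P. inc l p \<and> \<kappa> s p = Q})" for s j Q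
  define S where "S s = (\<Sum>Q\<in>\<kappa> s ` P. \<Prod>j\<in>M. N s j Q powr c)" for s
  define V where "V = real ((2 * b + 5) ^ card J)"
  have V1: "1 \<le> V" by (simp add: V_def)
  have finM: "finite M" using fin finite_subset by blast
  have cM: "c * real (card M) \<le> 2"
  proof -
    have "real (card M) - 1 > 0" using c by (metis zero_less_mult_pos zero_less_one)
    then have "2 \<le> card M" by linarith
    then have "1 \<le> real (card M) - 1" by linarith
    then have "c * 1 \<le> c * (real (card M) - 1)" using c by (intro mult_left_mono) auto
    then have "c \<le> 1" using c by linarith
    then show ?thesis using c by (simp add: algebra_simps)
  qed
  have Vpow: "(\<Prod>j\<in>M. V powr c) \<le> V ^ 2"
  proof -
    have "(\<Prod>j\<in>M. V powr c) = (V powr c) powr (card M)"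
      using V1 by (simp add: powr_realpow)
    also have "\<dots> = V powr (c * card M)" by (rule powr_powr)
    also have "\<dots> \<le> V powr 2" using V1 cM by (intro powr_mono) auto
    finally show ?thesis using V1 by simp
  qed
  have parent: "\<kappa> (Suc s) p = (\<lambda>i. \<kappa> s p i div int m)" for s p
  proof
    fix i
    have "\<lfloor>\<Phi> p i / (\<delta> * m ^ s) / real_of_int (int m)\<rfloor> = \<lfloor>\<Phi> p i / (\<delta> * m ^ s)\<rfloor> div int m"
      by (rule floor_divide_real_eq_div) simp
    then show "\<kappa> (Suc s) p i = \<kappa> s p i div int m"
      by (simp add: \<kappa>_def field_simps)
  qed
  have step: "S s \<le> V ^ 2 * S (Suc s)" for s
  proof -
    define par where "par Q = (\<lambda>i. Q i div int m)" for Q :: "'c \<Rightarrow> int"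
    define A where "A = (\<Union>p\<in>P. \<kappa> s p ` J)"
    have finA: "finite A" using fin by (simp add: A_def)
    have local: "(\<Sum>Q\<in>{Q \<in> \<kappa> s ` P. par Q = R}. \<Prod>j\<in>M. N s j Q powr c)
        \<le> V ^ 2 * (\<Prod>j\<in>M. N (Suc s) j R powr c)" if "R \<in> \<kappa> (Suc s) ` P" for R
    proof -
      \<comment> \<open>\<open>G j Q\<close> counts the tubes that meet the column of \<open>Q\<close> in direction \<open>j\<close> inside the box \<open>R\<close>; unlike \<open>N s j Q\<close>
        it does not depend on \<open>Q j\<close>, as Finner's inequality demands.\<close>
      define hit where "hit j l Q \<longleftrightarrow> (\<exists>p\<in>P. inc l p \<and> \<kappa> (Suc s) p = R \<and> (\<forall>i\<in>J. i \<noteq> j \<longrightarrow> \<kappa> s p i = Q i))"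
        for j l Q
      define G where "G j Q = real (card {l \<in> F j. hit j l Q})" for j Q
      have le: "N s j Q \<le> G j Q" if "j \<in> M" "par Q = R" for j Q
        unfolding N_def G_def of_nat_le_iff
        using that fin by (intro card_mono) (auto simp: hit_def par_def parent)
      have "(\<Sum>Q\<in>{Q \<in> \<kappa> s ` P. par Q = R}. \<Prod>j\<in>M. N s j Q powr c)
          \<le> (\<Sum>Q\<in>{Q \<in> \<kappa> s ` P. par Q = R}. \<Prod>j\<in>M. G j Q powr c)"
        using c le by (intro sum_mono prod_mono conjI powr_mono2) (auto simp: N_def)
      also have "\<dots> \<le> (\<Sum>Q\<in>grid_box J A (\<lambda>_. 0). \<Prod>j\<in>M. G j Q powr c)"
        using fin finA
        by (intro sum_mono2 finite_grid_box prod_nonneg) (auto simp: grid_box_def A_def, auto simp: \<kappa>_def)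
      also have "\<dots> \<le> (\<Prod>j\<in>M. (\<Sum>Q\<in>grid_box (J - {j}) A (\<lambda>_. 0). G j Q) powr c)"
        using fin finA finM c by (intro Finner_grid) (auto simp: G_def hit_def)
      also have "\<dots> \<le> (\<Prod>j\<in>M. (V * N (Suc s) j R) powr c)"
      proof (intro prod_mono conjI powr_mono2)
        fix j assume j: "j \<in> M"
        have finB: "finite (grid_box (J - {j}) A (\<lambda>_. 0))" using fin finA by (simp add: finite_grid_box)
        \<comment> \<open>A tube meets a bounded number of columns of cells inside \<open>R\<close>: along the box its \<open>j\<close>-th coordinate
          varies by at most \<open>m\<close> cells, hence the others by at most \<open>1 + b\<close>.\<close>
        have cols: "card {Q \<in> grid_box (J - {j}) A (\<lambda>_. 0). hit j l Q}
            \<le> V * of_bool (\<exists>p\<in>P. inc l p \<and> \<kappa> (Suc s) p = R)" if l: "l \<in> F j" for l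
        proof (cases "\<exists>p\<in>P. inc l p \<and> \<kappa> (Suc s) p = R")
          case False
          then have "{Q \<in> grid_box (J - {j}) A (\<lambda>_. 0). hit j l Q} = {}" by (auto simp: hit_def)
          then show ?thesis by (simp only: False) simp
        next
          case True
          then obtain p0 where p0: "p0 \<in> P" "inc l p0" "\<kappa> (Suc s) p0 = R" by blast
          have "card {Q \<in> grid_box (J - {j}) A (\<lambda>_. 0). hit j l Q} \<le> (2 * (b + 2) + 1) ^ card (J - {j})"
          proof (rule card_int_box_le[THEN conjunct2])
            fix Q i assume Q: "Q \<in> {Q \<in> grid_box (J - {j}) A (\<lambda>_. 0). hit j l Q}" and i: "i \<in> J - {j}"
            then obtain p where p: "p \<in> P" "inc l p" "\<kappa> (Suc s) p = R" "\<kappa> s p i = Q i"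
              by (auto simp: hit_def)
            let ?d = "\<delta> * real m ^ s"
            have d: "0 < ?d" "\<delta> \<le> ?d" using \<open>0 < \<delta>\<close> \<open>1 \<le> m\<close> by auto
            have "\<kappa> (Suc s) p j = \<kappa> (Suc s) p0 j" using p p0 by simp
            then have "\<lfloor>\<Phi> p j / (?d * m)\<rfloor> = \<lfloor>\<Phi> p0 j / (?d * m)\<rfloor>"
              using j fin by (auto simp: \<kappa>_def mult_ac)
            then have "\<bar>\<Phi> p j / (?d * m) - \<Phi> p0 j / (?d * m)\<bar> \<le> 1" by linarith
            then have "\<bar>\<Phi> p j - \<Phi> p0 j\<bar> \<le> ?d * m"
              using d \<open>1 \<le> m\<close> by (simp add: divide_simps abs_if flip: diff_divide_distrib split: if_splits)
            then have "\<bar>\<Phi> p j - \<Phi> p0 j\<bar> / m \<le> ?d" using \<open>1 \<le> m\<close> by (simp add: divide_simps)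
            moreover have "b * \<delta> \<le> b * ?d" using d by (intro mult_left_mono) auto
            ultimately have "\<bar>\<Phi> p i - \<Phi> p0 i\<bar> \<le> (1 + b) * ?d"
              using axial[OF j l p(1) p0(1) p(2) p0(2), of i] i by (auto simp: algebra_simps)
            then have "\<bar>\<Phi> p i / ?d - \<Phi> p0 i / ?d\<bar> \<le> real (1 + b)"
              using d(1) abs_diff_divide_le_iff by simp
            from abs_floor_diff_le[OF this] show "\<bar>Q i - \<kappa> s p0 i\<bar> \<le> int (b + 2)"
              using p(4) i by (simp add: \<kappa>_def)
          qed (use fin in \<open>auto simp: grid_box_def\<close>)
          also have "\<dots> \<le> (2 * b + 5) ^ card J"
          proof -
            have "2 * (b + 2) + 1 = 2 * b + 5" by simp
            moreover have "card (J - {j}) \<le> card J" using fin by (intro card_mono) auto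
            ultimately show ?thesis by (simp only:) (intro power_increasing, auto)
          qed
          finally have "card {Q \<in> grid_box (J - {j}) A (\<lambda>_. 0). hit j l Q} \<le> V"
            unfolding V_def by (simp only: of_nat_le_iff)
          then show ?thesis by (simp only: True) simp
        qed
        have "(\<Sum>Q\<in>grid_box (J - {j}) A (\<lambda>_. 0). G j Q)
            = (\<Sum>l\<in>F j. real (card {Q \<in> grid_box (J - {j}) A (\<lambda>_. 0). hit j l Q}))"
          unfolding G_def using fin(4)[OF j] finB
          by (simp only: real_card_filter) (rule sum.swap)
        also have "\<dots> \<le> (\<Sum>l\<in>F j. V * of_bool (\<exists>p\<in>P. inc l p \<and> \<kappa> (Suc s) p = R))"
          by (intro sum_mono cols)
        also have "\<dots> = V * N (Suc s) j R"
          unfolding N_def using fin(4)[OF j] by (simp only: real_card_filter sum_distrib_left)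
        finally show "(\<Sum>Q\<in>grid_box (J - {j}) A (\<lambda>_. 0). G j Q) \<le> V * N (Suc s) j R" .
      qed (use c in \<open>auto simp: G_def intro!: sum_nonneg\<close>)
      also have "\<dots> = (\<Prod>j\<in>M. V powr c) * (\<Prod>j\<in>M. N (Suc s) j R powr c)"
        using V1 by (simp add: powr_mult N_def prod.distrib)
      also have "\<dots> \<le> V ^ 2 * (\<Prod>j\<in>M. N (Suc s) j R powr c)"
        using Vpow by (intro mult_right_mono prod_nonneg) auto
      finally show ?thesis .
    qed
    have "S s = (\<Sum>R\<in>\<kappa> (Suc s) ` P. \<Sum>Q\<in>{Q \<in> \<kappa> s ` P. par Q = R}. \<Prod>j\<in>M. N s j Q powr c)"
      unfolding S_def using fin by (intro sum.group[symmetric]) (auto simp: parent par_def)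
    also have "\<dots> \<le> (\<Sum>R\<in>\<kappa> (Suc s) ` P. V ^ 2 * (\<Prod>j\<in>M. N (Suc s) j R powr c))"
      by (intro sum_mono local)
    finally show ?thesis by (simp add: S_def sum_distrib_left)
  qed
  have iter: "S 0 \<le> (V ^ 2) ^ s * S s" for s
  proof (induction s)
    case (Suc s)
    have "(V ^ 2) ^ s * S s \<le> (V ^ 2) ^ s * (V ^ 2 * S (Suc s))" by (intro mult_left_mono step) auto
    with Suc show ?case by (simp add: mult_ac)
  qed simp
  have top: "S s \<le> 3 ^ card J * (\<Prod>j\<in>M. real (card (F j)) powr c)"
  proof -
    have "card (\<kappa> s ` P) \<le> (2 * 1 + 1) ^ card J"
    proof (rule card_int_box_le[THEN conjunct2, of J _ "\<lambda>_. 0"])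
      fix Q i assume "Q \<in> \<kappa> s ` P" "i \<in> J"
      then obtain p where p: "p \<in> P" "Q = \<kappa> s p" by blast
      have "0 < \<delta> * real m ^ s" using \<open>0 < \<delta>\<close> \<open>1 \<le> m\<close> by auto
      then have "\<bar>\<Phi> p i / (\<delta> * m ^ s)\<bar> \<le> 1"
        using range[OF p(1) \<open>i \<in> J\<close>] by (simp add: abs_divide)
      then have "\<bar>\<lfloor>\<Phi> p i / (\<delta> * m ^ s)\<rfloor>\<bar> \<le> 1" by linarith
      then show "\<bar>Q i - 0\<bar> \<le> int 1" using \<open>i \<in> J\<close> by (simp add: p(2) \<kappa>_def)
    qed (use fin in \<open>auto simp: \<kappa>_def\<close>)
    then have "card (\<kappa> s ` P) \<le> 3 ^ card J" by simp
    then have "real (card (\<kappa> s ` P)) \<le> real (3 ^ card J)" by (simp only: of_nat_le_iff)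
    then have card: "real (card (\<kappa> s ` P)) \<le> 3 ^ card J" by simp
    have "S s \<le> (\<Sum>Q\<in>\<kappa> s ` P. \<Prod>j\<in>M. real (card (F j)) powr c)"
      unfolding S_def N_def using fin c
      by (intro sum_mono prod_mono conjI powr_mono2) (auto intro!: card_mono)
    also have "\<dots> = card (\<kappa> s ` P) * (\<Prod>j\<in>M. real (card (F j)) powr c)" by simp
    also have "\<dots> \<le> 3 ^ card J * (\<Prod>j\<in>M. real (card (F j)) powr c)"
      using card by (intro mult_right_mono prod_nonneg) auto
    finally show ?thesis .
  qed
  have "(\<Sum>p\<in>P. \<Prod>j\<in>M. real (card {l \<in> F j. inc l p}) powr c)
      \<le> (\<Sum>p\<in>P. \<Prod>j\<in>M. N 0 j (\<kappa> 0 p) powr c)"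
    unfolding N_def using fin c by (intro sum_mono prod_mono conjI powr_mono2) (auto intro!: card_mono)
  also have "\<dots> = (\<Sum>Q\<in>\<kappa> 0 ` P. \<Sum>p\<in>{p \<in> P. \<kappa> 0 p = Q}. \<Prod>j\<in>M. N 0 j (\<kappa> 0 p) powr c)"
    using fin by (intro sum.group[symmetric]) auto
  also have "\<dots> = (\<Sum>Q\<in>\<kappa> 0 ` P. card {p \<in> P. \<kappa> 0 p = Q} * (\<Prod>j\<in>M. N 0 j Q powr c))"
    by (intro sum.cong refl) simp
  also have "\<dots> \<le> (\<Sum>Q\<in>\<kappa> 0 ` P. E * (\<Prod>j\<in>M. N 0 j Q powr c))"
  proof (intro sum_mono mult_right_mono prod_nonneg ballI)
    fix Q
    have "card {p \<in> P. \<kappa> 0 p = Q} \<le> card {p \<in> P. \<forall>i\<in>J. \<lfloor>\<Phi> p i / \<delta>\<rfloor> = Q i}"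
      using fin by (intro card_mono) (auto simp: \<kappa>_def)
    with cell[of Q] show "card {p \<in> P. \<kappa> 0 p = Q} \<le> E" by linarith
  qed auto
  also have "\<dots> = E * S 0" by (simp add: S_def sum_distrib_left)
  also have "\<dots> \<le> E * ((V ^ 2) ^ s * S s)" using \<open>0 \<le> E\<close> by (intro mult_left_mono iter)
  also have "\<dots> \<le> E * ((V ^ 2) ^ s * (3 ^ card J * (\<Prod>j\<in>M. real (card (F j)) powr c)))"
    using \<open>0 \<le> E\<close> V1 by (intro mult_left_mono top) auto
  finally show ?thesis by (simp add: V_def mult_ac)
qed

section \<open>Flat sets of directions and dual bases\<close>

definition lin_form :: "'i set \<Rightarrow> ('i \<Rightarrow> real) \<Rightarrow> ('i \<Rightarrow> real) \<Rightarrow> real" where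
  "lin_form I \<psi> z = (\<Sum>i\<in>I. \<psi> i * z i)"

lemma lin_form_diff: "lin_form I \<psi> (\<lambda>i. x i - y i) = lin_form I \<psi> x - lin_form I \<psi> y"
  by (simp add: lin_form_def algebra_simps sum_subtractf)

lemma lin_form_add: "lin_form I \<psi> (\<lambda>i. x i + y i) = lin_form I \<psi> x + lin_form I \<psi> y"
  by (simp add: lin_form_def algebra_simps sum.distrib)

lemma lin_form_scale: "lin_form I \<psi> (\<lambda>i. k * x i) = k * lin_form I \<psi> x"
  by (simp add: lin_form_def sum_distrib_left algebra_simps)

lemma lin_form_diff_scale_left: "lin_form I (\<lambda>i. \<psi> i - k * \<xi> i) z = lin_form I \<psi> z - k * lin_form I \<xi> z"
  by (simp add: lin_form_def left_diff_distrib sum_subtractf sum_distrib_left mult.assoc)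

lemma abs_lin_form_le:
  fixes H B :: real
  assumes "\<And>i. i \<in> I \<Longrightarrow> \<bar>\<psi> i\<bar> \<le> H" "\<And>i. i \<in> I \<Longrightarrow> \<bar>z i\<bar> \<le> B" "0 \<le> B"
  shows "\<bar>lin_form I \<psi> z\<bar> \<le> card I * H * B"
proof -
  have "\<bar>lin_form I \<psi> z\<bar> \<le> (\<Sum>i\<in>I. \<bar>\<psi> i * z i\<bar>)" unfolding lin_form_def by (rule sum_abs)
  also have "\<dots> \<le> (\<Sum>i\<in>I. H * B)"
    using assms by (intro sum_mono) (auto simp: abs_mult intro!: mult_mono intro: order_trans[OF abs_ge_zero])
  finally show ?thesis by (simp add: mult_ac)
qed

text \<open>The coefficient bound that results from the recursive construction of dual functionals in
  \<open>flat_or_dual_basis\<close>.\<close>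

fun dual_bound :: "real \<Rightarrow> nat \<Rightarrow> real" where
  "dual_bound \<eta> 0 = 1"
| "dual_bound \<eta> (Suc d) = dual_bound \<eta> d + (2 ^ d + 1) * (1 + 2 * d * dual_bound \<eta> d) / \<eta>"

lemma dual_bound_ge_1: "0 < \<eta> \<Longrightarrow> 1 \<le> dual_bound \<eta> d"
proof (induction d)
  case (Suc d)
  have "1 \<le> dual_bound \<eta> d" using Suc by blast
  moreover from this have "0 \<le> (2 ^ d + 1) * (1 + 2 * real d * dual_bound \<eta> d) / \<eta>"
    using Suc.prems by (intro divide_nonneg_pos mult_nonneg_nonneg add_nonneg_nonneg) auto
  ultimately show ?case unfolding dual_bound.simps by linarith
qed simp

text \<open>Gaussian elimination with complete pivoting.  In every step the vector and the coordinate with the largest residual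
  are chosen; if that residual is at most \<open>\<eta>\<close>, the vectors chosen so far span an approximating subspace.  The choice
  of the largest pivot keeps the dual functionals bounded by \<open>2 ^ d\<close> on \<open>W\<close> independently of \<open>\<eta>\<close>, which makes
  the count in \<open>card_cells_flat\<close> sharp in \<open>K\<close>.\<close>

lemma flat_or_dual_basis:
  fixes W :: "('i \<Rightarrow> real) set"
  assumes "finite I" "finite W" "0 < \<eta>" and W: "\<forall>w\<in>W. \<forall>i\<in>I. \<bar>w i\<bar> \<le> 2"
  shows "(\<exists>j<d. \<exists>c \<psi>. (\<forall>m<j. c m \<in> W) \<and> (\<forall>w\<in>W. \<forall>m<j. \<bar>lin_form I (\<psi> m) w\<bar> \<le> 2 ^ j)
            \<and> (\<forall>w\<in>W. \<forall>i\<in>I. \<bar>w i - (\<Sum>m<j. lin_form I (\<psi> m) w * c m i)\<bar> \<le> \<eta>))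
       \<or> (\<exists>c \<psi>. (\<forall>m<d. c m \<in> W) \<and> (\<forall>w\<in>W. \<forall>m<d. \<bar>lin_form I (\<psi> m) w\<bar> \<le> 2 ^ d)
            \<and> (\<forall>m<d. \<forall>l<d. lin_form I (\<psi> m) (c l) = of_bool (m = l))
            \<and> (\<forall>m<d. \<forall>i\<in>I. \<bar>\<psi> m i\<bar> \<le> dual_bound \<eta> d))"
    (is "?flat d \<or> ?dual d")
proof (induction d)
  case 0
  show ?case by simp
next
  case (Suc d)
  from Suc.IH consider "?flat d" | "?dual d" by blast
  then show ?case
  proof cases
    case 1
    then have "?flat (Suc d)" using less_SucI by blast
    then show ?thesis by blast
  next
    case 2
    then obtain c \<psi> where c: "\<And>m. m < d \<Longrightarrow> c m \<in> W"
      and \<psi>: "\<And>w m. w \<in> W \<Longrightarrow> m < d \<Longrightarrow> \<bar>lin_form I (\<psi> m) w\<bar> \<le> 2 ^ d"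
      and dual: "\<And>m l. m < d \<Longrightarrow> l < d \<Longrightarrow> lin_form I (\<psi> m) (c l) = of_bool (m = l)"
      and bd: "\<And>m i. m < d \<Longrightarrow> i \<in> I \<Longrightarrow> \<bar>\<psi> m i\<bar> \<le> dual_bound \<eta> d"
      by metis
    define R where "R w i = w i - (\<Sum>m<d. lin_form I (\<psi> m) w * c m i)" for w i
    show ?thesis
    proof (cases "\<forall>w\<in>W. \<forall>i\<in>I. \<bar>R w i\<bar> \<le> \<eta>")
      case True
      have "?flat (Suc d)"
        by (rule exI[of _ d], rule conjI[OF lessI], rule exI[of _ c], rule exI[of _ \<psi>])
          (use True c \<psi> in \<open>auto simp: R_def\<close>)
      then show ?thesis by blast
    next
      case False
      \<comment> \<open>Maximality of this entry is what bounds the new functional by \<open>1\<close> on \<open>W\<close>.\<close>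
      define X where "X = (\<lambda>(w, i). \<bar>R w i\<bar>) ` (W \<times> I)"
      have "finite X" "X \<noteq> {}" using False assms by (auto simp: X_def)
      then have "Max X \<in> X" by simp
      then obtain w0 i0 where w0: "w0 \<in> W" "i0 \<in> I" "Max X = \<bar>R w0 i0\<bar>" by (auto simp: X_def)
      have max: "\<bar>R w i\<bar> \<le> \<bar>R w0 i0\<bar>" if "w \<in> W" "i \<in> I" for w i
        using that \<open>finite X\<close> unfolding w0(3)[symmetric] by (intro Max_ge) (auto simp: X_def)
      define \<rho> where "\<rho> = R w0 i0"
      have \<rho>: "\<eta> < \<bar>\<rho>\<bar>" using False max unfolding \<rho>_def by (meson le_less_trans not_le)
      then have \<rho>0: "\<rho> \<noteq> 0" using \<open>0 < \<eta>\<close> by auto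
      define \<xi> where "\<xi> i = (of_bool (i = i0) - (\<Sum>m<d. \<psi> m i * c m i0)) / \<rho>" for i
      have lin_\<xi>: "lin_form I \<xi> w = R w i0 / \<rho>" for w
      proof -
        have "lin_form I \<xi> w = (\<Sum>i\<in>I. (of_bool (i = i0) * w i - (\<Sum>m<d. \<psi> m i * w i * c m i0)) / \<rho>)"
          unfolding lin_form_def \<xi>_def by (intro sum.cong refl) (simp add: algebra_simps sum_distrib_left)
        also have "\<dots> = ((\<Sum>i\<in>I. of_bool (i = i0) * w i) - (\<Sum>i\<in>I. \<Sum>m<d. \<psi> m i * w i * c m i0)) / \<rho>"
          by (simp add: sum_subtractf flip: sum_divide_distrib)
        also have "(\<Sum>i\<in>I. of_bool (i = i0) * w i) = w i0"
          using w0 \<open>finite I\<close> by (simp add: of_bool_def if_distrib[of "\<lambda>x. x * _"] sum.delta cong: if_cong)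
        also have "(\<Sum>i\<in>I. \<Sum>m<d. \<psi> m i * w i * c m i0) = (\<Sum>m<d. lin_form I (\<psi> m) w * c m i0)"
          by (subst sum.swap) (simp add: lin_form_def sum_distrib_right)
        finally show ?thesis by (simp add: R_def)
      qed
      \<comment> \<open>The new functional is subtracted from the old ones so that they vanish on the new vector.\<close>
      define \<psi>' where "\<psi>' m i = (if m < d then \<psi> m i - lin_form I (\<psi> m) w0 * \<xi> i else \<xi> i)" for m i
      have lin_\<psi>': "lin_form I (\<psi>' m) w = (if m < d then lin_form I (\<psi> m) w - lin_form I (\<psi> m) w0 * lin_form I \<xi> w else lin_form I \<xi> w)" for m w
        using lin_form_diff_scale_left[of I "\<psi> m" "lin_form I (\<psi> m) w0" \<xi> w] by (simp add: lin_form_def \<psi>'_def)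
      define c' where "c' m = (if m < d then c m else w0)" for m
      have \<xi>_c: "lin_form I \<xi> (c l) = 0" if "l < d" for l
      proof -
        have "(\<Sum>m<d. lin_form I (\<psi> m) (c l) * c m i0) = (\<Sum>m<d. of_bool (m = l) * c m i0)"
          using dual that by (intro sum.cong) auto
        also have "\<dots> = c l i0"
          using that by (simp add: of_bool_def if_distrib[of "\<lambda>x. x * _"] sum.delta cong: if_cong)
        finally show ?thesis by (simp add: lin_\<xi> R_def)
      qed
      have \<xi>_w0: "lin_form I \<xi> w0 = 1" using \<rho>0 by (simp add: lin_\<xi> \<rho>_def)
      have \<xi>_W: "\<bar>lin_form I \<xi> w\<bar> \<le> 1" if "w \<in> W" for w
        using max[OF that w0(2)] \<rho>0 by (simp add: lin_\<xi> \<rho>_def abs_divide)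
      define H where "H = dual_bound \<eta> d"
      have H: "1 \<le> H" using dual_bound_ge_1 assms by (simp add: H_def)
      have \<xi>_bd: "\<bar>\<xi> i\<bar> \<le> (1 + 2 * d * H) / \<eta>" if "i \<in> I" for i
      proof -
        have "\<bar>\<Sum>m<d. \<psi> m i * c m i0\<bar> \<le> (\<Sum>m<d. \<bar>\<psi> m i * c m i0\<bar>)" by (rule sum_abs)
        also have "\<dots> \<le> (\<Sum>m<d. H * 2)"
          using bd[OF _ that] W c w0(2) H
          by (intro sum_mono) (auto simp: abs_mult H_def intro!: mult_mono)
        finally have "\<bar>of_bool (i = i0) - (\<Sum>m<d. \<psi> m i * c m i0)\<bar> \<le> 1 + 2 * d * H"
          by (auto simp: of_bool_def)
        then have "\<bar>\<xi> i\<bar> \<le> (1 + 2 * d * H) / \<bar>\<rho>\<bar>"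
          unfolding \<xi>_def abs_divide by (intro divide_right_mono) auto
        also have "\<dots> \<le> (1 + 2 * d * H) / \<eta>"
          using \<rho> H \<open>0 < \<eta>\<close> by (intro divide_left_mono) auto
        finally show ?thesis .
      qed
      have "?dual (Suc d)"
      proof (rule exI[of _ c'], rule exI[of _ \<psi>'], intro conjI allI ballI impI)
        show "c' m \<in> W" for m using c w0 by (auto simp: c'_def)
        show "\<bar>lin_form I (\<psi>' m) w\<bar> \<le> 2 ^ Suc d" if w: "w \<in> W" and m: "m < Suc d" for w m
        proof (cases "m < d")
          case True
          have "\<bar>lin_form I (\<psi> m) w0 * lin_form I \<xi> w\<bar> \<le> 2 ^ d * 1"
            unfolding abs_mult using \<psi>[OF w0(1) True] \<xi>_W[OF w] by (intro mult_mono) auto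
          then show ?thesis using \<psi>[OF w True] True by (simp add: lin_\<psi>')
        next
          case False
          have "(1::real) \<le> 2 ^ Suc d" by (rule one_le_power) simp
          moreover have "lin_form I (\<psi>' m) w = lin_form I \<xi> w" using False by (simp add: lin_\<psi>')
          ultimately show ?thesis using \<xi>_W[OF w] by linarith
        qed
        show "lin_form I (\<psi>' m) (c' l) = of_bool (m = l)" if "m < Suc d" "l < Suc d" for m l
          using that dual[of m l] \<xi>_c[of l] \<xi>_w0 by (auto simp: lin_\<psi>' c'_def less_Suc_eq)
        show "\<bar>\<psi>' m i\<bar> \<le> dual_bound \<eta> (Suc d)" if m: "m < Suc d" and i: "i \<in> I" for m i
        proof -
          define Y where "Y = (1 + 2 * d * H) / \<eta>"
          have Y: "0 \<le> Y" using H \<open>0 < \<eta>\<close> by (simp add: Y_def)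
          have eq: "dual_bound \<eta> (Suc d) = H + (2 ^ d * Y + Y)"
            by (simp add: H_def Y_def algebra_simps add_divide_distrib)
          show ?thesis
          proof (cases "m < d")
            case True
            have "\<bar>lin_form I (\<psi> m) w0 * \<xi> i\<bar> \<le> 2 ^ d * Y"
              unfolding abs_mult using \<psi>[OF w0(1) True] \<xi>_bd[OF i] by (intro mult_mono) (auto simp: Y_def)
            then show ?thesis unfolding eq using bd[OF True i] True Y by (simp add: \<psi>'_def H_def)
          next
            case False
            have "0 \<le> 2 ^ d * Y" using Y by simp
            then show ?thesis unfolding eq using \<xi>_bd[OF i] H False by (simp add: \<psi>'_def Y_def)
          qed
        qed
      qed
      then show ?thesis by blast
    qed
  qed
qed

lemma card_image_fibre_le:
  fixes a b :: real
  assumes "finite S" "card (g ` S) \<le> a" "\<And>x. x \<in> S \<Longrightarrow> card (f ` {y \<in> S. g y = g x}) \<le> b" "0 \<le> b"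
  shows "card (f ` S) \<le> a * b"
proof -
  have "f ` S = (\<Union>z\<in>g ` S. f ` {y \<in> S. g y = z})" by auto
  then have "card (f ` S) \<le> (\<Sum>z\<in>g ` S. card (f ` {y \<in> S. g y = z}))"
    using card_UN_le[of "g ` S" "\<lambda>z. f ` {y \<in> S. g y = z}"] \<open>finite S\<close> by simp
  then have "real (card (f ` S)) \<le> (\<Sum>z\<in>g ` S. real (card (f ` {y \<in> S. g y = z})))"
    by (simp only: of_nat_sum[symmetric] of_nat_le_iff)
  also have "\<dots> \<le> (\<Sum>z\<in>g ` S. b)" using assms(3) by (intro sum_mono) auto
  also have "\<dots> \<le> a * b" using assms by (simp add: mult_right_mono)
  finally show ?thesis .
qed

text \<open>Coordinates outside \<open>I\<close> get the value \<open>0\<close>, so that a cell is determined by its coordinates in \<open>I\<close>.\<close>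

definition cell :: "'i set \<Rightarrow> nat \<Rightarrow> ('i \<Rightarrow> real) \<Rightarrow> 'i \<Rightarrow> int" where
  "cell I K w = (\<lambda>i. if i \<in> I then \<lfloor>K * w i\<rfloor> else 0)"

text \<open>The values of the \<open>j\<close> functionals on \<open>W\<close> lie in a bounded box, which has \<open>O(K ^ j)\<close> cells of side
  \<open>1 / K\<close>, and by flatness they determine the vector up to \<open>O(1 / K)\<close>.\<close>

lemma card_cells_flat:
  fixes W :: "('i \<Rightarrow> real) set"
  assumes "finite I" "finite W" "1 \<le> K"
    and \<psi>: "\<And>w m. w \<in> W \<Longrightarrow> m < j \<Longrightarrow> \<bar>lin_form I (\<psi> m) (\<lambda>i. w i - w0 i)\<bar> \<le> 2 ^ j"
    and c: "\<And>m i. m < j \<Longrightarrow> i \<in> I \<Longrightarrow> \<bar>c m i\<bar> \<le> 2"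
    and flat: "\<And>w i. w \<in> W \<Longrightarrow> i \<in> I \<Longrightarrow>
        \<bar>w i - w0 i - (\<Sum>m<j. lin_form I (\<psi> m) (\<lambda>i. w i - w0 i) * c m i)\<bar> \<le> 1 / K"
  shows "card (cell I K ` W) \<le> (2 ^ (j + 2) * real K) ^ j * real ((4 * j + 7) ^ card I)"
proof -
  define y where "y m w = lin_form I (\<psi> m) (\<lambda>i. w i - w0 i)" for m w
  define g where "g w = (\<lambda>m. if m < j then \<lfloor>K * y m w\<rfloor> else 0)" for w
  show ?thesis
  proof (rule card_image_fibre_le[where g = g])
    have "card (g ` W) \<le> (2 * (2 ^ j * K) + 1) ^ card {..<j}"
    proof (rule card_int_box_le[THEN conjunct2, of _ _ "\<lambda>_. 0"])
      fix Q m assume "Q \<in> g ` W" "m \<in> {..<j}"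
      then obtain w where w: "w \<in> W" "m < j" "Q m = \<lfloor>K * y m w\<rfloor>" by (auto simp: g_def)
      have "\<bar>K * y m w\<bar> \<le> real K * 2 ^ j"
        unfolding abs_mult using \<psi>[OF w(1,2)] by (intro mult_mono) (auto simp: y_def)
      then have "\<bar>K * y m w\<bar> \<le> of_int (int (2 ^ j * K))" by (simp add: mult.commute)
      then show "\<bar>Q m - 0\<bar> \<le> int (2 ^ j * K)" unfolding w(3) by linarith
    qed (auto simp: g_def)
    also have "\<dots> \<le> (2 ^ (j + 2) * K) ^ j"
      using \<open>1 \<le> K\<close> by (auto intro!: power_mono simp: power_add)
    finally have "real (card (g ` W)) \<le> real ((2 ^ (j + 2) * K) ^ j)" by (simp only: of_nat_le_iff)
    then show "real (card (g ` W)) \<le> (2 ^ (j + 2) * real K) ^ j" by simp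
  next
    fix w assume w: "w \<in> W"
    have "card (cell I K ` {w' \<in> W. g w' = g w}) \<le> (2 * (2 * j + 3) + 1) ^ card I"
    proof (rule card_int_box_le[THEN conjunct2, of _ _ "cell I K w"])
      fix Q i assume "Q \<in> cell I K ` {w' \<in> W. g w' = g w}" and i: "i \<in> I"
      then obtain w' where w': "w' \<in> W" "g w' = g w" "Q = cell I K w'" by blast
      have yd: "\<bar>K * y m w' - K * y m w\<bar> \<le> 1" if "m < j" for m
      proof -
        have "\<lfloor>K * y m w'\<rfloor> = \<lfloor>K * y m w\<rfloor>" using fun_cong[OF w'(2), of m] that by (simp add: g_def)
        then show ?thesis by linarith
      qed
      have "\<bar>K * ((\<Sum>m<j. y m w' * c m i) - (\<Sum>m<j. y m w * c m i))\<bar>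
          = \<bar>\<Sum>m<j. (K * y m w' - K * y m w) * c m i\<bar>"
        by (simp add: sum_subtractf[symmetric] sum_distrib_left algebra_simps)
      also have "\<dots> \<le> (\<Sum>m<j. \<bar>(K * y m w' - K * y m w) * c m i\<bar>)" by (rule sum_abs)
      also have "\<dots> \<le> (\<Sum>m<j. 1 * 2)"
        unfolding abs_mult using yd c i by (intro sum_mono mult_mono) auto
      finally have s: "\<bar>K * ((\<Sum>m<j. y m w' * c m i) - (\<Sum>m<j. y m w * c m i))\<bar> \<le> 2 * real j" by simp
      have e: "\<bar>K * (w i - w0 i - (\<Sum>m<j. y m w * c m i))\<bar> \<le> 1" if "w \<in> W" for w
      proof -
        have "\<bar>K * (w i - w0 i - (\<Sum>m<j. y m w * c m i))\<bar> \<le> real K * (1 / real K)"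
          unfolding abs_mult using flat[OF that i] by (intro mult_mono) (auto simp: y_def)
        then show ?thesis using \<open>1 \<le> K\<close> by simp
      qed
      have "\<bar>K * w' i - K * w i\<bar> \<le> real (2 * j + 2)"
        using e[OF w] e[OF w'(1)] s by (simp add: algebra_simps abs_le_iff)
      from abs_floor_diff_le[OF this] show "\<bar>Q i - cell I K w i\<bar> \<le> int (2 * j + 3)"
        using i w'(3) by (simp add: cell_def)
    qed (use assms in \<open>auto simp: cell_def\<close>)
    then have "card (cell I K ` {w' \<in> W. g w' = g w}) \<le> (4 * j + 7) ^ card I"
      by (simp add: algebra_simps)
    then show "real (card (cell I K ` {w' \<in> W. g w' = g w})) \<le> real ((4 * j + 7) ^ card I)"
      by (simp only: of_nat_le_iff)
  qed (use assms in auto)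
qed

section \<open>Families of tubes in transversal directions\<close>

text \<open>The line \<open>l\<close> is the graph \<open>\<tau> \<mapsto> a l + \<tau> * v l\<close>, and the point \<open>p\<close> has time \<open>t p\<close> and position \<open>x p\<close>.  Points and
  lines are indexed by arbitrary types, so that an affine change of coordinates changes only the maps.\<close>

definition incident ::
  "'i set \<Rightarrow> real \<Rightarrow> ('l \<Rightarrow> 'i \<Rightarrow> real) \<Rightarrow> ('l \<Rightarrow> 'i \<Rightarrow> real) \<Rightarrow> ('p \<Rightarrow> real) \<Rightarrow> ('p \<Rightarrow> 'i \<Rightarrow> real) \<Rightarrow> 'l \<Rightarrow> 'p \<Rightarrow> bool" where
  "incident I \<delta> a v t x l p \<longleftrightarrow> (\<forall>i\<in>I. \<bar>x p i - a l i - t p * v l i\<bar> \<le> \<delta>)"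

text \<open>Points are distributed no more densely than a grid along any tube of width \<open>\<delta>\<close>.  The slope \<open>\<omega>\<close> is unrestricted,
  which makes the property invariant under shears, and \<open>D\<close> does not change under rescaling.\<close>

definition spread ::
  "'i set \<Rightarrow> real \<Rightarrow> real \<Rightarrow> 'p set \<Rightarrow> ('p \<Rightarrow> real) \<Rightarrow> ('p \<Rightarrow> 'i \<Rightarrow> real) \<Rightarrow> bool" where
  "spread I \<delta> D P t x \<longleftrightarrow> (\<forall>w\<ge>\<delta>. \<forall>\<tau> \<alpha> \<omega>.
     real (card {p \<in> P. \<bar>t p - \<tau>\<bar> \<le> w \<and> (\<forall>i\<in>I. \<bar>x p i - \<alpha> i - t p * \<omega> i\<bar> \<le> \<delta>)}) \<le> D * w)"

text \<open>The points \<open>c 0, \<dots>, c d\<close> are affinely independent in a quantitative sense, witnessed by functionals that are dual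
  to the differences from \<open>c 0\<close>.\<close>

definition dual_to :: "'i set \<Rightarrow> nat \<Rightarrow> real \<Rightarrow> (nat \<Rightarrow> 'i \<Rightarrow> real) \<Rightarrow> (nat \<Rightarrow> 'i \<Rightarrow> real) \<Rightarrow> bool" where
  "dual_to I d H c \<psi> \<longleftrightarrow> (\<forall>m\<in>{1..d}. (\<forall>i\<in>I. \<bar>\<psi> m i\<bar> \<le> H)
     \<and> (\<forall>k\<in>{1..d}. lin_form I (\<psi> m) (\<lambda>i. c k i - c 0 i) = of_bool (m = k)))"

lemma ex_power_between:
  fixes X :: real
  assumes "1 \<le> X" "2 \<le> (m::nat)"
  shows "\<exists>s. X \<le> real m ^ s \<and> real m ^ s \<le> m * X"
proof -
  define s where "s = (LEAST s. X \<le> real m ^ s)"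
  have "\<exists>s. X \<le> real m ^ s" using real_arch_pow[of "real m" X] assms less_imp_le by fastforce
  then have s: "X \<le> real m ^ s" unfolding s_def by (rule LeastI_ex)
  have "real m ^ s \<le> m * X"
  proof (cases s)
    case 0
    have "1 * 1 \<le> real m * X" using assms by (intro mult_mono) auto
    then show ?thesis using 0 by simp
  next
    case (Suc k)
    then have "\<not> X \<le> real m ^ k" unfolding s_def by (metis lessI not_less_Least)
    then have "real m * real m ^ k \<le> m * X" by (intro mult_left_mono) auto
    then show ?thesis using Suc by simp
  qed
  with s show ?thesis by blast
qed

text \<open>The lines of the \<open>j\<close>-th family have slopes close to \<open>c j\<close>, that is, directions close to \<open>(1, c j)\<close> in space-time.
  These \<open>d + 1\<close> vectors are linearly independent, with dual functionals \<open>\<Psi> 0, \<dots>, \<Psi> d\<close> obtained from \<open>\<psi>\<close>.  The \<open>\<Psi> m\<close>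
  together with the components \<open>\<Theta> i\<close> of the residual along these vectors form a redundant
  system of coordinates in which \<open>multilinear_Kakeya_grid\<close> applies.  Redundancy is harmless
  and avoids a completion to a basis.  The order in which the constants are chosen matters: \<open>H\<close> fixes \<open>b\<close> and hence the
  cost \<open>C0\<close> of one scale, then \<open>m\<close> is taken so large that \<open>C0 \<le> m powr \<epsilon>\<close>, and finally \<open>K\<close>, the closeness of the
  slopes, depends on \<open>m\<close>.\<close>

lemma transversal_families_bound:
  fixes H \<epsilon> :: real and N d :: nat
  assumes d: "1 \<le> d" and H: "1 \<le> H" and \<epsilon>: "0 < \<epsilon>"
  shows "\<exists>(K::nat) C. 1 \<le> K \<and> 1 \<le> C \<and>
    (\<forall>(I::'i set) \<delta> D (P::'p set) t x (a::'l \<Rightarrow> 'i \<Rightarrow> real) v F c \<psi>.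
      finite I \<longrightarrow> card I = N \<longrightarrow> 0 < \<delta> \<longrightarrow> \<delta> \<le> 1 \<longrightarrow> 0 \<le> D \<longrightarrow> finite P \<longrightarrow>
      (\<forall>p\<in>P. \<bar>t p\<bar> \<le> 1 \<and> (\<forall>i\<in>I. \<bar>x p i\<bar> \<le> 3)) \<longrightarrow> spread I \<delta> D P t x \<longrightarrow>
      (\<forall>j\<le>d. finite (F j) \<and> (\<forall>i\<in>I. \<bar>c j i\<bar> \<le> 1 \<and> (\<forall>l\<in>F j. \<bar>v l i - c j i\<bar> \<le> 1 / K))) \<longrightarrow>
      dual_to I d H c \<psi> \<longrightarrow>
      (\<Sum>p\<in>P. \<Prod>j\<le>d. real (card {l \<in> F j. incident I \<delta> a v t x l p}) powr (1 / d))
        \<le> C * \<delta> powr (1 - \<epsilon>) * D * (\<Prod>j\<le>d. real (card (F j)) powr (1 / d)))"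
proof -
  define B1 where "B1 = 1 + real (d + 1) * d * N * H"
  define b where "b = nat \<lceil>4 * B1 * (d + 2)\<rceil>"
  define C0 where "C0 = (real ((2 * b + 5) ^ (d + 1 + N))) ^ 2"
  define m where "m = max 2 (nat \<lceil>C0 powr (1 / \<epsilon>)\<rceil>)"
  define K where "K = nat \<lceil>2 * B1 * m\<rceil>"
  define R where "R = 3 + real (d + 1) * (1 + 4 * d * N * H)"
  define C where "C = (m * R * (d + 2)) powr \<epsilon> * 3 ^ (d + 1 + N)"
  have B1: "1 \<le> B1" "N * H \<le> B1" "d * (N * H) \<le> B1" "1 + (d + 1) * (d * (N * H)) = B1"
  proof -
    show "1 \<le> B1" using H by (simp add: B1_def)
    show "1 + (d + 1) * (d * (N * H)) = B1" by (simp add: B1_def mult_ac)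
    have 1: "N * H \<le> d * (N * H)" using d H mult_right_mono[of 1 "real d" "N * H"] by auto
    have "1 * (d * (N * H)) \<le> (d + 1) * (d * (N * H))" using H by (intro mult_right_mono) auto
    then show 2: "d * (N * H) \<le> B1" by (simp add: B1_def mult_ac)
    show "N * H \<le> B1" using 1 2 by linarith
  qed
  have "real 1 \<le> real ((2 * b + 5) ^ (d + 1 + N))" unfolding of_nat_le_iff by (rule one_le_power) simp
  then have C0: "1 \<le> C0" unfolding C0_def by (intro one_le_power) simp
  have m2: "2 \<le> m" by (simp add: m_def)
  have C0m: "C0 \<le> m powr \<epsilon>"
  proof -
    have "C0 powr (1 / \<epsilon>) \<le> m" by (simp add: m_def) linarith
    then have "(C0 powr (1 / \<epsilon>)) powr \<epsilon> \<le> m powr \<epsilon>" using \<epsilon> by (intro powr_mono2) auto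
    then show ?thesis using C0 \<epsilon> by (simp add: powr_powr)
  qed
  have K: "2 * B1 * m \<le> K" by (simp add: K_def) linarith
  have "1 * 1 \<le> B1 * m" using B1 m2 by (intro mult_mono) auto
  then have K1: "1 \<le> K" using K by linarith
  have R: "1 \<le> R" using H by (simp add: R_def)
  have C1: "1 \<le> C"
  proof -
    have "1 * 1 * 1 \<le> m * R * (d + 2)" using m2 R by (intro mult_mono) auto
    then have "1 \<le> (m * R * (d + 2)) powr \<epsilon>" using \<epsilon> by (intro ge_one_powr_ge_zero) auto
    moreover have "(1::real) \<le> 3 ^ (d + 1 + N)" by (rule one_le_power) simp
    ultimately have "1 * 1 \<le> C" unfolding C_def by (intro mult_mono) auto
    then show ?thesis by simp
  qed
  show ?thesis
  proof (intro exI[of _ K] exI[of _ C] conjI K1 C1 allI impI)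
    fix I :: "'i set" and \<delta> D :: real and P :: "'p set" and t :: "'p \<Rightarrow> real" and x :: "'p \<Rightarrow> 'i \<Rightarrow> real"
      and a v :: "'l \<Rightarrow> 'i \<Rightarrow> real" and F :: "nat \<Rightarrow> 'l set" and c \<psi> :: "nat \<Rightarrow> 'i \<Rightarrow> real"
    assume I: "finite I" "card I = N" and \<delta>: "0 < \<delta>" "\<delta> \<le> 1" and D: "0 \<le> D" and P: "finite P"
      and tx: "\<forall>p\<in>P. \<bar>t p\<bar> \<le> 1 \<and> (\<forall>i\<in>I. \<bar>x p i\<bar> \<le> 3)" and spr: "spread I \<delta> D P t x"
      and F: "\<forall>j\<le>d. finite (F j) \<and> (\<forall>i\<in>I. \<bar>c j i\<bar> \<le> 1 \<and> (\<forall>l\<in>F j. \<bar>v l i - c j i\<bar> \<le> 1 / K))"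
      and dual: "dual_to I d H c \<psi>"
    note \<psi> = dual[unfolded dual_to_def]
    define inc where "inc = incident I \<delta> a v t x"
    \<comment> \<open>\<open>U m\<close> kills \<open>(1, c 0)\<close> and is dual to the other directions; \<open>\<Psi> 0\<close> is what is missing to the time \<open>t\<close>,
      which equals \<open>1\<close> on every direction.\<close>
    define U where "U m p = lin_form I (\<psi> m) (\<lambda>i. x p i - t p * c 0 i)" for m p
    define \<Psi> where "\<Psi> m p = (if m = 0 then t p - (\<Sum>k=1..d. U k p) else U m p)" for m p
    define \<Theta> where "\<Theta> i p = x p i - (\<Sum>m\<le>d. \<Psi> m p * c m i)" for i p
    define \<Phi> where "\<Phi> p = case_sum (\<lambda>m. \<Psi> m p) (\<lambda>i. \<Theta> i p)" for p
    define J where "J = Inl ` {..d} \<union> Inr ` I"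
    define F' :: "nat + 'i \<Rightarrow> 'l set" where "F' = case_sum F (\<lambda>_. {})"
    \<comment> \<open>Cells have side \<open>\<delta>1 = \<delta> / (d + 2)\<close>, so that a cell lies in a box of side \<open>\<delta>\<close> in the original coordinates and \<open>spread\<close>
      bounds the number of its points.\<close>
    define \<delta>1 where "\<delta>1 = \<delta> / (d + 2)"
    have \<delta>1: "0 < \<delta>1" "\<delta>1 * (d + 2) = \<delta>" using \<delta> by (auto simp: \<delta>1_def)
    have sum_split: "(\<Sum>m\<le>d. f m) = f 0 + (\<Sum>m=1..d. f m)" for f :: "nat \<Rightarrow> real"
      by (simp add: sum.atLeast1_atMost_eq sum.atMost_shift lessThan_Suc_atMost del: sum.lessThan_Suc sum.atMost_Suc)
    have t_eq: "t p = (\<Sum>m\<le>d. \<Psi> m p)" for p by (simp add: sum_split \<Psi>_def)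
    have cardJ: "finite J" "card J = d + 1 + N"
    proof -
      have "J = {..d} <+> I" by (simp add: J_def Plus_def)
      then show "finite J" "card J = d + 1 + N" using I by (simp_all add: card_Plus)
    qed
    have cardM: "card (Inl ` {..d} :: (nat + 'i) set) = d + 1" by (simp add: card_image inj_on_def)
    \<comment> \<open>Along a tube of the \<open>j\<close>-th family \<open>\<Psi> j\<close> moves like the time, and all other coordinates stay almost constant.\<close>
    have tube: "\<bar>\<Psi> k p - \<Psi> k p' - of_bool (k = j) * (t p - t p')\<bar> \<le> B1 * (\<bar>t p - t p'\<bar> / K + 2 * \<delta>) \<and>
        (i \<in> I \<longrightarrow> \<bar>\<Theta> i p - \<Theta> i p'\<bar> \<le> B1 * (\<bar>t p - t p'\<bar> / K + 2 * \<delta>))"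
      if j: "j \<le> d" and l: "l \<in> F j" and p: "p \<in> P" "p' \<in> P" "inc l p" "inc l p'" and k: "k \<le> d"
      for j l p p' k i
    proof -
      define \<Delta> where "\<Delta> = t p - t p'"
      define u where "u = \<bar>\<Delta>\<bar> / K + 2 * \<delta>"
      have u: "0 \<le> u" using \<delta> by (simp add: u_def)
      define g where "g i = x p i - x p' i - \<Delta> * c j i" for i
      have g: "\<bar>g i\<bar> \<le> u" if "i \<in> I" for i
      proof -
        have 1: "\<bar>x p i - a l i - t p * v l i\<bar> \<le> \<delta>" "\<bar>x p' i - a l i - t p' * v l i\<bar> \<le> \<delta>"
          using p that by (auto simp: inc_def incident_def)
        have "\<bar>\<Delta> * (v l i - c j i)\<bar> \<le> \<bar>\<Delta>\<bar> * (1 / K)"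
          unfolding abs_mult using F j l that by (intro mult_left_mono) auto
        moreover have "g i = (x p i - a l i - t p * v l i) - (x p' i - a l i - t p' * v l i) + \<Delta> * (v l i - c j i)"
          by (simp add: g_def \<Delta>_def algebra_simps)
        ultimately show ?thesis using 1 by (simp add: u_def)
      qed
      define e where "e k = \<Psi> k p - \<Psi> k p' - of_bool (k = j) * \<Delta>" for k
      have eU: "U k p - U k p' - of_bool (k = j) * \<Delta> = lin_form I (\<psi> k) g" if "k \<in> {1..d}" for k
      proof -
        have "U k p - U k p' = lin_form I (\<psi> k) (\<lambda>i. g i + \<Delta> * (c j i - c 0 i))"
          unfolding U_def lin_form_diff[symmetric] g_def \<Delta>_def
          by (rule arg_cong[of _ _ "lin_form I (\<psi> k)"]) (auto simp: algebra_simps)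
        also have "\<dots> = lin_form I (\<psi> k) g + \<Delta> * lin_form I (\<psi> k) (\<lambda>i. c j i - c 0 i)"
          by (simp add: lin_form_add lin_form_scale)
        also have "lin_form I (\<psi> k) (\<lambda>i. c j i - c 0 i) = of_bool (k = j)"
          using \<psi> that j by (cases "j = 0") (auto simp: lin_form_def)
        finally show ?thesis by simp
      qed
      have linb: "\<bar>lin_form I (\<psi> k) g\<bar> \<le> N * H * u" if "k \<in> {1..d}" for k
        using abs_lin_form_le[of I "\<psi> k" H g u] \<psi> that g u I by auto
      have e: "\<bar>e k\<bar> \<le> d * (N * H) * u" if "k \<le> d" for k
      proof (cases "k = 0")
        case False
        then have "\<bar>e k\<bar> \<le> N * H * u" using eU[of k] linb[of k] that by (simp add: e_def \<Psi>_def)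
        also have "\<dots> \<le> d * (N * H) * u" using d H u mult_right_mono[of 1 "real d" "N * H"] by (intro mult_right_mono) auto
        finally show ?thesis .
      next
        case True
        have "(\<Sum>k=1..d. of_bool (k = j) * \<Delta>) = (\<Sum>k\<le>d. of_bool (k = j) * \<Delta>) - of_bool (j = 0) * \<Delta>"
          unfolding sum_split by auto
        also have "(\<Sum>k\<le>d. of_bool (k = j) * \<Delta>) = \<Delta>"
          using j by (simp add: of_bool_def if_distrib[of "\<lambda>x. x * _"] sum.delta cong: if_cong)
        finally have "e 0 = - (\<Sum>k=1..d. U k p - U k p' - of_bool (k = j) * \<Delta>)"
          by (simp add: e_def \<Psi>_def \<Delta>_def sum_subtractf)
        also have "\<dots> = - (\<Sum>k=1..d. lin_form I (\<psi> k) g)" using eU by simp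
        finally have "\<bar>e 0\<bar> \<le> (\<Sum>k=1..d. \<bar>lin_form I (\<psi> k) g\<bar>)" using sum_abs[of "\<lambda>k. lin_form I (\<psi> k) g"] by simp
        also have "\<dots> \<le> (\<Sum>k=1..d. N * H * u)" by (intro sum_mono linb)
        finally show ?thesis using True by (simp add: mult_ac)
      qed
      have "\<bar>e k\<bar> \<le> B1 * u"
        using e[OF k] mult_right_mono[OF B1(3) u] by linarith
      moreover have "\<bar>\<Theta> i p - \<Theta> i p'\<bar> \<le> B1 * u" if i: "i \<in> I"
      proof -
        have "(\<Sum>m\<le>d. of_bool (m = j) * \<Delta> * c m i) = \<Delta> * c j i"
          using j by (simp add: of_bool_def if_distrib[of "\<lambda>x. x * _"] sum.delta cong: if_cong)
        then have "(\<Sum>m\<le>d. \<Psi> m p * c m i) - (\<Sum>m\<le>d. \<Psi> m p' * c m i) = (\<Sum>m\<le>d. e m * c m i) + \<Delta> * c j i"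
          by (simp add: e_def algebra_simps sum.distrib sum_subtractf)
        then have "\<Theta> i p - \<Theta> i p' = g i - (\<Sum>m\<le>d. e m * c m i)"
          by (simp add: \<Theta>_def g_def)
        moreover have "\<bar>\<Sum>m\<le>d. e m * c m i\<bar> \<le> (\<Sum>m\<le>d. d * (N * H) * u * 1)"
          using e F i by (intro order_trans[OF sum_abs] sum_mono, unfold abs_mult, intro mult_mono) (auto intro: order_trans[OF abs_ge_zero])
        ultimately have "\<bar>\<Theta> i p - \<Theta> i p'\<bar> \<le> u + (d + 1) * (d * (N * H)) * u"
          using g[OF i] by (simp add: mult_ac)
        also have "\<dots> = (1 + (d + 1) * (d * (N * H))) * u" by (simp add: algebra_simps)
        also have "\<dots> = B1 * u" by (simp only: B1(4))
        finally show ?thesis .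
      qed
      ultimately show ?thesis by (simp add: e_def u_def \<Delta>_def)
    qed
    have UB: "\<bar>U k p\<bar> \<le> 4 * N * H" if "p \<in> P" "k \<in> {1..d}" for k p
    proof -
      have "\<bar>x p i - t p * c 0 i\<bar> \<le> 4" if "i \<in> I" for i
      proof -
        have "\<bar>t p * c 0 i\<bar> \<le> 1 * 1" unfolding abs_mult using tx F that \<open>p \<in> P\<close> by (intro mult_mono) auto
        moreover have "\<bar>x p i\<bar> \<le> 3" using tx that \<open>p \<in> P\<close> by auto
        ultimately show ?thesis by linarith
      qed
      then show ?thesis using abs_lin_form_le[of I "\<psi> k" H _ 4] \<psi> that I by (auto simp: U_def mult_ac)
    qed
    have \<Psi>B: "\<bar>\<Psi> k p\<bar> \<le> 1 + 4 * d * N * H" if "p \<in> P" "k \<le> d" for k p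
    proof (cases "k = 0")
      case True
      have "\<bar>\<Sum>k=1..d. U k p\<bar> \<le> (\<Sum>k=1..d. 4 * N * H)"
        using UB that by (intro order_trans[OF sum_abs] sum_mono) auto
      moreover have "\<bar>t p\<bar> \<le> 1" using tx that by auto
      ultimately show ?thesis using True by (simp add: \<Psi>_def mult_ac)
    next
      case False
      have "1 * (4 * N * H) \<le> d * (4 * N * H)" using d H by (intro mult_right_mono) auto
      then show ?thesis using UB[of p k] that False by (simp add: \<Psi>_def mult_ac)
    qed
    have \<Theta>B: "\<bar>\<Theta> i p\<bar> \<le> R" if "p \<in> P" "i \<in> I" for i p
    proof -
      have "\<bar>\<Sum>m\<le>d. \<Psi> m p * c m i\<bar> \<le> (\<Sum>m\<le>d. (1 + 4 * d * N * H) * 1)"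
        using \<Psi>B F that by (intro order_trans[OF sum_abs] sum_mono, unfold abs_mult, intro mult_mono) (auto intro: order_trans[OF abs_ge_zero])
      moreover have "\<bar>x p i\<bar> \<le> 3" using tx that by auto
      ultimately show ?thesis by (simp add: \<Theta>_def R_def)
    qed
    have \<Phi>B: "\<bar>\<Phi> p i\<bar> \<le> R" if "p \<in> P" "i \<in> J" for p i
    proof -
      have "1 + 4 * d * N * H \<le> (d + 1) * (1 + 4 * d * N * H)"
        using H mult_right_mono[of 1 "real (d + 1)" "1 + 4 * d * N * H"] by simp
      then have "1 + 4 * d * N * H \<le> R" by (simp add: R_def)
      then show ?thesis using \<Psi>B \<Theta>B that by (force simp: J_def \<Phi>_def)
    qed
    have "1 \<le> R / \<delta>1"
    proof -
      have "\<delta>1 * 1 \<le> \<delta>1 * (d + 2)" using \<delta>1 by (intro mult_left_mono) auto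
      then have "\<delta>1 \<le> R" using \<delta>1(2) \<delta> R by linarith
      then show ?thesis using \<delta>1 by (simp add: pos_le_divide_eq)
    qed
    from ex_power_between[OF this m2] obtain s where s: "R / \<delta>1 \<le> m ^ s" "m ^ s \<le> m * (R / \<delta>1)" by auto
    have "(\<Sum>p\<in>P. \<Prod>j\<in>Inl ` {..d}. real (card {l \<in> F' j. inc l p}) powr (1 / d))
      \<le> D * \<delta> * ((real ((2 * b + 5) ^ card J)) ^ 2) ^ s * 3 ^ card J * (\<Prod>j\<in>Inl ` {..d}. real (card (F' j)) powr (1 / d))"
    proof (rule multilinear_Kakeya_grid[where \<Phi> = \<Phi> and \<delta> = \<delta>1 and m = m])
      show "1 / real d * (real (card (Inl ` {..d} :: (nat + 'i) set)) - 1) = 1" using d by (simp only: cardM) simp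
      show "\<bar>\<Phi> p i - \<Phi> p' i\<bar> \<le> \<bar>\<Phi> p j - \<Phi> p' j\<bar> / real m + real b * \<delta>1"
        if h: "j \<in> Inl ` {..d}" "l \<in> F' j" "p \<in> P" "p' \<in> P" "inc l p" "inc l p'" "i \<in> J" "i \<noteq> j" for j l p p' i
      proof -
        obtain j' where j': "j = Inl j'" "j' \<le> d" using h by auto
        then have l: "l \<in> F j'" using h by (simp add: F'_def)
        define \<Delta> where "\<Delta> = \<bar>t p - t p'\<bar>"
        define G where "G = \<bar>\<Phi> p j - \<Phi> p' j\<bar>"
        \<comment> \<open>\<open>\<theta>\<close> is the rate at which the other coordinates drift with time; \<open>K\<close> makes it at most \<open>1 / (2 * m)\<close>.\<close>
        define \<theta> where "\<theta> = B1 / K"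
        have \<theta>: "0 \<le> \<theta>" "2 * \<theta> \<le> 1 / m" "\<theta> \<le> 1 / 2"
        proof -
          show "0 \<le> \<theta>" using B1 by (simp add: \<theta>_def)
          have "B1 * 1 \<le> B1 * m" using B1 m2 by (intro mult_left_mono) auto
          with K K1 m2 show "2 * \<theta> \<le> 1 / m" "\<theta> \<le> 1 / 2"
            by (auto simp: \<theta>_def divide_simps mult_ac)
        qed
        have eq: "B1 * (\<Delta> / K + 2 * \<delta>) = \<theta> * \<Delta> + 2 * B1 * \<delta>"
          by (simp add: \<theta>_def algebra_simps)
        note tb = tube[OF j'(2) l h(3-6), folded \<Delta>_def, unfolded eq]
        have "\<bar>\<Phi> p j - \<Phi> p' j - (t p - t p')\<bar> \<le> \<theta> * \<Delta> + 2 * B1 * \<delta>"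
          using tb[of j'] j' by (simp add: \<Phi>_def)
        then have "\<Delta> \<le> G + \<theta> * \<Delta> + 2 * B1 * \<delta>" unfolding G_def \<Delta>_def by linarith
        moreover have "\<theta> * \<Delta> \<le> 1 / 2 * \<Delta>" using \<theta> by (intro mult_right_mono) (auto simp: \<Delta>_def)
        ultimately have \<Delta>: "\<Delta> \<le> 2 * G + 4 * B1 * \<delta>" by linarith
        have "\<bar>\<Phi> p i - \<Phi> p' i\<bar> \<le> \<theta> * \<Delta> + 2 * B1 * \<delta>"
        proof (cases i)
          case (Inl k)
          then have "k \<le> d" "k \<noteq> j'" using h(7,8) j' by (auto simp: J_def)
          then show ?thesis using tb[of k] Inl by (simp add: \<Phi>_def)
        next
          case (Inr i')
          then have "i' \<in> I" using h(7) by (auto simp: J_def)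
          then show ?thesis using tb[of 0 i'] Inr by (simp add: \<Phi>_def)
        qed
        also have "\<theta> * \<Delta> \<le> \<theta> * (2 * G + 4 * B1 * \<delta>)" using \<theta> \<Delta> by (intro mult_left_mono) auto
        also have "\<dots> = 2 * \<theta> * G + \<theta> * (4 * B1 * \<delta>)" by (simp add: algebra_simps)
        also have "2 * \<theta> * G \<le> 1 / m * G" using \<theta> by (intro mult_right_mono) (auto simp: G_def)
        also have "\<theta> * (4 * B1 * \<delta>) \<le> 1 / 2 * (4 * B1 * \<delta>)" using \<theta> B1 \<delta> by (intro mult_right_mono) auto
        finally have "\<bar>\<Phi> p i - \<Phi> p' i\<bar> \<le> G / m + 4 * B1 * \<delta>" by simp
        also have "4 * B1 * \<delta> = (4 * B1 * (d + 2)) * \<delta>1"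
          unfolding \<delta>1(2)[symmetric] by simp
        also have "\<dots> \<le> b * \<delta>1" using \<delta>1 unfolding b_def by (intro mult_right_mono) linarith+
        finally show ?thesis by (simp add: G_def)
      qed
      show "card {p \<in> P. \<forall>i\<in>J. \<lfloor>\<Phi> p i / \<delta>1\<rfloor> = Q i} \<le> D * \<delta>" for Q
      proof (cases "{p \<in> P. \<forall>i\<in>J. \<lfloor>\<Phi> p i / \<delta>1\<rfloor> = Q i} = {}")
        case True
        then show ?thesis using D \<delta> by (simp only: True) simp
      next
        case False
        then obtain p0 where p0: "p0 \<in> P" "\<forall>i\<in>J. \<lfloor>\<Phi> p0 i / \<delta>1\<rfloor> = Q i" by blast
        have sub: "{p \<in> P. \<forall>i\<in>J. \<lfloor>\<Phi> p i / \<delta>1\<rfloor> = Q i}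
            \<subseteq> {p \<in> P. \<bar>t p - t p0\<bar> \<le> \<delta> \<and> (\<forall>i\<in>I. \<bar>x p i - x p0 i - t p * 0\<bar> \<le> \<delta>)}"
        proof safe
          fix p assume p: "p \<in> P" "\<forall>i\<in>J. \<lfloor>\<Phi> p i / \<delta>1\<rfloor> = Q i"
          have close: "\<bar>\<Phi> p i - \<Phi> p0 i\<bar> \<le> \<delta>1" if "i \<in> J" for i
          proof -
            have "\<lfloor>\<Phi> p i / \<delta>1\<rfloor> = \<lfloor>\<Phi> p0 i / \<delta>1\<rfloor>" using p p0 that by simp
            then have "\<bar>\<Phi> p i / \<delta>1 - \<Phi> p0 i / \<delta>1\<bar> \<le> 1" by linarith
            then show ?thesis using \<delta>1 by (simp add: abs_diff_divide_le_iff)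
          qed
          have \<Psi>c: "\<bar>\<Psi> k p - \<Psi> k p0\<bar> \<le> \<delta>1" if "k \<le> d" for k
            using close[of "Inl k"] that by (simp add: \<Phi>_def J_def)
          have "\<bar>t p - t p0\<bar> = \<bar>\<Sum>k\<le>d. \<Psi> k p - \<Psi> k p0\<bar>" by (simp add: t_eq sum_subtractf)
          also have "\<dots> \<le> (\<Sum>k\<le>d. \<delta>1)" using \<Psi>c by (intro order_trans[OF sum_abs] sum_mono) auto
          finally show "\<bar>t p - t p0\<bar> \<le> \<delta>" using \<delta>1 by (simp add: algebra_simps)
          fix i assume i: "i \<in> I"
          have "\<bar>\<Sum>k\<le>d. (\<Psi> k p - \<Psi> k p0) * c k i\<bar> \<le> (\<Sum>k\<le>d. \<delta>1 * 1)"
            using \<Psi>c F i \<delta>1 by (intro order_trans[OF sum_abs] sum_mono, unfold abs_mult, intro mult_mono) auto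
          moreover have "x p i - x p0 i = \<Theta> i p - \<Theta> i p0 + (\<Sum>k\<le>d. (\<Psi> k p - \<Psi> k p0) * c k i)"
            by (simp add: \<Theta>_def left_diff_distrib sum_subtractf)
          moreover have "\<bar>\<Theta> i p - \<Theta> i p0\<bar> \<le> \<delta>1" using close[of "Inr i"] i by (simp add: \<Phi>_def J_def)
          ultimately show "\<bar>x p i - x p0 i - t p * 0\<bar> \<le> \<delta>" using \<delta>1 by (simp add: algebra_simps)
        qed
        have "card {p \<in> P. \<forall>i\<in>J. \<lfloor>\<Phi> p i / \<delta>1\<rfloor> = Q i}
            \<le> real (card {p \<in> P. \<bar>t p - t p0\<bar> \<le> \<delta> \<and> (\<forall>i\<in>I. \<bar>x p i - x p0 i - t p * 0\<bar> \<le> \<delta>)})"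
          unfolding of_nat_le_iff using sub P by (intro card_mono) auto
        also have "\<dots> \<le> D * \<delta>" using spr[unfolded spread_def, rule_format, of \<delta> "t p0" "x p0" "\<lambda>_. 0"] by simp
        finally show ?thesis .
      qed
      show "\<bar>\<Phi> p i\<bar> \<le> \<delta>1 * real (m ^ s)" if "p \<in> P" "i \<in> J" for p i
        using \<Phi>B[OF that] s(1) \<delta>1 by (simp add: pos_divide_le_eq mult.commute)
    qed (use P cardJ F \<delta>1 d m2 D \<delta> in \<open>auto simp: F'_def J_def\<close>)
    then have "(\<Sum>p\<in>P. \<Prod>j\<le>d. real (card {l \<in> F j. inc l p}) powr (1 / d))
      \<le> D * \<delta> * C0 ^ s * 3 ^ (d + 1 + N) * (\<Prod>j\<le>d. real (card (F j)) powr (1 / d))"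
      by (simp add: prod.reindex F'_def C0_def cardJ(2) inj_on_def)
    also have "\<dots> \<le> D * \<delta> * ((m * R * (d + 2)) powr \<epsilon> * \<delta> powr - \<epsilon>) * 3 ^ (d + 1 + N) * (\<Prod>j\<le>d. real (card (F j)) powr (1 / d))"
    proof (intro mult_right_mono mult_left_mono prod_nonneg)
      have "C0 ^ s \<le> (m powr \<epsilon>) ^ s" using C0 C0m by (intro power_mono) auto
      also have "\<dots> = (m ^ s) powr \<epsilon>" using m2 by (simp add: powr_realpow[symmetric] powr_powr mult.commute)
      also have "\<dots> \<le> (m * (R / \<delta>1)) powr \<epsilon>" using s \<epsilon> by (intro powr_mono2) auto
      also have "m * (R / \<delta>1) = m * R * (d + 2) / \<delta>" by (simp add: \<delta>1_def)
      also have "\<dots> powr \<epsilon> = (m * R * (d + 2)) powr \<epsilon> * \<delta> powr - \<epsilon>"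
        using R \<delta> by (simp add: powr_divide powr_minus_divide)
      finally show "C0 ^ s \<le> (m * R * (d + 2)) powr \<epsilon> * \<delta> powr - \<epsilon>" .
    qed (use D \<delta> in auto)
    also have "\<dots> = C * (\<delta> * \<delta> powr - \<epsilon>) * D * (\<Prod>j\<le>d. real (card (F j)) powr (1 / d))"
      by (simp add: C_def mult_ac)
    also have "\<delta> * \<delta> powr - \<epsilon> = \<delta> powr (1 - \<epsilon>)" using \<delta> by (simp add: powr_diff powr_minus_divide)
    finally show "(\<Sum>p\<in>P. \<Prod>j\<le>d. real (card {l \<in> F j. incident I \<delta> a v t x l p}) powr (1 / d))
        \<le> C * \<delta> powr (1 - \<epsilon>) * D * (\<Prod>j\<le>d. real (card (F j)) powr (1 / d))"
      by (simp add: inc_def)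
  qed
qed

section \<open>Broad and narrow points, and rescaling\<close>

lemma finite_cells:
  assumes "finite I" and W: "\<And>w i. w \<in> W \<Longrightarrow> i \<in> I \<Longrightarrow> \<bar>w i\<bar> \<le> 1"
  shows "finite (cell I K ` W) \<and> card (cell I K ` W) \<le> (2 * K + 1) ^ card I"
proof (rule card_int_box_le[of I _ "\<lambda>_. 0"])
  fix Q i assume Q: "Q \<in> cell I K ` W" and i: "i \<in> I"
  then obtain w where w: "w \<in> W" "Q = cell I K w" by blast
  have "\<bar>K * w i\<bar> \<le> real K * 1" unfolding abs_mult using W[OF w(1) i] by (intro mult_mono) auto
  then have "\<bar>\<lfloor>K * w i\<rfloor>\<bar> \<le> int K" by linarith
  then show "\<bar>Q i - 0\<bar> \<le> int K" using w i by (simp add: cell_def)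
qed (use assms in \<open>auto simp: cell_def\<close>)

lemma cell_eq_imp_close:
  assumes "cell I K w = cell I K w'" "i \<in> I" "1 \<le> K"
  shows "\<bar>w i - w' i\<bar> \<le> 1 / K"
proof -
  have "\<lfloor>K * w i\<rfloor> = \<lfloor>K * w' i\<rfloor>" using fun_cong[OF assms(1), of i] assms(2) by (simp add: cell_def)
  then have "\<bar>K * w i - K * w' i\<bar> \<le> 1" by linarith
  then have "\<bar>real K * (w i - w' i)\<bar> \<le> 1" by (simp add: right_diff_distrib)
  then show ?thesis using assms(3) by (simp add: abs_mult pos_le_divide_eq mult.commute)
qed

text \<open>The constant of \<open>card_cells_flat\<close>, uniform in the dimension of the plane.\<close>

definition narrow_const :: "nat \<Rightarrow> real" where
  "narrow_const N = real ((2 ^ (N + 2)) ^ N * (4 * N + 7) ^ N)"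

text \<open>Lines whose slope lies in a poor fine cell, of side \<open>1 / k\<close>, are discarded; as there are at most \<open>T\<close> cells, this
  loses at most half of the lines.  The slopes of the others are either within \<open>1 / K\<close> of an affine plane of
  dimension at most \<open>d - 1\<close>, or they contain the vertices of a nondegenerate simplex, by \<open>flat_or_dual_basis\<close>
  for their differences from one of them.\<close>

lemma broad_or_narrow:
  fixes v :: "'l \<Rightarrow> 'i \<Rightarrow> real" and k :: nat and T :: real
  assumes I: "finite I" "card I = N" and L: "finite L" and d: "1 \<le> d" "d \<le> N" and K: "1 \<le> K"
    and v: "\<And>l i. l \<in> L \<Longrightarrow> i \<in> I \<Longrightarrow> \<bar>v l i\<bar> \<le> 1"
  defines "T \<equiv> real ((2 * k + 1) ^ N)"
  shows "(\<exists>c \<psi>. dual_to I d (dual_bound (1 / K) d) c \<psi> \<and> (\<forall>j\<le>d. c j \<in> v ` L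
            \<and> card L \<le> 2 * T * card {l \<in> L. cell I k (v l) = cell I k (c j)}))
       \<or> (\<exists>Z. finite Z \<and> card Z \<le> narrow_const N * real K ^ (d - 1)
            \<and> card L \<le> 2 * card {l \<in> L. cell I K (v l) \<in> Z})"
proof -
  define n where "n \<kappa> = real (card {l \<in> L. cell I k (v l) = \<kappa>})" for \<kappa>
  define S where "S = {l \<in> L. card L \<le> 2 * T * n (cell I k (v l))}"
  have T1: "1 \<le> T"
  proof -
    have "real 1 \<le> T" unfolding T_def of_nat_le_iff by (rule one_le_power) simp
    then show ?thesis by simp
  qed
  have S: "finite S" "S \<subseteq> L" using L by (auto simp: S_def)
  \<comment> \<open>Each poor cell holds fewer than \<open>card L / (2 * T)\<close> lines.\<close>
  have many: "card L \<le> 2 * card S"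
  proof -
    let ?X = "(\<lambda>l. cell I k (v l)) ` (L - S)"
    have X: "finite ?X" "card ?X \<le> (2 * k + 1) ^ N"
      using finite_cells[of I "v ` (L - S)" k] I v by (auto simp: image_image)
    have "card (L - S) = (\<Sum>\<kappa>\<in>?X. card {l \<in> L - S. cell I k (v l) = \<kappa>})"
      unfolding card_eq_sum using L X(1) by (intro sum.group[symmetric]) auto
    then have "real (card (L - S)) = (\<Sum>\<kappa>\<in>?X. real (card {l \<in> L - S. cell I k (v l) = \<kappa>}))" by simp
    also have "\<dots> \<le> (\<Sum>\<kappa>\<in>?X. real (card L) / (2 * T))"
    proof (rule sum_mono)
      fix \<kappa> assume "\<kappa> \<in> ?X"
      then have "2 * T * n \<kappa> < card L" by (auto simp: S_def)
      then have "n \<kappa> \<le> card L / (2 * T)" using T1 by (simp add: pos_le_divide_eq mult.commute)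
      moreover have "real (card {l \<in> L - S. cell I k (v l) = \<kappa>}) \<le> n \<kappa>"
        unfolding n_def of_nat_le_iff using L by (intro card_mono) auto
      ultimately show "real (card {l \<in> L - S. cell I k (v l) = \<kappa>}) \<le> card L / (2 * T)" by linarith
    qed
    also have "\<dots> = real (card ?X) * (real (card L) / (2 * T))" by simp
    also have "\<dots> \<le> T * (real (card L) / (2 * T))"
    proof (rule mult_right_mono)
      show "real (card ?X) \<le> T" unfolding T_def of_nat_le_iff by (rule X(2))
    qed (use T1 in simp)
    also have "\<dots> = card L / 2" using T1 by simp
    finally have "2 * card (L - S) \<le> card L" by linarith
    moreover have "card L = card S + card (L - S)"
      using S L by (metis card_Diff_subset card_mono le_add_diff_inverse)
    ultimately show ?thesis by linarith
  qed
  show ?thesis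
  proof (cases "S = {}")
    case True
    then have "card L = 0" using many by simp
    moreover have "0 \<le> narrow_const N * real K ^ (d - 1)" by (simp add: narrow_const_def)
    ultimately show ?thesis by (intro disjI2 exI[of _ "{}"]) auto
  next
    case False
    then obtain l0 where l0: "l0 \<in> S" by blast
    define W where "W = (\<lambda>l i. v l i - v l0 i) ` S"
    have W: "\<forall>w\<in>W. \<forall>i\<in>I. \<bar>w i\<bar> \<le> 2"
    proof (intro ballI)
      fix w i assume "w \<in> W" "i \<in> I"
      then obtain l where "l \<in> L" "w i = v l i - v l0 i" using S by (auto simp: W_def)
      moreover have "l0 \<in> L" using l0 S by blast
      ultimately show "\<bar>w i\<bar> \<le> 2" using v[of l i] v[of l0 i] \<open>i \<in> I\<close> by linarith
    qed
    have fW: "finite W" and K0: "0 < 1 / real K" using S K by (auto simp: W_def)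
    from flat_or_dual_basis[of I W "1 / real K" d, OF I(1) fW K0 W] show ?thesis
    proof (elim disjE exE conjE)
      fix j c \<psi> assume j: "j < d" and c: "\<forall>m<j. c m \<in> W"
        and \<psi>: "\<forall>w\<in>W. \<forall>m<j. \<bar>lin_form I (\<psi> m) w\<bar> \<le> 2 ^ j"
        and flat: "\<forall>w\<in>W. \<forall>i\<in>I. \<bar>w i - (\<Sum>m<j. lin_form I (\<psi> m) w * c m i)\<bar> \<le> 1 / real K"
      define Z where "Z = cell I K ` v ` S"
      have "card Z \<le> (2 ^ (j + 2) * real K) ^ j * real ((4 * j + 7) ^ card I)"
        unfolding Z_def
      proof (rule card_cells_flat[of I _ K j \<psi> "v l0" c])
        show "\<bar>c m i\<bar> \<le> 2" if "m < j" "i \<in> I" for m i using c W that by blast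
        fix w assume "w \<in> v ` S"
        then have w: "(\<lambda>i. w i - v l0 i) \<in> W" by (auto simp: W_def)
        then show "\<bar>lin_form I (\<psi> m) (\<lambda>i. w i - v l0 i)\<bar> \<le> 2 ^ j" if "m < j" for m
          using \<psi> that by blast
        show "\<bar>w i - v l0 i - (\<Sum>m<j. lin_form I (\<psi> m) (\<lambda>i. w i - v l0 i) * c m i)\<bar> \<le> 1 / real K"
          if "i \<in> I" for i using bspec[OF flat w] that by blast
      qed (use I S K in auto)
      also have "\<dots> = (2 ^ (j + 2)) ^ j * real ((4 * j + 7) ^ card I) * real K ^ j"
        by (simp add: power_mult_distrib mult_ac)
      also have "\<dots> \<le> narrow_const N * real K ^ (d - 1)"
      proof (intro mult_mono)
        have "(2 ^ (j + 2)) ^ j \<le> ((2 ^ (N + 2)) ^ N :: nat)"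
        proof -
          have "(2 ^ (j + 2)) ^ j \<le> ((2 ^ (N + 2)) ^ j :: nat)"
            using j d by (intro power_mono power_increasing) auto
          also have "\<dots> \<le> (2 ^ (N + 2)) ^ N" using j d by (intro power_increasing) auto
          finally show ?thesis .
        qed
        moreover have "(4 * j + 7) ^ card I \<le> (4 * N + 7) ^ N"
          using I j d by (auto intro!: power_mono)
        ultimately have "(2 ^ (j + 2)) ^ j * (4 * j + 7) ^ card I \<le> (2 ^ (N + 2)) ^ N * (4 * N + 7) ^ N"
          by (rule mult_mono) auto
        then have "real ((2 ^ (j + 2)) ^ j * (4 * j + 7) ^ card I) \<le> narrow_const N"
          unfolding narrow_const_def of_nat_le_iff .
        then show "(2 ^ (j + 2)) ^ j * real ((4 * j + 7) ^ card I) \<le> narrow_const N" by simp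
        show "real K ^ j \<le> real K ^ (d - 1)" using j K by (intro power_increasing) auto
      qed (auto simp: narrow_const_def)
      finally have "card Z \<le> narrow_const N * real K ^ (d - 1)" .
      moreover have "card S \<le> card {l \<in> L. cell I K (v l) \<in> Z}"
        using L S by (intro card_mono) (auto simp: Z_def)
      ultimately show ?thesis using many S by (intro disjI2 exI[of _ Z]) (auto simp: Z_def)
    next
      fix c \<psi> assume c: "\<forall>m<d. c m \<in> W" and \<psi>: "\<forall>w\<in>W. \<forall>m<d. \<bar>lin_form I (\<psi> m) w\<bar> \<le> 2 ^ d"
        and dual: "\<forall>m<d. \<forall>l<d. lin_form I (\<psi> m) (c l) = of_bool (m = l)"
        and bd: "\<forall>m<d. \<forall>i\<in>I. \<bar>\<psi> m i\<bar> \<le> dual_bound (1 / real K) d"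
      have "\<forall>m<d. \<exists>l\<in>S. c m = (\<lambda>i. v l i - v l0 i)" using c by (auto simp: W_def)
      then obtain l where l: "\<And>m. m < d \<Longrightarrow> l m \<in> S \<and> c m = (\<lambda>i. v (l m) i - v l0 i)" by metis
      define c' where "c' j = (if j = 0 then v l0 else v (l (j - 1)))" for j
      have "c' j \<in> v ` S" if "j \<le> d" for j
        using that l l0 by (cases "j = 0") (auto simp: c'_def)
      then have c'_rich: "c' j \<in> v ` L \<and> card L \<le> 2 * T * card {l \<in> L. cell I k (v l) = cell I k (c' j)}"
        if "j \<le> d" for j
        using that by (fastforce simp: S_def n_def)
      have c'_dual: "dual_to I d (dual_bound (1 / real K) d) c' (\<lambda>m. \<psi> (m - 1))"
        unfolding dual_to_def
      proof (intro ballI conjI)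
        fix m assume m: "m \<in> {1..d}"
        show "\<bar>\<psi> (m - 1) i\<bar> \<le> dual_bound (1 / real K) d" if "i \<in> I" for i
          using m bd that by auto
        fix k assume k: "k \<in> {1..d}"
        have "(\<lambda>i. c' k i - c' 0 i) = c (k - 1)" using l[of "k - 1"] k by (auto simp: c'_def)
        then show "lin_form I (\<psi> (m - 1)) (\<lambda>i. c' k i - c' 0 i) = of_bool (m = k)"
          using dual m k by auto
      qed
      show ?thesis
        by (rule disjI1, rule exI[of _ c'], rule exI[of _ "\<lambda>m. \<psi> (m - 1)"])
          (use c'_dual c'_rich in blast)
    qed
  qed
qed

text \<open>The nonconcentration hypothesis, with the supremum distance of \<open>(a, v)\<close> in place of the metric on lines.\<close>

definition spaced ::
  "'i set \<Rightarrow> real \<Rightarrow> real \<Rightarrow> real \<Rightarrow> 'l set \<Rightarrow> ('l \<Rightarrow> 'i \<Rightarrow> real) \<Rightarrow> ('l \<Rightarrow> 'i \<Rightarrow> real) \<Rightarrow> bool" where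
  "spaced I \<delta> A \<sigma> L a v \<longleftrightarrow> (\<forall>r\<ge>\<delta>. \<forall>\<alpha> \<omega>.
     real (card {l \<in> L. \<forall>i\<in>I. \<bar>a l i - \<alpha> i\<bar> \<le> r \<and> \<bar>v l i - \<omega> i\<bar> \<le> r}) \<le> A * (r / \<delta>) powr \<sigma>)"

lemma spread_subset:
  assumes "spread I \<delta> D P t x" "P' \<subseteq> P" "finite P"
  shows "spread I \<delta> D P' t x"
  unfolding spread_def
proof (intro allI impI)
  fix w \<tau> \<alpha> \<omega> assume w: "\<delta> \<le> w"
  have "real (card {p \<in> P'. \<bar>t p - \<tau>\<bar> \<le> w \<and> (\<forall>i\<in>I. \<bar>x p i - \<alpha> i - t p * \<omega> i\<bar> \<le> \<delta>)})
      \<le> real (card {p \<in> P. \<bar>t p - \<tau>\<bar> \<le> w \<and> (\<forall>i\<in>I. \<bar>x p i - \<alpha> i - t p * \<omega> i\<bar> \<le> \<delta>)})"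
    unfolding of_nat_le_iff using assms by (intro card_mono) auto
  also have "\<dots> \<le> D * w" using assms(1) w unfolding spread_def by blast
  finally show "real (card {p \<in> P'. \<bar>t p - \<tau>\<bar> \<le> w \<and> (\<forall>i\<in>I. \<bar>x p i - \<alpha> i - t p * \<omega> i\<bar> \<le> \<delta>)}) \<le> D * w" .
qed

lemma scaled_bound_iff:
  fixes K y r :: real
  assumes "0 < K"
  shows "\<bar>K * y\<bar> \<le> K * r \<longleftrightarrow> \<bar>y\<bar> \<le> r"
  using assms by (simp add: abs_mult)

lemma spread_rescale:
  assumes "spread I \<delta> D P t x" "1 \<le> K" "0 < \<delta>"
  shows "spread I (K * \<delta>) D P t (\<lambda>p i. K * (x p i - \<alpha>0 i - t p * \<omega>0 i))"
  unfolding spread_def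
proof (intro allI impI)
  fix w \<tau> \<alpha> \<omega> assume w: "K * \<delta> \<le> w"
  have "1 * \<delta> \<le> K * \<delta>" using assms by (intro mult_right_mono) auto
  then have w': "\<delta> \<le> w" using w by simp
  have "K * (x p i - \<alpha>0 i - t p * \<omega>0 i) - \<alpha> i - t p * \<omega> i
      = K * (x p i - (\<alpha>0 i + \<alpha> i / K) - t p * (\<omega>0 i + \<omega> i / K))" for p i
    using assms by (simp add: field_simps)
  then have "\<bar>K * (x p i - \<alpha>0 i - t p * \<omega>0 i) - \<alpha> i - t p * \<omega> i\<bar> \<le> K * \<delta>
      \<longleftrightarrow> \<bar>x p i - (\<alpha>0 i + \<alpha> i / K) - t p * (\<omega>0 i + \<omega> i / K)\<bar> \<le> \<delta>" for p i
    using assms by (simp only: scaled_bound_iff)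
  then show "real (card {p \<in> P. \<bar>t p - \<tau>\<bar> \<le> w \<and>
      (\<forall>i\<in>I. \<bar>K * (x p i - \<alpha>0 i - t p * \<omega>0 i) - \<alpha> i - t p * \<omega> i\<bar> \<le> K * \<delta>)}) \<le> D * w"
    using assms(1)[unfolded spread_def, rule_format, OF w', of \<tau> "\<lambda>i. \<alpha>0 i + \<alpha> i / K" "\<lambda>i. \<omega>0 i + \<omega> i / K"]
    by simp
qed

lemma spaced_rescale:
  assumes "spaced I \<delta> A \<sigma> L a v" "1 \<le> K" "0 < \<delta>" "L' \<subseteq> L" "finite L"
  shows "spaced I (K * \<delta>) A \<sigma> L' (\<lambda>l i. K * (a l i - \<alpha>0 i)) (\<lambda>l i. K * (v l i - \<omega>0 i))"
  unfolding spaced_def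
proof (intro allI impI)
  fix r \<alpha> \<omega> assume r: "K * \<delta> \<le> r"
  have r': "\<delta> \<le> r / K" using r assms by (simp add: pos_le_divide_eq mult.commute)
  have "K * (y - y0) - z = K * (y - (y0 + z / K))" for y y0 z
    using assms by (simp add: field_simps)
  then have eq: "\<bar>K * (y - y0) - z\<bar> \<le> r \<longleftrightarrow> \<bar>y - (y0 + z / K)\<bar> \<le> r / K" for y y0 z
    using assms scaled_bound_iff[of K _ "r / K"] by simp
  have "real (card {l \<in> L'. \<forall>i\<in>I. \<bar>K * (a l i - \<alpha>0 i) - \<alpha> i\<bar> \<le> r \<and> \<bar>K * (v l i - \<omega>0 i) - \<omega> i\<bar> \<le> r})
      \<le> real (card {l \<in> L. \<forall>i\<in>I. \<bar>a l i - (\<alpha>0 i + \<alpha> i / K)\<bar> \<le> r / K \<and> \<bar>v l i - (\<omega>0 i + \<omega> i / K)\<bar> \<le> r / K})"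
    unfolding of_nat_le_iff eq using assms by (intro card_mono) auto
  also have "\<dots> \<le> A * ((r / K) / \<delta>) powr \<sigma>"
    using assms(1)[unfolded spaced_def, rule_format, OF r', of "\<lambda>i. \<alpha>0 i + \<alpha> i / K" "\<lambda>i. \<omega>0 i + \<omega> i / K"]
    by simp
  finally show "real (card {l \<in> L'. \<forall>i\<in>I. \<bar>K * (a l i - \<alpha>0 i) - \<alpha> i\<bar> \<le> r \<and> \<bar>K * (v l i - \<omega>0 i) - \<omega> i\<bar> \<le> r})
      \<le> A * (r / (K * \<delta>)) powr \<sigma>" by simp
qed

lemma incident_rescale:
  assumes "0 < K"
  shows "incident I (K * \<delta>) (\<lambda>l i. K * (a l i - \<alpha>0 i)) (\<lambda>l i. K * (v l i - \<omega>0 i)) t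
      (\<lambda>p i. K * (x p i - \<alpha>0 i - t p * \<omega>0 i)) l p \<longleftrightarrow> incident I \<delta> a v t x l p"
proof -
  have "K * (x p i - \<alpha>0 i - t p * \<omega>0 i) - K * (a l i - \<alpha>0 i) - t p * (K * (v l i - \<omega>0 i))
      = K * (x p i - a l i - t p * v l i)" for i
    by (simp add: algebra_simps)
  then show ?thesis unfolding incident_def using assms by (simp only: scaled_bound_iff)
qed

text \<open>Double counting: \<open>spread\<close> at the scale \<open>w = 1\<close> allows at most \<open>D\<close> points on a line.\<close>

lemma sum_incident_le:
  fixes D :: real
  assumes "finite L" "finite P" and spr: "spread I \<delta> D P t x" and "\<delta> \<le> 1" and t: "\<And>p. p \<in> P \<Longrightarrow> \<bar>t p\<bar> \<le> 1"
  shows "(\<Sum>p\<in>P. real (card {l \<in> L. incident I \<delta> a v t x l p})) \<le> card L * D"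
proof -
  have "(\<Sum>p\<in>P. real (card {l \<in> L. incident I \<delta> a v t x l p}))
      = (\<Sum>l\<in>L. real (card {p \<in> P. incident I \<delta> a v t x l p}))"
    using assms by (simp only: real_card_filter) (rule sum.swap)
  also have "\<dots> \<le> (\<Sum>l\<in>L. D)"
  proof (rule sum_mono)
    fix l
    have "{p \<in> P. incident I \<delta> a v t x l p}
        = {p \<in> P. \<bar>t p - 0\<bar> \<le> 1 \<and> (\<forall>i\<in>I. \<bar>x p i - a l i - t p * v l i\<bar> \<le> \<delta>)}"
      using t by (auto simp: incident_def)
    then show "real (card {p \<in> P. incident I \<delta> a v t x l p}) \<le> D"
      using spr[unfolded spread_def, rule_format, OF \<open>\<delta> \<le> 1\<close>, of 0 "a l" "v l"] by simp
  qed
  finally show ?thesis by simp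
qed

section \<open>Bounds on the broad and on the narrow part\<close>

lemma prod_const_powr:
  assumes "1 \<le> (d::nat)" "0 \<le> (x::real)"
  shows "(\<Prod>j\<le>d. x powr (1 / d)) = x powr (1 + 1 / d)"
proof (cases "x = 0")
  case False
  then have "(\<Prod>j\<le>d. x powr (1 / d)) = (x powr (1 / d)) powr (d + 1)"
    using assms by (simp only: prod_constant card_atMost) (subst powr_realpow, auto)
  also have "\<dots> = x powr (1 / d * (d + 1))" by (rule powr_powr)
  also have "1 / d * (d + 1) = 1 + 1 / d" using assms by (simp add: field_simps)
  finally show ?thesis .
qed simp

text \<open>At a broad point the multiplicity \<open>f p\<close> is comparable to the multiplicity of each of \<open>d + 1\<close> transversal families, so
  that \<open>f p powr (1 + 1 / d)\<close> is comparable to the product of their powers \<open>1 / d\<close>.  The families depend on the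
  point, but there is only a bounded number of choices: a family is given by a fine cell.\<close>

lemma sum_broad_le:
  fixes T B H :: real and f :: "'p \<Rightarrow> real" and inc :: "'l \<Rightarrow> 'p \<Rightarrow> bool" and v :: "'l \<Rightarrow> 'i \<Rightarrow> real"
  assumes fin: "finite P" "finite L" and d: "1 \<le> d" and T: "1 \<le> T" "card (cell I k ` v ` L) \<le> T" and "0 \<le> B"
    and v: "\<And>l i. l \<in> L \<Longrightarrow> i \<in> I \<Longrightarrow> \<bar>v l i\<bar> \<le> 1" and k: "1 \<le> k"
    and trans: "\<And>F c \<psi>. \<forall>j\<le>d. finite (F j) \<and> (\<forall>i\<in>I. \<bar>c j i\<bar> \<le> 1 \<and> (\<forall>l\<in>F j. \<bar>v l i - c j i\<bar> \<le> 1 / k)) \<Longrightarrow>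
       dual_to I d H c \<psi> \<Longrightarrow>
       (\<Sum>p\<in>P. \<Prod>j\<le>d. real (card {l \<in> F j. inc l p}) powr (1 / d)) \<le> B * (\<Prod>j\<le>d. real (card (F j)) powr (1 / d))"
    and f: "\<And>p. p \<in> P \<Longrightarrow> 0 \<le> f p"
    and broad: "\<And>p. p \<in> P \<Longrightarrow> \<exists>c \<psi>. dual_to I d H c \<psi> \<and> (\<forall>j\<le>d. c j \<in> v ` L
        \<and> f p \<le> 2 * T * card {l \<in> {l \<in> L. inc l p}. cell I k (v l) = cell I k (c j)})"
  shows "(\<Sum>p\<in>P. f p powr (1 + 1 / d)) \<le> (2 * T) ^ 2 * T ^ (d + 1) * B * card L powr (1 + 1 / d)"
proof -
  define X where "X = cell I k ` v ` L"
  define good where "good \<kappa> \<longleftrightarrow> (\<exists>c \<psi>. dual_to I d H c \<psi> \<and> (\<forall>j\<le>d. c j \<in> v ` L \<and> cell I k (c j) = \<kappa> j))" for \<kappa>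
  define G where "G = {\<kappa> \<in> {..d} \<rightarrow>\<^sub>E X. good \<kappa>}"
  define F where "F \<kappa> j = {l \<in> L. cell I k (v l) = \<kappa> j}" for \<kappa> :: "nat \<Rightarrow> 'i \<Rightarrow> int" and j
  have finX: "finite X" using fin by (simp add: X_def)
  then have finPi: "finite ({..d} \<rightarrow>\<^sub>E X)" by (intro finite_PiE) auto
  have finG: "finite G" using finPi by (simp add: G_def)
  have cardG: "card G \<le> T ^ (d + 1)"
  proof -
    have "card G \<le> card ({..d} \<rightarrow>\<^sub>E X)" unfolding G_def using finPi by (intro card_mono) auto
    also have "\<dots> = card X ^ (d + 1)" by (simp add: card_PiE)
    finally have "real (card G) \<le> real (card X) ^ (d + 1)" by (metis of_nat_le_iff of_nat_power)
    also have "\<dots> \<le> T ^ (d + 1)" using T by (intro power_mono) (auto simp: X_def)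
    finally show ?thesis .
  qed
  have T2: "(2 * T) powr (1 + 1 / d) \<le> (2 * T) ^ 2"
  proof -
    have "(2 * T) powr (1 + 1 / d) \<le> (2 * T) powr 2" using T d by (intro powr_mono) auto
    then show ?thesis using T by simp
  qed
  have point: "f p powr (1 + 1 / d) \<le> (2 * T) ^ 2 * (\<Sum>\<kappa>\<in>G. \<Prod>j\<le>d. real (card {l \<in> F \<kappa> j. inc l p}) powr (1 / d))"
    if p: "p \<in> P" for p
  proof -
    obtain c \<psi> where c: "dual_to I d H c \<psi>" "\<And>j. j \<le> d \<Longrightarrow> c j \<in> v ` L"
      "\<And>j. j \<le> d \<Longrightarrow> f p \<le> 2 * T * card {l \<in> {l \<in> L. inc l p}. cell I k (v l) = cell I k (c j)}"
      using broad[OF p] by blast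
    define \<kappa> where "\<kappa> = restrict (\<lambda>j. cell I k (c j)) {..d}"
    have "good \<kappa>" unfolding good_def
      by (rule exI[of _ c], rule exI[of _ \<psi>]) (use c(1,2) in \<open>auto simp: \<kappa>_def\<close>)
    then have \<kappa>: "\<kappa> \<in> G" unfolding G_def using c(2) by (auto simp: \<kappa>_def X_def)
    have "f p powr (1 + 1 / d) = (\<Prod>j\<le>d. f p powr (1 / d))" using prod_const_powr d f p by simp
    also have "\<dots> \<le> (\<Prod>j\<le>d. (2 * T * card {l \<in> F \<kappa> j. inc l p}) powr (1 / d))"
    proof (intro prod_mono conjI powr_mono2)
      fix j assume "j \<in> {..d}"
      moreover have "{l \<in> {l \<in> L. inc l p}. cell I k (v l) = cell I k (c j)} = {l \<in> F \<kappa> j. inc l p}"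
        using \<open>j \<in> {..d}\<close> by (auto simp: F_def \<kappa>_def)
      ultimately show "f p \<le> 2 * T * card {l \<in> F \<kappa> j. inc l p}" using c(3)[of j] by simp
    qed (use f p in auto)
    also have "\<dots> = (\<Prod>j\<le>d. (2 * T) powr (1 / d)) * (\<Prod>j\<le>d. real (card {l \<in> F \<kappa> j. inc l p}) powr (1 / d))"
      unfolding prod.distrib[symmetric] by (intro prod.cong refl powr_mult)
    also have "(\<Prod>j\<le>d. (2 * T) powr (1 / d)) = (2 * T) powr (1 + 1 / d)"
      using T d by (intro prod_const_powr) auto
    also have "(2 * T) powr (1 + 1 / d) * (\<Prod>j\<le>d. real (card {l \<in> F \<kappa> j. inc l p}) powr (1 / d))
        \<le> (2 * T) ^ 2 * (\<Sum>\<kappa>\<in>G. \<Prod>j\<le>d. real (card {l \<in> F \<kappa> j. inc l p}) powr (1 / d))"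
      using \<kappa> finG T2
      by (intro mult_mono member_le_sum[where f = "\<lambda>\<kappa>. \<Prod>j\<le>d. real (card {l \<in> F \<kappa> j. inc l p}) powr (1 / d)"])
        (auto intro!: prod_nonneg)
    finally show ?thesis .
  qed
  have family: "(\<Sum>p\<in>P. \<Prod>j\<le>d. real (card {l \<in> F \<kappa> j. inc l p}) powr (1 / d)) \<le> B * card L powr (1 + 1 / d)"
    if \<kappa>: "\<kappa> \<in> G" for \<kappa>
  proof -
    obtain c \<psi> where c: "dual_to I d H c \<psi>" "\<And>j. j \<le> d \<Longrightarrow> c j \<in> v ` L \<and> cell I k (c j) = \<kappa> j"
      using \<kappa> by (auto simp: G_def good_def)
    have "(\<Sum>p\<in>P. \<Prod>j\<le>d. real (card {l \<in> F \<kappa> j. inc l p}) powr (1 / d)) \<le> B * (\<Prod>j\<le>d. real (card (F \<kappa> j)) powr (1 / d))"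
    proof (rule trans[OF _ c(1)], intro allI impI conjI ballI)
      fix j assume j: "j \<le> d"
      show "finite (F \<kappa> j)" using fin by (simp add: F_def)
      fix i assume i: "i \<in> I"
      show "\<bar>c j i\<bar> \<le> 1" using c(2)[OF j] v i by auto
      fix l assume "l \<in> F \<kappa> j"
      then have "cell I k (v l) = cell I k (c j)" using c(2)[OF j] by (simp add: F_def)
      from cell_eq_imp_close[OF this i k] show "\<bar>v l i - c j i\<bar> \<le> 1 / k" .
    qed
    also have "(\<Prod>j\<le>d. real (card (F \<kappa> j)) powr (1 / d)) \<le> (\<Prod>j\<le>d. real (card L) powr (1 / d))"
      using fin by (intro prod_mono conjI powr_mono2) (auto simp: F_def intro!: card_mono)
    also have "\<dots> = card L powr (1 + 1 / d)" using d by (intro prod_const_powr) auto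
    finally show ?thesis using \<open>0 \<le> B\<close> by (simp add: mult_left_mono)
  qed
  have "(\<Sum>p\<in>P. f p powr (1 + 1 / d))
      \<le> (\<Sum>p\<in>P. (2 * T) ^ 2 * (\<Sum>\<kappa>\<in>G. \<Prod>j\<le>d. real (card {l \<in> F \<kappa> j. inc l p}) powr (1 / d)))"
    by (intro sum_mono point)
  also have "\<dots> = (2 * T) ^ 2 * (\<Sum>\<kappa>\<in>G. \<Sum>p\<in>P. \<Prod>j\<le>d. real (card {l \<in> F \<kappa> j. inc l p}) powr (1 / d))"
    unfolding sum_distrib_left[symmetric] by (subst sum.swap) simp
  also have "\<dots> \<le> (2 * T) ^ 2 * (\<Sum>\<kappa>\<in>G. B * card L powr (1 + 1 / d))"
    by (intro mult_left_mono sum_mono family) auto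
  also have "\<dots> = (2 * T) ^ 2 * (card G * (B * card L powr (1 + 1 / d)))" by simp
  also have "\<dots> \<le> (2 * T) ^ 2 * (T ^ (d + 1) * (B * card L powr (1 + 1 / d)))"
    using cardG \<open>0 \<le> B\<close> by (intro mult_left_mono mult_right_mono) auto
  finally show ?thesis by (simp add: mult_ac)
qed

text \<open>The pieces are the sets of lines with \<open>a\<close> and \<open>v\<close> in given cells of side \<open>1 / K\<close>.  For lines through one point the
  cell of \<open>v\<close> determines that of \<open>a\<close> up to \<open>9 ^ N\<close> possibilities, so that the number of pieces is at most
  \<open>9 ^ N * B\<close>; convexity of the power does the rest.\<close>

lemma narrow_powr_le:
  fixes q B :: real and a v :: "'l \<Rightarrow> 'i \<Rightarrow> real"
  assumes I: "finite I" "card I = N" and L: "finite L" and K: "1 \<le> K" "\<delta> \<le> 1 / K" and "\<bar>t p\<bar> \<le> 1" and q: "1 \<le> q"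
  defines "\<tau> \<equiv> \<lambda>l. (cell I K (a l), cell I K (v l))"
  assumes Z: "finite Z" "card Z \<le> B"
    and narrow: "card {l \<in> L. incident I \<delta> a v t x l p} \<le>
        2 * card {l \<in> {l \<in> L. incident I \<delta> a v t x l p}. cell I K (v l) \<in> Z}"
  shows "card {l \<in> L. incident I \<delta> a v t x l p} powr q \<le> 2 powr q * (9 ^ N * B) powr (q - 1) *
      (\<Sum>z\<in>\<tau> ` L. card {l \<in> {l \<in> L. \<tau> l = z}. incident I \<delta> a v t x l p} powr q)"
proof -
  define S where "S = {l \<in> {l \<in> L. incident I \<delta> a v t x l p}. cell I K (v l) \<in> Z}"
  define y where "y z = real (card {l \<in> {l \<in> L. \<tau> l = z}. incident I \<delta> a v t x l p})" for z
  have S: "finite S" "S \<subseteq> L" using L by (auto simp: S_def)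
  have B: "0 \<le> B" using Z by linarith
  have card\<tau>: "card (\<tau> ` S) \<le> B * 9 ^ N"
  proof (rule card_image_fibre_le[of _ "\<lambda>l. cell I K (v l)"])
    have "card ((\<lambda>l. cell I K (v l)) ` S) \<le> card Z" using Z by (intro card_mono) (auto simp: S_def)
    then show "card ((\<lambda>l. cell I K (v l)) ` S) \<le> B" using Z by linarith
    fix l0 assume l0: "l0 \<in> S"
    let ?S = "{l \<in> S. cell I K (v l) = cell I K (v l0)}"
    have "inj_on fst (\<tau> ` ?S)" by (rule inj_onI) (auto simp: \<tau>_def)
    then have "card (\<tau> ` ?S) = card (fst ` \<tau> ` ?S)" by (simp add: card_image)
    also have "fst ` \<tau> ` ?S = (\<lambda>l. cell I K (a l)) ` ?S" by (simp add: image_image \<tau>_def)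
    also have "card \<dots> \<le> (2 * 4 + 1) ^ card I"
    proof (rule card_int_box_le[THEN conjunct2, of _ _ "cell I K (a l0)"])
      fix Q i assume "Q \<in> (\<lambda>l. cell I K (a l)) ` ?S" and i: "i \<in> I"
      then obtain l where l: "l \<in> S" "cell I K (v l) = cell I K (v l0)" "Q = cell I K (a l)" by blast
      have "\<bar>v l i - v l0 i\<bar> \<le> 1 / K" by (rule cell_eq_imp_close[OF l(2) i K(1)])
      then have "\<bar>t p * (v l i - v l0 i)\<bar> \<le> 1 * (1 / K)"
        unfolding abs_mult using \<open>\<bar>t p\<bar> \<le> 1\<close> by (intro mult_mono) auto
      then have tv: "\<bar>t p * v l i - t p * v l0 i\<bar> \<le> 1 / K" by (simp add: right_diff_distrib)
      have "\<bar>x p i - a l i - t p * v l i\<bar> \<le> \<delta>" "\<bar>x p i - a l0 i - t p * v l0 i\<bar> \<le> \<delta>"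
        using l(1) l0 i by (auto simp: S_def incident_def)
      then have "\<bar>a l i - a l0 i\<bar> \<le> 3 * (1 / K)" using tv K(2) by linarith
      then have "\<bar>K * (a l i - a l0 i)\<bar> \<le> real K * (3 * (1 / K))" unfolding abs_mult by (intro mult_mono) auto
      then have "\<bar>K * a l i - K * a l0 i\<bar> \<le> real 3" using K by (simp add: right_diff_distrib)
      from abs_floor_diff_le[OF this] show "\<bar>Q i - cell I K (a l0) i\<bar> \<le> int 4"
        using i l(3) by (simp add: cell_def)
    qed (use I in \<open>auto simp: cell_def\<close>)
    finally have "card (\<tau> ` ?S) \<le> 9 ^ N" using I by simp
    then have "real (card (\<tau> ` ?S)) \<le> real (9 ^ N)" by (simp only: of_nat_le_iff)
    then show "real (card (\<tau> ` ?S)) \<le> 9 ^ N" by simp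
  qed (use S in auto)
  have "card S = (\<Sum>z\<in>\<tau> ` S. card {l \<in> S. \<tau> l = z})"
    unfolding card_eq_sum using S by (intro sum.group[symmetric]) auto
  then have "real (card S) = (\<Sum>z\<in>\<tau> ` S. real (card {l \<in> S. \<tau> l = z}))" by simp
  also have "\<dots> \<le> (\<Sum>z\<in>\<tau> ` S. y z)"
    unfolding y_def of_nat_le_iff using L by (intro sum_mono of_nat_mono card_mono) (auto simp: S_def)
  finally have "card {l \<in> L. incident I \<delta> a v t x l p} \<le> 2 * (\<Sum>z\<in>\<tau> ` S. y z)"
    using narrow by (simp add: S_def)
  then have "card {l \<in> L. incident I \<delta> a v t x l p} powr q \<le> (2 * (\<Sum>z\<in>\<tau> ` S. y z)) powr q"
    using q by (intro powr_mono2) auto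
  also have "\<dots> = 2 powr q * (\<Sum>z\<in>\<tau> ` S. y z) powr q"
    by (intro powr_mult) 
  also have "(\<Sum>z\<in>\<tau> ` S. y z) powr q \<le> card (\<tau> ` S) powr (q - 1) * (\<Sum>z\<in>\<tau> ` S. y z powr q)"
    using S q by (intro sum_powr_le) (auto simp: y_def)
  also have "\<dots> \<le> (9 ^ N * B) powr (q - 1) * (\<Sum>z\<in>\<tau> ` L. y z powr q)"
    using card\<tau> q L S B by (intro mult_mono powr_mono2 sum_mono2) (auto simp: mult.commute sum_nonneg)
  finally show ?thesis by (simp add: y_def mult_ac)
qed

section \<open>The discrete Kakeya estimate\<close>

text \<open>Induction on the number of rescalings by \<open>K\<close> that take \<open>\<delta>\<close> to \<open>1\<close>.  The constant \<open>M\<close> enters through its power \<open>M powr q\<close>,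
  and likewise the loss is \<open>\<delta> powr - (\<epsilon> * q)\<close>: this makes the estimate uniform in \<open>q\<close>, which is unbounded as
  \<open>d = 1\<close> and \<open>\<beta>\<close> tends to \<open>0\<close>.  \<open>K\<close> is chosen so large that the narrow part contributes at most half of the bound;
  the broad part contributes at most the other half because \<open>M\<close> is chosen after \<open>K\<close> and the fine scale \<open>k\<close>.\<close>

theorem discrete_Kakeya:
  fixes \<epsilon> A :: real and N d :: nat
  assumes d: "1 \<le> d" "d \<le> N" and \<epsilon>: "0 < \<epsilon>" and A: "1 \<le> A"
  shows "\<exists>M\<ge>1. \<forall>(I::'i set) \<sigma> q D (P::'p set) t \<delta> (L::'l set) a v x.
    finite I \<longrightarrow> card I = N \<longrightarrow> 1 + 1 / d \<le> q \<longrightarrow> \<sigma> * (q - 1) = 1 + (real d - 1) * (q - 1) \<longrightarrow>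
    0 \<le> D \<longrightarrow> finite P \<longrightarrow> (\<forall>p\<in>P. \<bar>t p\<bar> \<le> 1) \<longrightarrow> 0 < \<delta> \<longrightarrow> \<delta> \<le> 1 \<longrightarrow> finite L \<longrightarrow>
    (\<forall>l\<in>L. \<forall>i\<in>I. \<bar>a l i\<bar> \<le> 1 \<and> \<bar>v l i\<bar> \<le> 1) \<longrightarrow>
    spread I \<delta> D P t x \<longrightarrow> spaced I \<delta> A \<sigma> L a v \<longrightarrow>
    (\<Sum>p\<in>P. real (card {l \<in> L. incident I \<delta> a v t x l p}) powr q)
      \<le> M powr q * \<delta> powr (- (\<epsilon> * q) - (real d - 1) * (q - 1)) * card L * D"
proof -
  define C1 where "C1 = 9 ^ N * narrow_const N"
  have C1: "1 \<le> C1"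
  proof -
    have "real 1 \<le> narrow_const N" unfolding narrow_const_def of_nat_le_iff by simp
    moreover have "(1::real) \<le> 9 ^ N" by simp
    ultimately have "1 * 1 \<le> C1" unfolding C1_def by (intro mult_mono) auto
    then show ?thesis by simp
  qed
  define K where "K = max 2 (nat \<lceil>(4 * C1) powr (1 / \<epsilon>)\<rceil>)"
  have K2: "2 \<le> K" by (simp add: K_def)
  have KC: "4 * C1 \<le> K powr \<epsilon>"
  proof -
    have "(4 * C1) powr (1 / \<epsilon>) \<le> K" by (simp add: K_def) linarith
    then have "((4 * C1) powr (1 / \<epsilon>)) powr \<epsilon> \<le> K powr \<epsilon>" using \<epsilon> by (intro powr_mono2) auto
    then show ?thesis using C1 \<epsilon> by (simp add: powr_powr)
  qed
  define H where "H = dual_bound (1 / K) d"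
  have H: "1 \<le> H" unfolding H_def using K2 by (intro dual_bound_ge_1) auto
  from transversal_families_bound[OF d(1) H \<epsilon>, of N, where 'i = 'i and 'p = 'p and 'l = 'l]
  obtain k :: nat and C2 :: real where k: "1 \<le> k" and C2: "1 \<le> C2" and trans:
    "\<And>(I::'i set) \<delta> D (P::'p set) t x (a::'l \<Rightarrow> 'i \<Rightarrow> real) v F c \<psi>.
      finite I \<Longrightarrow> card I = N \<Longrightarrow> 0 < \<delta> \<Longrightarrow> \<delta> \<le> 1 \<Longrightarrow> 0 \<le> D \<Longrightarrow> finite P \<Longrightarrow>
      (\<forall>p\<in>P. \<bar>t p\<bar> \<le> 1 \<and> (\<forall>i\<in>I. \<bar>x p i\<bar> \<le> 3)) \<Longrightarrow> spread I \<delta> D P t x \<Longrightarrow>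
      (\<forall>j\<le>d. finite (F j) \<and> (\<forall>i\<in>I. \<bar>c j i\<bar> \<le> 1 \<and> (\<forall>l\<in>F j. \<bar>v l i - c j i\<bar> \<le> 1 / k))) \<Longrightarrow>
      dual_to I d H c \<psi> \<Longrightarrow>
      (\<Sum>p\<in>P. \<Prod>j\<le>d. real (card {l \<in> F j. incident I \<delta> a v t x l p}) powr (1 / d))
        \<le> C2 * \<delta> powr (1 - \<epsilon>) * D * (\<Prod>j\<le>d. real (card (F j)) powr (1 / d))"
    by blast
  define T where "T = real ((2 * k + 1) ^ N)"
  have T: "1 \<le> T"
  proof -
    have "real 1 \<le> T" unfolding T_def of_nat_le_iff by (rule one_le_power) simp
    then show ?thesis by simp
  qed
  define CB where "CB = (2 * T) ^ 2 * T ^ (d + 1) * C2"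
  have CB: "1 \<le> CB"
  proof -
    have "1 * 1 * 1 \<le> CB" unfolding CB_def using T C2
      by (intro mult_mono one_le_power) auto
    then show ?thesis by simp
  qed
  define M where "M = 2 * CB * A * K"
  have "1 * 1 * 1 * 1 \<le> M" unfolding M_def using CB A K2 by (intro mult_mono) auto
  then have M: "1 \<le> M" by simp
  show ?thesis
  proof (rule exI[of _ M], intro conjI M allI impI)
    fix I :: "'i set" and \<sigma> q D :: real and P :: "'p set" and t :: "'p \<Rightarrow> real" and \<delta> :: real and L :: "'l set"
      and a v :: "'l \<Rightarrow> 'i \<Rightarrow> real" and x :: "'p \<Rightarrow> 'i \<Rightarrow> real"
    assume I: "finite I" "card I = N" and q: "1 + 1 / d \<le> q" and \<sigma>: "\<sigma> * (q - 1) = 1 + (real d - 1) * (q - 1)"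
      and D: "0 \<le> D" and P: "finite P" "\<forall>p\<in>P. \<bar>t p\<bar> \<le> 1"
    define s where "s = (real d - 1) * (q - 1)"
    have "0 < 1 / real d" using d by simp
    then have q1: "1 < q" using q by linarith
    have s: "0 \<le> s" using q1 d by (simp add: s_def)
    have MA: "CB * A powr q \<le> M powr q / 2" "A powr q * K \<le> M powr q"
    proof -
      have "2 * CB * A powr q \<le> (2 * CB) powr q * A powr q"
        using CB q1 powr_mono[of 1 q "2 * CB"] by (intro mult_right_mono) auto
      also have "\<dots> = (2 * CB * A) powr q" using CB A by (simp add: powr_mult)
      also have "\<dots> \<le> M powr q"
        using CB A K2 q1 mult_left_mono[of 1 "real K" "2 * CB * A"] by (intro powr_mono2) (auto simp: M_def)
      finally show "CB * A powr q \<le> M powr q / 2" by simp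
      have "A powr q * K \<le> A powr q * K powr q"
        using K2 q1 powr_mono[of 1 q "real K"] by (intro mult_left_mono) auto
      also have "\<dots> = (1 * A * K) powr q" using A by (simp add: powr_mult)
      also have "\<dots> \<le> M powr q" unfolding M_def using CB A K2 q1 by (intro powr_mono2 mult_mono) auto
      finally show "A powr q * K \<le> M powr q" .
    qed
    \<comment> \<open>The spacing hypothesis at radius \<open>1\<close>; the exponent of \<open>\<delta>\<close> comes from the identity for \<open>\<sigma> * (q - 1)\<close>.\<close>
    have cardL: "card L powr (q - 1) \<le> A powr q * \<delta> powr (- 1 - s)"
      if \<delta>: "0 < \<delta>" "\<delta> \<le> 1" and L: "finite L" and spc: "spaced I \<delta> A \<sigma> L a v"
        and av: "\<forall>l\<in>L. \<forall>i\<in>I. \<bar>a l i\<bar> \<le> 1 \<and> \<bar>v l i\<bar> \<le> 1"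
      for \<delta> :: real and L :: "'l set" and a v :: "'l \<Rightarrow> 'i \<Rightarrow> real"
    proof -
      have "{l \<in> L. \<forall>i\<in>I. \<bar>a l i - 0\<bar> \<le> 1 \<and> \<bar>v l i - 0\<bar> \<le> 1} = L" using av by auto
      then have "card L \<le> A * (1 / \<delta>) powr \<sigma>"
        using spc[unfolded spaced_def, rule_format, OF \<delta>(2), of "\<lambda>_. 0" "\<lambda>_. 0"] by simp
      then have "card L powr (q - 1) \<le> (A * (1 / \<delta>) powr \<sigma>) powr (q - 1)"
        using q1 by (intro powr_mono2) auto
      also have "\<dots> = A powr (q - 1) * (1 / \<delta>) powr (1 + s)"
        using A by (simp add: powr_mult powr_powr \<sigma> s_def)
      also have "(1 / \<delta>) powr (1 + s) = \<delta> powr (- 1 - s)"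
        using \<delta> powr_minus_divide[of \<delta> "1 + s"] by (simp add: powr_divide)
      also have "A powr (q - 1) * \<delta> powr (- 1 - s) \<le> A powr q * \<delta> powr (- 1 - s)"
        using A by (intro mult_right_mono powr_mono) auto
      finally show ?thesis .
    qed
    have base: "(\<Sum>p\<in>P. real (card {l \<in> L. incident I \<delta> a v t x l p}) powr q)
        \<le> M powr q * \<delta> powr (- (\<epsilon> * q) - s) * card L * D"
      if K\<delta>: "1 \<le> K * \<delta>" and \<delta>: "0 < \<delta>" "\<delta> \<le> 1" and L: "finite L" and spr: "spread I \<delta> D P t x"
        and spc: "spaced I \<delta> A \<sigma> L a v" and av: "\<forall>l\<in>L. \<forall>i\<in>I. \<bar>a l i\<bar> \<le> 1 \<and> \<bar>v l i\<bar> \<le> 1"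
      for \<delta> :: real and L :: "'l set" and a v :: "'l \<Rightarrow> 'i \<Rightarrow> real" and x :: "'p \<Rightarrow> 'i \<Rightarrow> real"
    proof -
      define f where "f p = real (card {l \<in> L. incident I \<delta> a v t x l p})" for p
      have f: "0 \<le> f p" "f p \<le> card L" for p using L by (auto simp: f_def intro!: card_mono)
      have "(\<Sum>p\<in>P. f p powr q) = (\<Sum>p\<in>P. f p powr (q - 1) * f p)"
        using f powr_add[of _ "q - 1" 1] by (intro sum.cong refl) simp
      also have "\<dots> \<le> (\<Sum>p\<in>P. card L powr (q - 1) * f p)"
        using f q1 by (intro sum_mono mult_right_mono powr_mono2) auto
      also have "\<dots> = card L powr (q - 1) * (\<Sum>p\<in>P. f p)" by (simp add: sum_distrib_left)
      also have "\<dots> \<le> card L powr (q - 1) * (card L * D)"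
        unfolding f_def using P by (intro mult_left_mono sum_incident_le[OF L P(1) spr \<delta>(2)]) auto
      also have "\<dots> \<le> (A powr q * \<delta> powr (- 1 - s)) * (card L * D)"
        using D by (intro mult_right_mono cardL[OF \<delta> L spc av]) auto
      also have "(A powr q * \<delta> powr (- 1 - s)) * (card L * D)
          \<le> A powr q * (K * \<delta> powr (- (\<epsilon> * q) - s)) * (card L * D)"
      proof (intro mult_right_mono mult_left_mono)
        have "\<delta> powr (- 1 - s) = (1 / \<delta>) * \<delta> powr (- s)"
          using \<delta> powr_add[of \<delta> "- 1" "- s"] by (simp add: powr_minus_divide)
        also have "\<dots> \<le> K * \<delta> powr (- (\<epsilon> * q) - s)"
          using K\<delta> \<delta> \<epsilon> q1 by (intro mult_mono powr_mono') (auto simp: pos_divide_le_eq)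
        finally show "\<delta> powr (- 1 - s) \<le> K * \<delta> powr (- (\<epsilon> * q) - s)" .
      qed (use D in auto)
      also have "A powr q * (K * \<delta> powr (- (\<epsilon> * q) - s)) * (card L * D)
          = (A powr q * K) * (\<delta> powr (- (\<epsilon> * q) - s) * (card L * D))" by (simp add: mult_ac)
      also have "\<dots> \<le> M powr q * (\<delta> powr (- (\<epsilon> * q) - s) * (card L * D))"
        using D by (intro mult_right_mono MA) auto
      finally show ?thesis by (simp add: f_def mult_ac)
    qed
    have main: "(\<Sum>p\<in>P. real (card {l \<in> L. incident I \<delta> a v t x l p}) powr q)
        \<le> M powr q * \<delta> powr (- (\<epsilon> * q) - s) * card L * D"
      if "1 \<le> K ^ n * \<delta>" "0 < \<delta>" "\<delta> \<le> 1" "finite L" "\<forall>l\<in>L. \<forall>i\<in>I. \<bar>a l i\<bar> \<le> 1 \<and> \<bar>v l i\<bar> \<le> 1"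
        "spread I \<delta> D P t x" "spaced I \<delta> A \<sigma> L a v"
      for n and \<delta> :: real and L :: "'l set" and a v :: "'l \<Rightarrow> 'i \<Rightarrow> real" and x :: "'p \<Rightarrow> 'i \<Rightarrow> real"
      using that
    proof (induction n arbitrary: \<delta> L a v x)
      case 0
      have "1 * 1 \<le> K * \<delta>" using 0 K2 by (intro mult_mono) auto
      then have K\<delta>: "1 \<le> K * \<delta>" by simp
      show ?case by (rule base[OF K\<delta>]) (use 0 in auto)
    next
      case (Suc n)
      note \<delta> = Suc.prems(2,3) and L = Suc.prems(4) and av = Suc.prems(5) and spr = Suc.prems(6) and spc = Suc.prems(7)
      show ?case
      proof (cases "1 \<le> K * \<delta>")
        case True
        then show ?thesis by (rule base[OF _ \<delta> L spr spc av])
      next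
        case False
        define f where "f p = real (card {l \<in> L. incident I \<delta> a v t x l p})" for p
        define broad where "broad p \<longleftrightarrow> (\<exists>c \<psi>. dual_to I d H c \<psi> \<and> (\<forall>j\<le>d. c j \<in> v ` {l \<in> L. incident I \<delta> a v t x l p}
            \<and> f p \<le> 2 * T * card {l \<in> {l \<in> L. incident I \<delta> a v t x l p}. cell I k (v l) = cell I k (c j)}))" for p
        define BP where "BP = {p \<in> P. f p \<noteq> 0 \<and> broad p}"
        define NP where "NP = {p \<in> P. f p \<noteq> 0 \<and> \<not> broad p}"
        define Y where "Y = \<delta> powr (- (\<epsilon> * q) - s) * card L * D"
        have Y0: "0 \<le> Y" using D by (simp add: Y_def)
        have f: "0 \<le> f p" "f p \<le> card L" for p using L by (auto simp: f_def intro!: card_mono)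
        have split: "(\<Sum>p\<in>P. f p powr q) = (\<Sum>p\<in>BP. f p powr q) + (\<Sum>p\<in>NP. f p powr q)"
        proof -
          have "(\<Sum>p\<in>P. f p powr q) = (\<Sum>p\<in>BP \<union> NP. f p powr q)"
            using P by (intro sum.mono_neutral_right) (auto simp: BP_def NP_def)
          also have "\<dots> = (\<Sum>p\<in>BP. f p powr q) + (\<Sum>p\<in>NP. f p powr q)"
            using P by (intro sum.union_disjoint) (auto simp: BP_def NP_def)
          finally show ?thesis .
        qed
        \<comment> \<open>Raising the exponent from \<open>1 + 1 / d\<close> to \<open>q\<close> by the trivial bound \<open>f p \<le> card L\<close>.\<close>
        have broad_part: "(\<Sum>p\<in>BP. f p powr q) \<le> M powr q / 2 * Y"
        proof -
          define B where "B = C2 * \<delta> powr (1 - \<epsilon>) * D"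
          have "(\<Sum>p\<in>BP. f p powr (1 + 1 / d)) \<le> (2 * T) ^ 2 * T ^ (d + 1) * B * card L powr (1 + 1 / d)"
          proof (rule sum_broad_le[where inc = "incident I \<delta> a v t x"])
            show "finite BP" using P by (simp add: BP_def)
            show "real (card (cell I k ` v ` L)) \<le> T"
              unfolding T_def of_nat_le_iff using finite_cells[of I "v ` L" k] I av by auto
            show "\<bar>v l i\<bar> \<le> 1" if "l \<in> L" "i \<in> I" for l i using av that by blast
            show "0 \<le> B" using C2 D by (simp add: B_def)
            show "(\<Sum>p\<in>BP. \<Prod>j\<le>d. real (card {l \<in> F j. incident I \<delta> a v t x l p}) powr (1 / d))
                \<le> B * (\<Prod>j\<le>d. real (card (F j)) powr (1 / d))"
              if F: "\<forall>j\<le>d. finite (F j) \<and> (\<forall>i\<in>I. \<bar>c j i\<bar> \<le> 1 \<and> (\<forall>l\<in>F j. \<bar>v l i - c j i\<bar> \<le> 1 / k))"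
                and dual: "dual_to I d H c \<psi>" for F c \<psi>
              unfolding B_def
            proof (rule trans[OF I \<delta> D _ _ _ F dual])
              show "finite BP" using P by (simp add: BP_def)
              show "spread I \<delta> D BP t x" by (rule spread_subset[OF spr _ P(1)]) (auto simp: BP_def)
              show "\<forall>p\<in>BP. \<bar>t p\<bar> \<le> 1 \<and> (\<forall>i\<in>I. \<bar>x p i\<bar> \<le> 3)"
              proof (intro ballI conjI)
                fix p assume p: "p \<in> BP"
                show tp: "\<bar>t p\<bar> \<le> 1" using p P by (simp add: BP_def)
                fix i assume i: "i \<in> I"
                have "card {l \<in> L. incident I \<delta> a v t x l p} \<noteq> 0" using p by (simp add: BP_def f_def)
                then have "{l \<in> L. incident I \<delta> a v t x l p} \<noteq> {}" by (metis card.empty)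
                then obtain l where l: "l \<in> L" "incident I \<delta> a v t x l p" by blast
                have "\<bar>t p * v l i\<bar> \<le> 1 * 1" unfolding abs_mult using tp av l i by (intro mult_mono) auto
                moreover have "\<bar>a l i\<bar> \<le> 1" using av l i by blast
                moreover have "\<bar>x p i - a l i - t p * v l i\<bar> \<le> \<delta>" using l i by (simp add: incident_def)
                ultimately show "\<bar>x p i\<bar> \<le> 3" using \<delta> by linarith
              qed
            qed
            show "\<exists>c \<psi>. dual_to I d H c \<psi> \<and> (\<forall>j\<le>d. c j \<in> v ` L
              \<and> f p \<le> 2 * T * card {l \<in> {l \<in> L. incident I \<delta> a v t x l p}. cell I k (v l) = cell I k (c j)})"
              if p: "p \<in> BP" for p
            proof -
              have "broad p" using p by (simp add: BP_def)
              then show ?thesis unfolding broad_def by blast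
            qed
          qed (use L d T f k in auto)
          then have q_sum: "(\<Sum>p\<in>BP. f p powr (1 + 1 / d)) \<le> CB * (\<delta> powr (1 - \<epsilon>) * D * card L powr (1 + 1 / d))"
            by (simp add: B_def CB_def mult_ac)
          have "(\<Sum>p\<in>BP. f p powr q) = (\<Sum>p\<in>BP. f p powr (q - (1 + 1 / d)) * f p powr (1 + 1 / d))"
            by (simp add: powr_add[symmetric])
          also have "\<dots> \<le> (\<Sum>p\<in>BP. card L powr (q - (1 + 1 / d)) * f p powr (1 + 1 / d))"
            using q f by (intro sum_mono mult_right_mono powr_mono2) auto
          also have "\<dots> = card L powr (q - (1 + 1 / d)) * (\<Sum>p\<in>BP. f p powr (1 + 1 / d))"
            by (simp add: sum_distrib_left)
          also have "\<dots> \<le> card L powr (q - (1 + 1 / d)) * (CB * (\<delta> powr (1 - \<epsilon>) * D * card L powr (1 + 1 / d)))"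
            by (intro mult_left_mono q_sum) auto
          also have "\<dots> = CB * \<delta> powr (1 - \<epsilon>) * D * (card L powr (q - (1 + 1 / d)) * card L powr (1 + 1 / d))"
            by (simp add: mult_ac)
          also have "card L powr (q - (1 + 1 / d)) * card L powr (1 + 1 / d) = card L powr (q - 1) * card L"
            using powr_add[of "card L" "q - 1" 1] by (simp add: powr_add[symmetric])
          also have "CB * \<delta> powr (1 - \<epsilon>) * D * (card L powr (q - 1) * card L)
              \<le> CB * \<delta> powr (1 - \<epsilon>) * D * ((A powr q * \<delta> powr (- 1 - s)) * card L)"
            using CB D by (intro mult_left_mono mult_right_mono cardL[OF \<delta> L spc av]) auto
          also have "\<dots> = CB * A powr q * (\<delta> powr (1 - \<epsilon>) * \<delta> powr (- 1 - s)) * card L * D"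
            by (simp add: mult_ac)
          also have "\<delta> powr (1 - \<epsilon>) * \<delta> powr (- 1 - s) = \<delta> powr (- \<epsilon> - s)"
            by (simp add: powr_add[symmetric])
          also have "CB * A powr q * \<delta> powr (- \<epsilon> - s) * card L * D
              \<le> M powr q / 2 * \<delta> powr (- (\<epsilon> * q) - s) * card L * D"
            using \<delta> \<epsilon> q1 D MA CB by (intro mult_right_mono mult_mono powr_mono') auto
          finally show ?thesis by (simp add: Y_def mult_ac)
        qed
        define \<tau> where "\<tau> l = (cell I K (a l), cell I K (v l))" for l
        define Lz where "Lz z = {l \<in> L. \<tau> l = z}" for z
        define B where "B = narrow_const N * real K ^ (d - 1)"
        have B: "0 \<le> B" by (simp add: B_def narrow_const_def)
        have "\<delta> \<le> 1 / K" using False K2 by (simp add: pos_le_divide_eq mult.commute)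
        have narrow_point: "f p powr q \<le> 2 powr q * (9 ^ N * B) powr (q - 1) *
            (\<Sum>z\<in>\<tau> ` L. card {l \<in> Lz z. incident I \<delta> a v t x l p} powr q)" if p: "p \<in> NP" for p
        proof -
          have "\<exists>Z. finite Z \<and> card Z \<le> B \<and> card {l \<in> L. incident I \<delta> a v t x l p}
              \<le> 2 * card {l \<in> {l \<in> L. incident I \<delta> a v t x l p}. cell I K (v l) \<in> Z}"
          proof -
            have "finite {l \<in> L. incident I \<delta> a v t x l p}" "1 \<le> K"
              "\<And>l i. l \<in> {l \<in> L. incident I \<delta> a v t x l p} \<Longrightarrow> i \<in> I \<Longrightarrow> \<bar>v l i\<bar> \<le> 1"
              using L K2 av by auto
            from broad_or_narrow[where k = k and v = v, OF I this(1) d this(2,3), folded T_def H_def B_def]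
            have "broad p \<or> (\<exists>Z. finite Z \<and> card Z \<le> B \<and> card {l \<in> L. incident I \<delta> a v t x l p}
              \<le> 2 * card {l \<in> {l \<in> L. incident I \<delta> a v t x l p}. cell I K (v l) \<in> Z})"
              unfolding broad_def f_def .
            then show ?thesis using p by (simp add: NP_def)
          qed
          then obtain Z where Z: "finite Z" "card Z \<le> B" "card {l \<in> L. incident I \<delta> a v t x l p}
              \<le> 2 * card {l \<in> {l \<in> L. incident I \<delta> a v t x l p}. cell I K (v l) \<in> Z}" by blast
          show ?thesis
            unfolding f_def Lz_def \<tau>_def
            by (rule narrow_powr_le[OF I L _ \<open>\<delta> \<le> 1 / K\<close> _ _ Z]) (use K2 p P q1 in \<open>auto simp: NP_def\<close>)
        qed
        \<comment> \<open>One cell, moved to the origin and enlarged to unit size, is an instance of the induction hypothesis at width \<open>K * \<delta>\<close>.\<close>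
        have child: "(\<Sum>p\<in>P. card {l \<in> Lz z. incident I \<delta> a v t x l p} powr q)
            \<le> M powr q * (K * \<delta>) powr (- (\<epsilon> * q) - s) * card (Lz z) * D" for z
        proof -
          define \<alpha> \<omega> where "\<alpha> i = fst z i / K" and "\<omega> i = snd z i / K" for i
          have K0: "0 < real K" "1 \<le> real K" using K2 by auto
          have "(\<Sum>p\<in>P. real (card {l \<in> Lz z. incident I (K * \<delta>) (\<lambda>l i. K * (a l i - \<alpha> i)) (\<lambda>l i. K * (v l i - \<omega> i)) t
              (\<lambda>p i. K * (x p i - \<alpha> i - t p * \<omega> i)) l p}) powr q)
            \<le> M powr q * (K * \<delta>) powr (- (\<epsilon> * q) - s) * card (Lz z) * D"
          proof (rule Suc.IH)
            show "1 \<le> real (K ^ n) * (real K * \<delta>)" using Suc.prems(1) by (simp add: mult_ac)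
            show "0 < real K * \<delta>" "real K * \<delta> \<le> 1" using \<delta> K0 False by auto
            show "finite (Lz z)" using L by (simp add: Lz_def)
            show "spread I (K * \<delta>) D P t (\<lambda>p i. K * (x p i - \<alpha> i - t p * \<omega> i))"
              by (rule spread_rescale[OF spr K0(2) \<delta>(1)])
            show "spaced I (K * \<delta>) A \<sigma> (Lz z) (\<lambda>l i. K * (a l i - \<alpha> i)) (\<lambda>l i. K * (v l i - \<omega> i))"
              by (rule spaced_rescale[OF spc K0(2) \<delta>(1) _ L]) (auto simp: Lz_def)
            show "\<forall>l\<in>Lz z. \<forall>i\<in>I. \<bar>K * (a l i - \<alpha> i)\<bar> \<le> 1 \<and> \<bar>K * (v l i - \<omega> i)\<bar> \<le> 1"
            proof (intro ballI)
              fix l i assume l: "l \<in> Lz z" and i: "i \<in> I"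
              have "fst z i = \<lfloor>K * a l i\<rfloor>" "snd z i = \<lfloor>K * v l i\<rfloor>"
                using l i by (auto simp: Lz_def \<tau>_def cell_def)
              then have "K * (a l i - \<alpha> i) = K * a l i - \<lfloor>K * a l i\<rfloor>" "K * (v l i - \<omega> i) = K * v l i - \<lfloor>K * v l i\<rfloor>"
                using K0 by (auto simp: \<alpha>_def \<omega>_def field_simps)
              then show "\<bar>K * (a l i - \<alpha> i)\<bar> \<le> 1 \<and> \<bar>K * (v l i - \<omega> i)\<bar> \<le> 1" by linarith
            qed
          qed
          then show ?thesis by (simp only: incident_rescale[OF K0(1)])
        qed
        have narrow_part: "(\<Sum>p\<in>NP. f p powr q) \<le> M powr q / 2 * Y"
        proof -
          define W where "W = 2 powr q * (9 ^ N * B) powr (q - 1)"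
          have W0: "0 \<le> W" by (simp add: W_def)
          have W: "W \<le> (2 * C1) powr q * K powr s"
          proof -
            have "9 ^ N * B = C1 * real K powr (real d - 1)"
              using K2 d by (simp add: B_def C1_def powr_realpow[symmetric] of_nat_diff)
            then have "(9 ^ N * B) powr (q - 1) = C1 powr (q - 1) * K powr s"
              using C1 by (simp add: powr_mult powr_powr s_def)
            also have "\<dots> \<le> C1 powr q * K powr s"
              using C1 by (intro mult_right_mono powr_mono) auto
            finally have "W \<le> 2 powr q * (C1 powr q * K powr s)"
              unfolding W_def by (intro mult_left_mono) auto
            then show ?thesis using C1 by (simp add: powr_mult)
          qed
          \<comment> \<open>The factors \<open>K powr s\<close> from convexity and \<open>K powr - s\<close> from rescaling cancel; \<open>K powr - (\<epsilon> * q)\<close> beats the constants.\<close>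
          have gain: "W * (K * \<delta>) powr (- (\<epsilon> * q) - s) \<le> \<delta> powr (- (\<epsilon> * q) - s) / 2"
          proof -
            have "K powr s * K powr (- (\<epsilon> * q) - s) = K powr (- (\<epsilon> * q))" by (simp add: powr_add[symmetric])
            also have "\<dots> = (K powr \<epsilon>) powr (- q)" by (simp add: powr_powr)
            also have "\<dots> \<le> (4 * C1) powr (- q)" using KC C1 q1 by (intro powr_mono2') auto
            finally have "(2 * C1) powr q * (K powr s * K powr (- (\<epsilon> * q) - s)) \<le> (2 * C1) powr q * (4 * C1) powr (- q)"
              by (intro mult_left_mono) auto
            also have "(4 * C1) powr (- q) = (2 * C1) powr (- q) * 2 powr (- q)"
              using C1 powr_mult[of "2 * C1" 2 "- q"] by simp
            also have "(2 * C1) powr q * ((2 * C1) powr (- q) * 2 powr (- q)) = 2 powr (- q)"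
              using C1 by (simp add: powr_minus)
            also have "\<dots> \<le> 2 powr (- 1)" using q1 by (intro powr_mono) auto
            finally have half: "(2 * C1) powr q * (K powr s * K powr (- (\<epsilon> * q) - s)) \<le> 1 / 2"
              by (simp add: powr_minus)
            have "W * (K * \<delta>) powr (- (\<epsilon> * q) - s)
                \<le> ((2 * C1) powr q * K powr s) * (K * \<delta>) powr (- (\<epsilon> * q) - s)"
              using W by (intro mult_right_mono) auto
            also have "\<dots> = ((2 * C1) powr q * (K powr s * K powr (- (\<epsilon> * q) - s))) * \<delta> powr (- (\<epsilon> * q) - s)"
              using \<delta> by (simp add: powr_mult)
            also have "\<dots> \<le> 1 / 2 * \<delta> powr (- (\<epsilon> * q) - s)" using half by (intro mult_right_mono) auto
            finally show ?thesis by simp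
          qed
          have cards: "(\<Sum>z\<in>\<tau> ` L. real (card (Lz z))) = card L"
          proof -
            have "card L = (\<Sum>z\<in>\<tau> ` L. card (Lz z))"
              unfolding card_eq_sum Lz_def using L by (intro sum.group[symmetric]) auto
            then show ?thesis by simp
          qed
          have "(\<Sum>p\<in>NP. f p powr q) \<le> (\<Sum>p\<in>NP. W * (\<Sum>z\<in>\<tau> ` L. card {l \<in> Lz z. incident I \<delta> a v t x l p} powr q))"
            unfolding W_def by (intro sum_mono narrow_point)
          also have "\<dots> \<le> (\<Sum>p\<in>P. W * (\<Sum>z\<in>\<tau> ` L. card {l \<in> Lz z. incident I \<delta> a v t x l p} powr q))"
            using P W0 by (intro sum_mono2 mult_nonneg_nonneg sum_nonneg) (auto simp: NP_def)
          also have "\<dots> = W * (\<Sum>z\<in>\<tau> ` L. \<Sum>p\<in>P. card {l \<in> Lz z. incident I \<delta> a v t x l p} powr q)"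
            unfolding sum_distrib_left[symmetric] by (subst sum.swap) simp
          also have "\<dots> \<le> W * (\<Sum>z\<in>\<tau> ` L. M powr q * (K * \<delta>) powr (- (\<epsilon> * q) - s) * card (Lz z) * D)"
            using W0 by (intro mult_left_mono sum_mono child)
          also have "\<dots> = (W * (K * \<delta>) powr (- (\<epsilon> * q) - s)) * (M powr q * (card L * D))"
            unfolding cards[symmetric] by (simp add: sum_distrib_left sum_distrib_right mult_ac)
          also have "\<dots> \<le> (\<delta> powr (- (\<epsilon> * q) - s) / 2) * (M powr q * (card L * D))"
            using D by (intro mult_right_mono gain) auto
          finally show ?thesis by (simp add: Y_def mult_ac)
        qed
        have "(\<Sum>p\<in>P. f p powr q) \<le> M powr q * Y"
          using split broad_part narrow_part by simp
        then show ?thesis by (simp add: f_def Y_def mult_ac)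
      qed
    qed
    assume \<delta>: "0 < \<delta>" "\<delta> \<le> 1" and *: "finite L" "\<forall>l\<in>L. \<forall>i\<in>I. \<bar>a l i\<bar> \<le> 1 \<and> \<bar>v l i\<bar> \<le> 1"
      "spread I \<delta> D P t x" "spaced I \<delta> A \<sigma> L a v"
    obtain n where "1 / \<delta> < real K ^ n" using real_arch_pow[of "real K" "1 / \<delta>"] K2 by auto
    then have "1 \<le> K ^ n * \<delta>" using \<delta> by (simp add: pos_divide_less_eq)
    from main[OF this \<delta> *] show "(\<Sum>p\<in>P. real (card {l \<in> L. incident I \<delta> a v t x l p}) powr q)
      \<le> M powr q * \<delta> powr (- (\<epsilon> * q) - (real d - 1) * (q - 1)) * card L * D"
      by (simp add: s_def)
  qed
qed

section \<open>Tubes and the metric space of lines\<close>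

text \<open>The tube extends beyond both ends of its axis by \<open>\<delta>\<close>, so its diameter is at least \<open>1 + 2 * \<delta>\<close>.\<close>

lemma tube_in_ball:
  fixes A B :: "'a::euclidean_space"
  assumes AB: "dist A B = 1" and \<delta>: "0 < \<delta>" and T: "segment_nbhd \<delta> A B \<subseteq> ball 0 1"
  shows "\<delta> \<le> 1 / 2" "norm A \<le> 1"
proof -
  define u where "u = B - A"
  have u: "norm u = 1" using AB by (simp add: u_def dist_norm norm_minus_commute)
  show "\<delta> \<le> 1 / 2"
  proof (rule dense_le_bounded[OF \<delta>])
    fix r assume r: "0 < r" "r < \<delta>"
    have "A - r *\<^sub>R u \<in> segment_nbhd \<delta> A B"
      unfolding segment_nbhd_def by (rule UN_I[of A]) (use r u in \<open>auto simp: dist_norm\<close>)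
    moreover have "B + r *\<^sub>R u \<in> segment_nbhd \<delta> A B"
      unfolding segment_nbhd_def by (rule UN_I[of B]) (use r u in \<open>auto simp: dist_norm\<close>)
    ultimately have "norm (A - r *\<^sub>R u) < 1" "norm (B + r *\<^sub>R u) < 1" using T by auto
    then have "norm ((B + r *\<^sub>R u) - (A - r *\<^sub>R u)) < 2"
      using norm_triangle_ineq4[of "B + r *\<^sub>R u" "A - r *\<^sub>R u"] by linarith
    also have "(B + r *\<^sub>R u) - (A - r *\<^sub>R u) = u + r *\<^sub>R u + r *\<^sub>R u"
      by (simp add: u_def algebra_simps)
    also have "\<dots> = (1 + r + r) *\<^sub>R u" by (simp only: scaleR_left_distrib scaleR_one)
    finally show "r \<le> 1 / 2" using u r by simp
  qed
  have "A \<in> segment_nbhd \<delta> A B" using \<delta> by (auto simp: segment_nbhd_def intro!: bexI[of _ A])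
  then have "norm A < 1" using T by auto
  then show "norm A \<le> 1" by simp
qed

lemma open_segment_nbhd: "open (segment_nbhd \<delta> A B)"
  by (auto simp: segment_nbhd_def)

text \<open>About \<open>1 / (2 * \<delta>)\<close> disjoint balls of radius \<open>\<delta>\<close> have their centres on the axis.\<close>

lemma measure_tube_ge:
  fixes A B :: "'a::euclidean_space"
  assumes AB: "dist A B = 1" and \<delta>: "0 < \<delta>" and bdd: "bounded (segment_nbhd \<delta> A B)"
  shows "unit_ball_vol (DIM('a)) / 2 * \<delta> ^ (DIM('a) - 1) \<le> measure lebesgue (segment_nbhd \<delta> A B)"
proof -
  define u where "u = B - A"
  have u: "norm u = 1" using AB by (simp add: u_def dist_norm norm_minus_commute)
  define m where "m = nat \<lfloor>1 / (2 * \<delta>)\<rfloor>"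
  have m: "real m * (2 * \<delta>) \<le> 1" "1 / (2 * \<delta>) \<le> real (m + 1)"
  proof -
    have "real m \<le> 1 / (2 * \<delta>)" unfolding m_def using \<delta> by (simp add: of_nat_nat)
    then show "real m * (2 * \<delta>) \<le> 1" using \<delta> by (simp add: pos_le_divide_eq)
    show "1 / (2 * \<delta>) \<le> real (m + 1)" unfolding m_def using \<delta> by linarith
  qed
  define c where "c k = A + (real k * (2 * \<delta>)) *\<^sub>R u" for k
  have sub: "(\<Union>k\<in>{..m}. ball (c k) \<delta>) \<subseteq> segment_nbhd \<delta> A B"
  proof (rule UN_least)
    fix k assume k: "k \<in> {..m}"
    have "real k * (2 * \<delta>) \<le> real m * (2 * \<delta>)" using k \<delta> by (intro mult_right_mono) auto
    then have "real k * (2 * \<delta>) \<le> 1" using m by linarith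
    moreover have "c k = (1 - real k * (2 * \<delta>)) *\<^sub>R A + (real k * (2 * \<delta>)) *\<^sub>R B"
      by (simp add: c_def u_def algebra_simps)
    ultimately have "c k \<in> closed_segment A B" using \<delta> by (auto simp: closed_segment_def intro!: exI[of _ "real k * (2 * \<delta>)"])
    then show "ball (c k) \<delta> \<subseteq> segment_nbhd \<delta> A B" by (auto simp: segment_nbhd_def)
  qed
  have disj: "disjnt (ball (c k) \<delta>) (ball (c k') \<delta>)" if "k \<noteq> k'" for k k'
  proof -
    have "c k - c k' = ((real k - real k') * (2 * \<delta>)) *\<^sub>R u" by (simp add: c_def algebra_simps)
    then have "dist (c k) (c k') = \<bar>real k - real k'\<bar> * (2 * \<delta>)" using u \<delta> by (simp add: dist_norm abs_mult)
    moreover have "1 \<le> \<bar>real k - real k'\<bar>" using that by linarith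
    ultimately have "1 * (2 * \<delta>) \<le> dist (c k) (c k')" using \<delta> by (simp add: mult_right_mono)
    then have "\<delta> + \<delta> \<le> dist (c k) (c k')" by simp
    then show ?thesis by (simp add: disjnt_def disjoint_ballI)
  qed
  have meas: "segment_nbhd \<delta> A B \<in> lmeasurable"
    using bdd open_segment_nbhd by (intro lmeasurable_open) auto
  have "unit_ball_vol (DIM('a)) / 2 * \<delta> ^ (DIM('a) - 1) = 1 / (2 * \<delta>) * (unit_ball_vol (DIM('a)) * \<delta> ^ DIM('a))"
    using \<delta> by (cases "DIM('a)") auto
  also have "\<dots> \<le> real (m + 1) * (unit_ball_vol (DIM('a)) * \<delta> ^ DIM('a))"
    using m \<delta> by (intro mult_right_mono) auto
  also have "\<dots> = (\<Sum>k\<in>{..m}. measure lebesgue (ball (c k) \<delta>))"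
    using \<delta> by (simp add: content_ball)
  also have "\<dots> = measure lebesgue (\<Union>k\<in>{..m}. ball (c k) \<delta>)"
    using disj by (intro measure_UNION'[symmetric]) (auto simp: pairwise_def)
  also have "\<dots> \<le> measure lebesgue (segment_nbhd \<delta> A B)"
    using sub meas by (intro measure_mono_fmeasurable) auto
  finally show ?thesis .
qed

lemma wedge_area_le_norm_diff:
  assumes "norm e = 1" "norm e' = 1"
  shows "wedge_area e e' \<le> norm (e - e')"
proof -
  have ee: "e \<bullet> e = 1" "e' \<bullet> e' = 1" using assms by (auto simp: dot_square_norm)
  have "(e \<bullet> e) * (e' \<bullet> e') - (e \<bullet> e')\<^sup>2 \<le> (e - e') \<bullet> (e - e')"
    using zero_le_power2[of "1 - e \<bullet> e'"] ee
    by (simp add: inner_diff_left inner_diff_right inner_commute[of e' e] power2_eq_square algebra_simps)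
  then show ?thesis unfolding wedge_area_def norm_eq_sqrt_inner by (rule real_sqrt_le_mono)
qed

lemma norm_normalize_diff_le:
  fixes v v' :: "'a::real_normed_vector"
  assumes "1 \<le> norm v" "1 \<le> norm v'"
  shows "norm (v /\<^sub>R norm v - v' /\<^sub>R norm v') \<le> 2 * norm (v - v')"
proof -
  have nz: "norm v \<noteq> 0" "norm v' \<noteq> 0" using assms by auto
  have "inverse (norm v) - inverse (norm v') = (norm v' - norm v) / (norm v * norm v')"
    using nz by (simp add: field_simps)
  moreover have "v /\<^sub>R norm v - v' /\<^sub>R norm v'
      = (v - v') /\<^sub>R norm v + (inverse (norm v) - inverse (norm v')) *\<^sub>R v'"
    by (simp add: algebra_simps)
  ultimately have "v /\<^sub>R norm v - v' /\<^sub>R norm v'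
      = (v - v') /\<^sub>R norm v + ((norm v' - norm v) / (norm v * norm v')) *\<^sub>R v'" by simp
  also have "norm \<dots> \<le> norm (v - v') / norm v + \<bar>norm v' - norm v\<bar> / norm v"
    using nz by (intro order_trans[OF norm_triangle_ineq]) (simp add: divide_simps abs_mult)
  also have "\<dots> \<le> norm (v - v') / 1 + norm (v - v') / 1"
    using assms norm_triangle_ineq3[of v' v] by (intro add_mono frac_le) (auto simp: norm_minus_commute)
  finally show ?thesis by simp
qed

text \<open>The converse comparison that the spacing hypothesis requires: lines with close parameters are close in the metric on lines.\<close>

lemma line_dist_range_le:
  fixes a a' v v' :: "'a::euclidean_space"
  assumes v: "1 \<le> norm v" "1 \<le> norm v'" and a': "norm a' \<le> R"
    and l: "l \<in> lines" "l = range (\<lambda>t. a + t *\<^sub>R v)" "l' \<in> lines" "l' = range (\<lambda>t. a' + t *\<^sub>R v')"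
  shows "line_dist l l' \<le> 2 * norm (a - a') + (4 * R + 2) * norm (v - v')"
proof -
  define e e' where "e = v /\<^sub>R norm v" and "e' = v' /\<^sub>R norm v'"
  have nz: "norm v \<noteq> 0" "norm v' \<noteq> 0" using v by auto
  have e: "norm e = 1" "norm e' = 1" using nz by (auto simp: e_def e'_def)
  have par: "affine_parallel (span {w /\<^sub>R norm w}) (range (\<lambda>t. b + t *\<^sub>R w)) \<and>
      b - (b \<bullet> (w /\<^sub>R norm w)) *\<^sub>R (w /\<^sub>R norm w) \<in> range (\<lambda>t. b + t *\<^sub>R w)" if "norm w \<noteq> 0" for b w :: 'a
  proof -
    have "range (\<lambda>t. b + t *\<^sub>R w) = range (\<lambda>t. b + t *\<^sub>R (w /\<^sub>R norm w))"
    proof safe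
      fix t
      have "b + t *\<^sub>R w = b + (t * norm w) *\<^sub>R (w /\<^sub>R norm w)" using that by simp
      then show "b + t *\<^sub>R w \<in> range (\<lambda>t. b + t *\<^sub>R (w /\<^sub>R norm w))" by blast
      show "b + t *\<^sub>R (w /\<^sub>R norm w) \<in> range (\<lambda>t. b + t *\<^sub>R w)" by auto
    qed
    moreover have "b - (b \<bullet> (w /\<^sub>R norm w)) *\<^sub>R (w /\<^sub>R norm w)
        = b + (- (b \<bullet> (w /\<^sub>R norm w))) *\<^sub>R (w /\<^sub>R norm w)" by simp
    ultimately show ?thesis unfolding parallel_span_iff by blast
  qed
  have orth: "orthogonal (b - (b \<bullet> w) *\<^sub>R w) w" if "norm w = 1" for b w :: 'a
    using that by (simp add: orthogonal_def inner_diff_left dot_square_norm)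
  have "line_dist l l' = norm ((a - (a \<bullet> e) *\<^sub>R e) - (a' - (a' \<bullet> e') *\<^sub>R e')) + wedge_area e e'"
    using par[OF nz(1), of a] par[OF nz(2), of a'] orth[OF e(1)] orth[OF e(2)] e l
    by (intro line_dist_eq) (auto simp: e_def e'_def)
  also have "(a - (a \<bullet> e) *\<^sub>R e) - (a' - (a' \<bullet> e') *\<^sub>R e')
      = (a - a') - ((a - a') \<bullet> e) *\<^sub>R e - (a' \<bullet> (e - e')) *\<^sub>R e - (a' \<bullet> e') *\<^sub>R (e - e')"
    by (simp add: inner_diff_left inner_diff_right algebra_simps)
  also have "norm \<dots> \<le> norm (a - a') + norm (a - a') + R * norm (e - e') + R * norm (e - e')"
  proof -
    have 1: "norm (((a - a') \<bullet> e) *\<^sub>R e) \<le> norm (a - a')"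
      using Cauchy_Schwarz_ineq2[of "a - a'" e] e by simp
    have "\<bar>a' \<bullet> (e - e')\<bar> \<le> norm a' * norm (e - e')" by (rule Cauchy_Schwarz_ineq2)
    also have "\<dots> \<le> R * norm (e - e')" using a' by (intro mult_right_mono) auto
    finally have 2: "norm ((a' \<bullet> (e - e')) *\<^sub>R e) \<le> R * norm (e - e')" using e by simp
    have "\<bar>a' \<bullet> e'\<bar> \<le> R" using Cauchy_Schwarz_ineq2[of a' e'] e a' by simp
    then have 3: "norm ((a' \<bullet> e') *\<^sub>R (e - e')) \<le> R * norm (e - e')" by (simp add: mult_right_mono)
    show ?thesis
      using 1 2 3 norm_triangle_ineq4[of "a - a'" "((a - a') \<bullet> e) *\<^sub>R e"]
        norm_triangle_ineq4[of "(a - a') - ((a - a') \<bullet> e) *\<^sub>R e" "(a' \<bullet> (e - e')) *\<^sub>R e"]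
        norm_triangle_ineq4[of "(a - a') - ((a - a') \<bullet> e) *\<^sub>R e - (a' \<bullet> (e - e')) *\<^sub>R e" "(a' \<bullet> e') *\<^sub>R (e - e')"]
      by linarith
  qed
  also have "wedge_area e e' \<le> norm (e - e')" using e by (rule wedge_area_le_norm_diff)
  finally have "line_dist l l' \<le> 2 * norm (a - a') + (2 * R + 1) * norm (e - e')"
    by (simp add: algebra_simps)
  also have "\<dots> \<le> 2 * norm (a - a') + (2 * R + 1) * (2 * norm (v - v'))"
  proof (intro add_left_mono mult_left_mono)
    show "norm (e - e') \<le> 2 * norm (v - v')" unfolding e_def e'_def using v by (rule norm_normalize_diff_le)
    show "0 \<le> 2 * R + 1" using a' norm_ge_zero[of a'] by linarith
  qed
  finally show ?thesis by (simp add: algebra_simps)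
qed

text \<open>Coordinates are halved because a point of the unit ball has been rounded to the grid and its coordinates may exceed \<open>1\<close>,
  and intercepts may be as large as \<open>2\<close>.  The width \<open>2 * \<delta>\<close> results from this halving and from rounding.\<close>

lemma spread_grid:
  fixes i0 :: "'n::finite"
  assumes \<delta>: "0 < \<delta>" and P: "finite P"
  shows "spread (UNIV - {i0}) (2 * \<delta>) (9 * 17 ^ CARD('n) / \<delta>) P
     (\<lambda>z. \<delta> * real_of_int (z i0) / 2) (\<lambda>z i. \<delta> * real_of_int (z i) / 2)"
  unfolding spread_def
proof (intro allI impI)
  fix w \<tau> and \<alpha> \<omega> :: "'n \<Rightarrow> real" assume w: "2 * \<delta> \<le> w"
  define S where "S = {z \<in> P. \<bar>\<delta> * real_of_int (z i0) / 2 - \<tau>\<bar> \<le> w \<and> (\<forall>i\<in>UNIV - {i0}.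
      \<bar>\<delta> * real_of_int (z i) / 2 - \<alpha> i - \<delta> * real_of_int (z i0) / 2 * \<omega> i\<bar> \<le> 2 * \<delta>)}"
  have finS: "finite S" using P by (simp add: S_def)
  have "card (id ` S) \<le> (9 * w / \<delta>) * 17 ^ CARD('n)"
  proof (rule card_image_fibre_le[of S "\<lambda>z. z i0"])
    show "card ((\<lambda>z. z i0) ` S) \<le> 9 * w / \<delta>"
    proof (cases "S = {}")
      case True
      then show ?thesis using w \<delta> by simp
    next
      case False
      then obtain z0 where z0: "z0 \<in> S" by blast
      define r where "r = nat \<lfloor>4 * w / \<delta>\<rfloor>"
      have r: "real r \<le> 4 * w / \<delta>" using w \<delta> by (simp add: r_def of_nat_nat)
      have "(\<lambda>z. z i0) ` S \<subseteq> {z0 i0 - int r..z0 i0 + int r}"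
      proof safe
        fix z assume z: "z \<in> S"
        have "\<bar>\<delta> * real_of_int (z i0) / 2 - \<delta> * real_of_int (z0 i0) / 2\<bar> \<le> 2 * w"
          using z z0 by (simp add: S_def abs_le_iff)
        then have "\<bar>\<delta> * (real_of_int (z i0) - real_of_int (z0 i0))\<bar> \<le> 4 * w"
          by (simp add: right_diff_distrib abs_le_iff)
        then have "\<bar>real_of_int (z i0) - real_of_int (z0 i0)\<bar> \<le> 4 * w / \<delta>"
          using \<delta> by (simp add: abs_mult pos_le_divide_eq mult.commute)
        then have "\<bar>z i0 - z0 i0\<bar> \<le> \<lfloor>4 * w / \<delta>\<rfloor>" by (simp add: le_floor_iff)
        moreover have "\<lfloor>4 * w / \<delta>\<rfloor> = int r" using w \<delta> by (simp add: r_def)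
        ultimately show "z i0 \<in> {z0 i0 - int r..z0 i0 + int r}" by auto
      qed
      then have "card ((\<lambda>z. z i0) ` S) \<le> card {z0 i0 - int r..z0 i0 + int r}" by (intro card_mono) auto
      also have "\<dots> = 2 * r + 1" by simp
      finally have "real (card ((\<lambda>z. z i0) ` S)) \<le> 2 * (4 * w / \<delta>) + 1" using r by simp
      also have "1 \<le> w / \<delta>" using w \<delta> by (simp add: pos_le_divide_eq)
      finally show ?thesis by simp
    qed
    fix z0 assume z0: "z0 \<in> S"
    have "card (id ` {z \<in> S. z i0 = z0 i0}) \<le> (2 * 8 + 1) ^ card (UNIV :: 'n set)"
    proof (rule card_int_box_le[THEN conjunct2, of _ _ z0])
      fix z i assume "z \<in> id ` {z \<in> S. z i0 = z0 i0}"
      then have z: "z \<in> S" "z i0 = z0 i0" by auto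
      show "\<bar>z i - z0 i\<bar> \<le> int 8"
      proof (cases "i = i0")
        case False
        then have i: "i \<in> UNIV - {i0}" by simp
        have "\<bar>\<delta> * real_of_int (z i) / 2 - \<alpha> i - \<delta> * real_of_int (z i0) / 2 * \<omega> i\<bar> \<le> 2 * \<delta>"
          "\<bar>\<delta> * real_of_int (z0 i) / 2 - \<alpha> i - \<delta> * real_of_int (z0 i0) / 2 * \<omega> i\<bar> \<le> 2 * \<delta>"
          using z(1) z0 i unfolding S_def by blast+
        then have "\<bar>\<delta> * real_of_int (z i) / 2 - \<delta> * real_of_int (z0 i) / 2\<bar> \<le> 4 * \<delta>"
          unfolding z(2) by linarith
        then have "\<bar>\<delta> * (real_of_int (z i) - real_of_int (z0 i))\<bar> \<le> \<delta> * 8"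
          by (simp add: right_diff_distrib abs_le_iff)
        then have "\<bar>real_of_int (z i) - real_of_int (z0 i)\<bar> \<le> 8" using scaled_bound_iff[OF \<delta>] by blast
        then show ?thesis by linarith
      qed (use z in auto)
    qed auto
    moreover have "2 * 8 + 1 = (17::nat)" by simp
    ultimately have "card (id ` {z \<in> S. z i0 = z0 i0}) \<le> 17 ^ CARD('n)" by (simp only:)
    then have "real (card (id ` {z \<in> S. z i0 = z0 i0})) \<le> real (17 ^ CARD('n))" by (simp only: of_nat_le_iff)
    then show "real (card (id ` {z \<in> S. z i0 = z0 i0})) \<le> 17 ^ CARD('n)" by simp
  qed (use finS in auto)
  then show "real (card {z \<in> P. \<bar>\<delta> * real_of_int (z i0) / 2 - \<tau>\<bar> \<le> w \<and> (\<forall>i\<in>UNIV - {i0}.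
      \<bar>\<delta> * real_of_int (z i) / 2 - \<alpha> i - \<delta> * real_of_int (z i0) / 2 * \<omega> i\<bar> \<le> 2 * \<delta>)})
      \<le> 9 * 17 ^ CARD('n) / \<delta> * w"
    by (simp add: S_def mult_ac)
qed

section \<open>From tubes to a grid\<close>

text \<open>The axis as the graph of \<open>\<tau> \<mapsto> a + \<tau> * v\<close> over its dominant coordinate \<open>i0\<close>.  Dominance gives \<open>\<bar>v $ i\<bar> \<le> 1\<close>, and the
  last clause says that every point of the tube is within \<open>\<delta>\<close> of the graph.\<close>

lemma tube_line:
  fixes A B :: "real ^ 'n" and i0 :: 'n
  assumes AB: "dist A B = 1" and \<delta>: "0 < \<delta>" and T: "segment_nbhd \<delta> A B \<subseteq> ball 0 1"
    and max: "\<And>i. \<bar>(B - A) $ i\<bar> \<le> \<bar>(B - A) $ i0\<bar>"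
  defines "v \<equiv> (1 / (B - A) $ i0) *\<^sub>R (B - A)"
  defines "a \<equiv> A - (A $ i0) *\<^sub>R v"
  shows "v $ i0 = 1" "\<bar>v $ i\<bar> \<le> 1" "1 \<le> norm v" "a $ i0 = 0" "\<bar>a $ i\<bar> \<le> 2" "norm a \<le> 2 * CARD('n)"
    "coaxial_line (segment_nbhd \<delta> A B) = range (\<lambda>t. a + t *\<^sub>R v)"
    "coaxial_line (segment_nbhd \<delta> A B) \<in> lines"
    "x \<in> segment_nbhd \<delta> A B \<Longrightarrow> \<exists>y. norm (x - y) \<le> \<delta> \<and> (\<forall>i. y $ i = a $ i + y $ i0 * v $ i)"
proof -
  define u where "u = B - A"
  have u: "norm u = 1" using AB by (simp add: u_def dist_norm norm_minus_commute)
  have u0: "u $ i0 \<noteq> 0"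
  proof
    assume "u $ i0 = 0"
    then have "u = 0" using max by (simp add: vec_eq_iff u_def)
    then show False using u by simp
  qed
  have v: "v = (1 / u $ i0) *\<^sub>R u" by (simp add: v_def u_def)
  show v0: "v $ i0 = 1" using u0 by (simp add: v)
  show v1: "\<bar>v $ i\<bar> \<le> 1" for i
    using max[of i] u0 by (simp add: v u_def abs_divide)
  show "1 \<le> norm v" using component_le_norm_cart[of v i0] v0 by simp
  show a0: "a $ i0 = 0" by (simp add: a_def v0)
  have A1: "\<bar>A $ i\<bar> \<le> 1" for i
    using component_le_norm_cart[of A i] tube_in_ball(2)[OF AB \<delta> T] by linarith
  show a2: "\<bar>a $ i\<bar> \<le> 2" for i
  proof -
    have "\<bar>A $ i0 * v $ i\<bar> \<le> 1 * 1" unfolding abs_mult using A1 v1 by (intro mult_mono) auto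
    then show ?thesis using A1[of i] by (simp add: a_def)
  qed
  have "norm a \<le> (\<Sum>i\<in>UNIV. \<bar>a $ i\<bar>)" by (rule norm_le_l1_cart)
  also have "\<dots> \<le> (\<Sum>i\<in>(UNIV :: 'n set). 2)" by (intro sum_mono a2)
  finally show "norm a \<le> 2 * CARD('n)" by simp
  have line: "A + s *\<^sub>R u = a + (A $ i0 + s * u $ i0) *\<^sub>R v" for s
    using u0 by (simp add: a_def v algebra_simps)
  have hull: "affine hull {A, B} = range (\<lambda>t. a + t *\<^sub>R v)"
    unfolding affine_hull_2_alt u_def[symmetric]
  proof safe
    fix s show "A + s *\<^sub>R u \<in> range (\<lambda>t. a + t *\<^sub>R v)" unfolding line by blast
  next
    fix t
    have "a + t *\<^sub>R v = A + ((t - A $ i0) / u $ i0) *\<^sub>R u" unfolding line using u0 by simp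
    then show "a + t *\<^sub>R v \<in> range (\<lambda>s. A + s *\<^sub>R u)" by blast
  qed
  show "coaxial_line (segment_nbhd \<delta> A B) = range (\<lambda>t. a + t *\<^sub>R v)"
    using coaxial_line_eq[OF AB \<delta>] hull by simp
  have "A \<noteq> B" using AB by auto
  then show "coaxial_line (segment_nbhd \<delta> A B) \<in> lines"
    using coaxial_line_eq[OF AB \<delta>] by (simp add: lines_def aff_dim_2)
  show "\<exists>y. norm (x - y) \<le> \<delta> \<and> (\<forall>i. y $ i = a $ i + y $ i0 * v $ i)" if x: "x \<in> segment_nbhd \<delta> A B"
  proof -
    obtain y where y: "y \<in> closed_segment A B" "dist y x < \<delta>" using x by (auto simp: segment_nbhd_def)
    then obtain s where "y = A + s *\<^sub>R u" by (auto simp: closed_segment_def u_def algebra_simps)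
    then obtain t where t: "y = a + t *\<^sub>R v" using line by blast
    then have "y $ i0 = t" using a0 v0 by simp
    then show ?thesis using t y by (intro exI[of _ y]) (auto simp: dist_norm norm_minus_commute)
  qed
qed

text \<open>The endpoints \<open>A\<close>, \<open>B\<close> of the axis and a dominant coordinate \<open>j0\<close> of the direction are fixed once for every tube.\<close>

locale tube_family =
  fixes \<delta> :: real and \<sigma> :: real and TT :: "(real ^ 'n) set set" and A B :: "(real ^ 'n) set \<Rightarrow> real ^ 'n"
    and j0 :: "(real ^ 'n) set \<Rightarrow> 'n"
  assumes \<delta>: "0 < \<delta>" and fin: "finite TT" and \<sigma>: "0 \<le> \<sigma>" "\<sigma> \<le> 2 * CARD('n)"
    and AB: "\<And>T. T \<in> TT \<Longrightarrow> dist (A T) (B T) = 1"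
    and TAB: "\<And>T. T \<in> TT \<Longrightarrow> T = segment_nbhd \<delta> (A T) (B T)"
    and in_ball: "\<And>T. T \<in> TT \<Longrightarrow> T \<subseteq> ball 0 1"
    and j0: "\<And>T i. T \<in> TT \<Longrightarrow> \<bar>(B T - A T) $ i\<bar> \<le> \<bar>(B T - A T) $ j0 T\<bar>"
    and spacing: "\<And>r l. \<delta> \<le> r \<Longrightarrow> l \<in> lines \<Longrightarrow>
         real (card {T \<in> TT. coaxial_line T \<in> lines.mball l r}) \<le> (r / \<delta>) powr \<sigma>"
begin

definition v where "v T = (1 / (B T - A T) $ j0 T) *\<^sub>R (B T - A T)"
definition a where "a T = A T - (A T $ j0 T) *\<^sub>R v T"

lemma line_facts:
  assumes "T \<in> TT"
  shows "v T $ j0 T = 1" "\<bar>v T $ i\<bar> \<le> 1" "1 \<le> norm (v T)" "a T $ j0 T = 0" "\<bar>a T $ i\<bar> \<le> 2" "norm (a T) \<le> 2 * CARD('n)"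
    "coaxial_line T = range (\<lambda>t. a T + t *\<^sub>R v T)" "coaxial_line T \<in> lines"
    "x \<in> T \<Longrightarrow> \<exists>y. norm (x - y) \<le> \<delta> \<and> (\<forall>i. y $ i = a T $ i + y $ j0 T * v T $ i)"
  using tube_line[OF AB[OF assms] \<delta> _ j0[OF assms], folded TAB[OF assms], OF in_ball[OF assms], folded v_def, folded a_def]
  by auto

text \<open>Two members of a box of radius \<open>r\<close> in the parameters have axes at distance less than \<open>29 * n\<^sup>2 * r\<close>, so that the box is
  contained in a ball around any one of its members.  Passing from radius \<open>r\<close> over \<open>\<delta>\<close> to radius \<open>r\<close> over \<open>2 * \<delta>\<close>
  doubles the constant.\<close>

lemma spaced_class:
  fixes i0 :: 'n
  defines "L \<equiv> {T \<in> TT. j0 T = i0}"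
  shows "spaced (UNIV - {i0}) (2 * \<delta>) ((58 * real CARD('n) ^ 2) powr (2 * CARD('n))) \<sigma> L (\<lambda>T i. a T $ i / 2) (\<lambda>T i. v T $ i)"
  unfolding spaced_def
proof (intro allI impI)
  fix r \<alpha> \<omega> assume r: "2 * \<delta> \<le> r"
  define n where "n = real CARD('n)"
  have n: "1 \<le> n" by (simp add: n_def Suc_le_eq)
  define S where "S = {T \<in> L. \<forall>i\<in>UNIV - {i0}. \<bar>a T $ i / 2 - \<alpha> i\<bar> \<le> r \<and> \<bar>v T $ i - \<omega> i\<bar> \<le> r}"
  have r0: "0 < r" using r \<delta> by linarith
  show "real (card {T \<in> L. \<forall>i\<in>UNIV - {i0}. \<bar>a T $ i / 2 - \<alpha> i\<bar> \<le> r \<and> \<bar>v T $ i - \<omega> i\<bar> \<le> r})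
      \<le> (58 * real CARD('n) ^ 2) powr (2 * CARD('n)) * (r / (2 * \<delta>)) powr \<sigma>"
  proof (cases "S = {}")
    case True
    then show ?thesis unfolding S_def by (simp only: card.empty) simp
  next
    case False
    then obtain T0 where T0: "T0 \<in> S" by blast
    then have T0': "T0 \<in> TT" "j0 T0 = i0" by (auto simp: S_def L_def)
    have "S \<subseteq> {T \<in> TT. coaxial_line T \<in> lines.mball (coaxial_line T0) (29 * n ^ 2 * r)}"
    proof safe
      fix T assume T: "T \<in> S"
      then show T': "T \<in> TT" by (simp add: S_def L_def)
      have j: "j0 T = i0" using T by (simp add: S_def L_def)
      have close: "\<bar>a T0 $ i - a T $ i\<bar> \<le> 4 * r \<and> \<bar>v T0 $ i - v T $ i\<bar> \<le> 2 * r" for i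
      proof (cases "i = i0")
        case True
        then show ?thesis using line_facts(1,4)[OF T'] line_facts(1,4)[OF T0'(1)] j T0' r0 by simp
      next
        case False
        then have "i \<in> UNIV - {i0}" by simp
        then have "\<bar>a T0 $ i / 2 - \<alpha> i\<bar> \<le> r" "\<bar>v T0 $ i - \<omega> i\<bar> \<le> r" "\<bar>a T $ i / 2 - \<alpha> i\<bar> \<le> r" "\<bar>v T $ i - \<omega> i\<bar> \<le> r"
          using T T0 unfolding S_def by blast+
        then show ?thesis by linarith
      qed
      have "norm (a T0 - a T) \<le> (\<Sum>i\<in>UNIV. \<bar>(a T0 - a T) $ i\<bar>)" by (rule norm_le_l1_cart)
      also have "\<dots> \<le> (\<Sum>i\<in>(UNIV :: 'n set). 4 * r)" using close by (intro sum_mono) simp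
      finally have na: "norm (a T0 - a T) \<le> 4 * n * r" by (simp add: n_def)
      have "norm (v T0 - v T) \<le> (\<Sum>i\<in>UNIV. \<bar>(v T0 - v T) $ i\<bar>)" by (rule norm_le_l1_cart)
      also have "\<dots> \<le> (\<Sum>i\<in>(UNIV :: 'n set). 2 * r)" using close by (intro sum_mono) simp
      finally have nv: "norm (v T0 - v T) \<le> 2 * n * r" by (simp add: n_def)
      have "line_dist (coaxial_line T0) (coaxial_line T) \<le> 2 * norm (a T0 - a T) + (4 * (2 * n) + 2) * norm (v T0 - v T)"
        using line_facts[OF T'] line_facts[OF T0'(1)] by (intro line_dist_range_le) (auto simp: n_def)
      also have "\<dots> \<le> 2 * (4 * n * r) + (4 * (2 * n) + 2) * (2 * n * r)"
        using na nv n by (intro add_mono mult_left_mono) auto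
      also have "\<dots> = (12 * n + 16 * n ^ 2) * r" by (simp add: algebra_simps power2_eq_square)
      also have "\<dots> < 29 * n ^ 2 * r"
      proof (rule mult_strict_right_mono[OF _ r0])
        have "n * 1 \<le> n * n" "1 * 1 \<le> n * n" using n by (intro mult_mono; simp)+
        then show "12 * n + 16 * n ^ 2 < 29 * n ^ 2" by (simp add: power2_eq_square)
      qed
      finally show "coaxial_line T \<in> lines.mball (coaxial_line T0) (29 * n ^ 2 * r)"
        using line_facts(8)[OF T'] line_facts(8)[OF T0'(1)] by (simp add: lines.in_mball)
    qed
    then have "card S \<le> card {T \<in> TT. coaxial_line T \<in> lines.mball (coaxial_line T0) (29 * n ^ 2 * r)}"
      using fin by (intro card_mono) auto
    then have "real (card S) \<le> real (card {T \<in> TT. coaxial_line T \<in> lines.mball (coaxial_line T0) (29 * n ^ 2 * r)})"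
      by (simp only: of_nat_le_iff)
    also have "\<dots> \<le> (29 * n ^ 2 * r / \<delta>) powr \<sigma>"
    proof (rule spacing[OF _ line_facts(8)[OF T0'(1)]])
      have "1 \<le> 29 * n ^ 2" using one_le_power[OF n, of 2] by linarith
      then have "1 * r \<le> 29 * n ^ 2 * r" using r0 by (intro mult_right_mono) auto
      then show "\<delta> \<le> 29 * n ^ 2 * r" using r \<delta> by linarith
    qed
    also have "29 * n ^ 2 * r / \<delta> = (58 * n ^ 2) * (r / (2 * \<delta>))" by simp
    also have "\<dots> powr \<sigma> = (58 * n ^ 2) powr \<sigma> * (r / (2 * \<delta>)) powr \<sigma>" by (rule powr_mult)
    also have "\<dots> \<le> (58 * n ^ 2) powr (2 * CARD('n)) * (r / (2 * \<delta>)) powr \<sigma>"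
      using \<sigma> one_le_power[OF n, of 2] by (intro mult_right_mono powr_mono) auto
    finally show ?thesis by (simp add: S_def n_def)
  qed
qed

definition grid_cell :: "real ^ 'n \<Rightarrow> 'n \<Rightarrow> int" where
  "grid_cell x = (\<lambda>i. \<lfloor>x $ i / \<delta>\<rfloor>)"

lemma grid_cell_bounds: "\<delta> * real_of_int (grid_cell x i) \<le> x $ i" "x $ i \<le> \<delta> * real_of_int (grid_cell x i) + \<delta>"
proof -
  have "real_of_int \<lfloor>x $ i / \<delta>\<rfloor> \<le> x $ i / \<delta>" "x $ i / \<delta> \<le> real_of_int \<lfloor>x $ i / \<delta>\<rfloor> + 1" by linarith+
  then have "real_of_int \<lfloor>x $ i / \<delta>\<rfloor> * \<delta> \<le> x $ i" "x $ i \<le> (real_of_int \<lfloor>x $ i / \<delta>\<rfloor> + 1) * \<delta>"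
    using \<delta> by (simp_all only: pos_le_divide_eq pos_divide_le_eq)
  then show "\<delta> * real_of_int (grid_cell x i) \<le> x $ i" "x $ i \<le> \<delta> * real_of_int (grid_cell x i) + \<delta>"
    by (simp_all add: grid_cell_def algebra_simps)
qed

abbreviation inc :: "'n \<Rightarrow> (real ^ 'n) set \<Rightarrow> ('n \<Rightarrow> int) \<Rightarrow> bool" where
  "inc i0 \<equiv> incident (UNIV - {i0}) (2 * \<delta>) (\<lambda>T i. a T $ i / 2) (\<lambda>T i. v T $ i)
     (\<lambda>z. \<delta> * real_of_int (z i0) / 2) (\<lambda>z i. \<delta> * real_of_int (z i) / 2)"

text \<open>Rounding to the grid and passing from the tube to its axis cost \<open>\<delta>\<close> each, in the coordinate considered and in the time
  coordinate; halving the total \<open>4 * \<delta>\<close> leaves \<open>2 * \<delta>\<close>.\<close>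

lemma incident_cell:
  assumes T: "T \<in> TT" and x: "x \<in> T"
  shows "inc (j0 T) T (grid_cell x)"
  unfolding incident_def
proof
  fix i
  obtain y where y: "norm (x - y) \<le> \<delta>" "\<And>i. y $ i = a T $ i + y $ j0 T * v T $ i"
    using line_facts(9)[OF T x] by blast
  have near: "\<bar>\<delta> * real_of_int (grid_cell x i) - y $ i\<bar> \<le> 2 * \<delta>" for i
  proof -
    have "\<bar>x $ i - y $ i\<bar> \<le> \<delta>" using component_le_norm_cart[of "x - y" i] y(1) by simp
    then show ?thesis using grid_cell_bounds[of x i] by linarith
  qed
  define e where "e i = \<delta> * real_of_int (grid_cell x i) - y $ i" for i
  have "\<bar>e (j0 T) * v T $ i\<bar> \<le> (2 * \<delta>) * 1"
    unfolding abs_mult using near line_facts(2)[OF T] \<delta> by (intro mult_mono) (auto simp: e_def)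
  moreover have "\<bar>e i\<bar> \<le> 2 * \<delta>" using near by (simp add: e_def)
  ultimately have "\<bar>e i - e (j0 T) * v T $ i\<bar> \<le> 4 * \<delta>"
    using abs_triangle_ineq4[of "e i" "e (j0 T) * v T $ i"] by linarith
  moreover have "\<delta> * real_of_int (grid_cell x i) / 2 - a T $ i / 2 - \<delta> * real_of_int (grid_cell x (j0 T)) / 2 * v T $ i
      = (e i - e (j0 T) * v T $ i) / 2"
    using y(2)[of i] by (simp add: e_def algebra_simps)
  ultimately show "\<bar>\<delta> * real_of_int (grid_cell x i) / 2 - a T $ i / 2
      - \<delta> * real_of_int (grid_cell x (j0 T)) / 2 * v T $ i\<bar> \<le> 2 * \<delta>"
    by (simp only: abs_divide) simp
qed

text \<open>A point of the unit ball has coordinates at most \<open>1\<close>; rounding may add \<open>\<delta>\<close>.\<close>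

definition grid :: "('n \<Rightarrow> int) set" where
  "grid = {z. \<forall>i. \<bar>\<delta> * real_of_int (z i)\<bar> \<le> 2}"

lemma finite_grid: "finite grid"
proof -
  have "finite grid \<and> card grid \<le> (2 * nat \<lceil>2 / \<delta>\<rceil> + 1) ^ card (UNIV :: 'n set)"
  proof (rule card_int_box_le[of UNIV _ "\<lambda>_. 0"])
    fix z i assume "z \<in> grid"
    then have "\<bar>\<delta> * real_of_int (z i)\<bar> \<le> 2" by (simp add: grid_def)
    then have "\<bar>real_of_int (z i)\<bar> \<le> 2 / \<delta>" using \<delta> by (simp add: abs_mult pos_le_divide_eq mult.commute)
    then show "\<bar>z i - 0\<bar> \<le> int (nat \<lceil>2 / \<delta>\<rceil>)" by linarith
  qed auto
  then show ?thesis by blast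
qed

lemma grid_cell_in_grid:
  assumes "x \<in> ball 0 1" "\<delta> \<le> 1 / 2"
  shows "grid_cell x \<in> grid"
proof -
  have "\<bar>\<delta> * real_of_int (grid_cell x i)\<bar> \<le> 2" for i
  proof -
    have "\<bar>x $ i\<bar> \<le> 1" using component_le_norm_cart[of x i] assms by simp
    then show ?thesis using grid_cell_bounds[of x i] assms(2) by linarith
  qed
  then show ?thesis by (simp add: grid_def)
qed

text \<open>On a grid cube the overlap function is at most the sum over the directional classes of the discrete multiplicities at the
  corner of the cube.\<close>

lemma nn_integral_overlap_le:
  fixes q :: real
  assumes q: "1 < q" and half: "\<delta> \<le> 1 / 2"
  defines "F \<equiv> \<lambda>i0 z. real (card {T \<in> {T \<in> TT. j0 T = i0}. inc i0 T z})"
  shows "(\<integral>\<^sup>+x. ennreal (\<bar>\<Sum>T\<in>TT. indicator T x\<bar> powr q) \<partial>lebesgue)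
    \<le> ennreal (\<delta> ^ CARD('n) * (real CARD('n) powr (q - 1) * (\<Sum>i0\<in>UNIV. \<Sum>z\<in>grid. F i0 z powr q)))"
proof -
  define G where "G z = real CARD('n) powr (q - 1) * (\<Sum>i0\<in>UNIV. F i0 z powr q)" for z
  define Q where "Q z = cbox (\<chi> i. \<delta> * real_of_int (z i)) (\<chi> i. \<delta> * real_of_int (z i) + \<delta>)" for z :: "'n \<Rightarrow> int"
  have G0: "0 \<le> G z" for z by (simp add: G_def sum_nonneg)
  have meas: "Q z \<in> sets lebesgue" for z by (simp add: Q_def)
  have vol: "emeasure lebesgue (Q z) = ennreal (\<delta> ^ CARD('n))" for z
  proof -
    have "Q z \<noteq> {}" unfolding Q_def interval_ne_empty_cart using \<delta> by simp
    then have "measure lebesgue (Q z) = \<delta> ^ CARD('n)" unfolding Q_def by (simp add: content_cbox_cart)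
    moreover have "emeasure lebesgue (Q z) = ennreal (measure lebesgue (Q z))"
      unfolding Q_def by (rule emeasure_eq_measure2[symmetric, THEN sym]) (auto intro: fmeasurableD2 lmeasurable_cbox)
    ultimately show ?thesis by simp
  qed
  have "(\<integral>\<^sup>+x. ennreal (\<bar>\<Sum>T\<in>TT. indicator T x\<bar> powr q) \<partial>lebesgue)
      \<le> (\<integral>\<^sup>+x. (\<Sum>z\<in>grid. ennreal (G z) * indicator (Q z) x) \<partial>lebesgue)"
  proof (rule nn_integral_mono)
    fix x :: "real ^ 'n"
    have f: "(\<Sum>T\<in>TT. indicator T x) = real (card {T \<in> TT. x \<in> T})"
      using fin by (simp add: real_card_filter indicator_def of_bool_def)
    show "ennreal (\<bar>\<Sum>T\<in>TT. indicator T x\<bar> powr q) \<le> (\<Sum>z\<in>grid. ennreal (G z) * indicator (Q z) x)"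
    proof (cases "{T \<in> TT. x \<in> T} = {}")
      case True
      then show ?thesis unfolding f by (simp only: True) simp
    next
      case False
      then have "x \<in> ball 0 1" using in_ball by blast
      then have z: "grid_cell x \<in> grid" using half by (rule grid_cell_in_grid)
      have xQ: "x \<in> Q (grid_cell x)" unfolding Q_def mem_box_cart using grid_cell_bounds by simp
      have "card {T \<in> TT. x \<in> T} = (\<Sum>i0\<in>UNIV. card {T \<in> {T \<in> TT. x \<in> T}. j0 T = i0})"
        unfolding card_eq_sum using fin by (intro sum.group[symmetric]) auto
      also have "\<dots> \<le> (\<Sum>i0\<in>UNIV. card {T \<in> {T \<in> TT. j0 T = i0}. inc i0 T (grid_cell x)})"
        using fin incident_cell by (intro sum_mono card_mono) auto
      finally have "real (card {T \<in> TT. x \<in> T}) \<le> (\<Sum>i0\<in>UNIV. F i0 (grid_cell x))"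
        unfolding F_def by (simp only: of_nat_sum[symmetric] of_nat_le_iff)
      then have "real (card {T \<in> TT. x \<in> T}) powr q \<le> (\<Sum>i0\<in>UNIV. F i0 (grid_cell x)) powr q"
        using q by (intro powr_mono2) auto
      also have "\<dots> \<le> G (grid_cell x)"
        unfolding G_def using q by (intro sum_powr_le) (auto simp: F_def)
      finally have "ennreal (\<bar>\<Sum>T\<in>TT. indicator T x\<bar> powr q) \<le> ennreal (G (grid_cell x)) * indicator (Q (grid_cell x)) x"
        using xQ unfolding f by (simp add: ennreal_leI)
      also have "\<dots> \<le> (\<Sum>z\<in>grid. ennreal (G z) * indicator (Q z) x)"
        using finite_grid z by (intro member_le_sum[where f = "\<lambda>z. ennreal (G z) * indicator (Q z) x"]) auto
      finally show ?thesis .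
    qed
  qed
  also have "\<dots> = (\<Sum>z\<in>grid. ennreal (G z) * emeasure lebesgue (Q z))"
    using meas by (subst nn_integral_sum) (auto simp: nn_integral_cmult_indicator)
  also have "\<dots> = (\<Sum>z\<in>grid. ennreal (G z * \<delta> ^ CARD('n)))"
    using G0 \<delta> by (simp add: vol ennreal_mult)
  also have "\<dots> = ennreal (\<Sum>z\<in>grid. G z * \<delta> ^ CARD('n))"
    using G0 \<delta> by (intro sum_ennreal) auto
  also have "(\<Sum>z\<in>grid. G z * \<delta> ^ CARD('n))
      = \<delta> ^ CARD('n) * (real CARD('n) powr (q - 1) * (\<Sum>i0\<in>UNIV. \<Sum>z\<in>grid. F i0 z powr q))"
  proof -
    have "(\<Sum>i0\<in>UNIV. \<Sum>z\<in>grid. F i0 z powr q) = (\<Sum>z\<in>grid. \<Sum>i0\<in>UNIV. F i0 z powr q)"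
      by (rule sum.swap)
    then show ?thesis by (simp add: G_def sum_distrib_left mult_ac)
  qed
  finally show ?thesis .
qed

text \<open>The number of tubes in the discrete bound is converted into their total volume by \<open>measure_tube_ge\<close>.  All
  constants are made \<open>q\<close>-th powers of numbers that are at least \<open>1\<close>, so that the \<open>q\<close>-th root leaves a
  constant independent of \<open>q\<close>.\<close>

lemma Lp_norm_overlap_le:
  fixes q e M :: real
  assumes q: "1 < q" and half: "\<delta> \<le> 1 / 2" and e: "e \<le> 0" and M: "1 \<le> M"
    and disc: "\<And>i0. (\<Sum>z\<in>grid. real (card {T \<in> {T \<in> TT. j0 T = i0}. inc i0 T z}) powr q)
      \<le> M powr q * (2 * \<delta>) powr e * card {T \<in> TT. j0 T = i0} * (9 * 17 ^ CARD('n) / \<delta>)"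
  defines "D1 \<equiv> max 1 (9 * 17 ^ CARD('n) / (unit_ball_vol (CARD('n)) / 2))"
  shows "Lp_norm (ennreal q) (\<lambda>x. \<Sum>T\<in>TT. indicator T x)
    \<le> ennreal (CARD('n) * M * D1 * \<delta> powr (e / q) * (\<Sum>T\<in>TT. measure lebesgue T) powr (1 / q))"
proof -
  define n where "n = CARD('n)"
  define c0 where "c0 = unit_ball_vol n / 2"
  define S where "S = (\<Sum>T\<in>TT. measure lebesgue T)"
  define \<Sigma> where "\<Sigma> = (\<Sum>i0\<in>UNIV. \<Sum>z\<in>grid. real (card {T \<in> {T \<in> TT. j0 T = i0}. inc i0 T z}) powr q)"
  define X where "X = \<delta> ^ n * (real n powr (q - 1) * \<Sigma>)"
  have n: "1 \<le> n" by (simp add: n_def Suc_le_eq)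
  have c0: "0 < c0" by (simp add: c0_def)
  have D1: "1 \<le> D1" "9 * 17 ^ n / c0 \<le> D1" by (simp_all add: D1_def c0_def n_def)
  have S: "0 \<le> S" "c0 * \<delta> ^ (n - 1) * card TT \<le> S"
  proof -
    show "0 \<le> S" by (simp add: S_def sum_nonneg)
    have "c0 * \<delta> ^ (n - 1) \<le> measure lebesgue T" if T: "T \<in> TT" for T
    proof -
      have "bounded (segment_nbhd \<delta> (A T) (B T))"
        using in_ball[OF T] TAB[OF T] by (metis bounded_ball bounded_subset)
      from measure_tube_ge[OF AB[OF T] \<delta> this] show ?thesis
        using TAB[OF T] by (simp add: c0_def n_def)
    qed
    then have "(\<Sum>T\<in>TT. c0 * \<delta> ^ (n - 1)) \<le> S" unfolding S_def by (rule sum_mono)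
    then show "c0 * \<delta> ^ (n - 1) * card TT \<le> S" by (simp add: mult.commute)
  qed
  have "\<Sigma> \<le> (\<Sum>i0\<in>UNIV. M powr q * (2 * \<delta>) powr e * card {T \<in> TT. j0 T = i0} * (9 * 17 ^ n / \<delta>))"
    unfolding \<Sigma>_def n_def by (intro sum_mono disc)
  also have "\<dots> = M powr q * (2 * \<delta>) powr e * (\<Sum>i0\<in>UNIV. card {T \<in> TT. j0 T = i0}) * (9 * 17 ^ n / \<delta>)"
    by (simp add: sum_distrib_left sum_distrib_right sum_divide_distrib)
  also have "(\<Sum>i0\<in>UNIV. card {T \<in> TT. j0 T = i0}) = card TT"
    unfolding card_eq_sum using fin by (intro sum.group) auto
  finally have "\<Sigma> \<le> M powr q * (2 * \<delta>) powr e * card TT * (9 * 17 ^ n / \<delta>)" .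
  also have "\<dots> \<le> M powr q * \<delta> powr e * card TT * (9 * 17 ^ n / \<delta>)"
    using \<delta> e by (intro mult_right_mono mult_left_mono powr_mono2') auto
  finally have "X \<le> \<delta> ^ n * (real n powr (q - 1) * (M powr q * \<delta> powr e * card TT * (9 * 17 ^ n / \<delta>)))"
    unfolding X_def using \<delta> by (intro mult_left_mono) auto
  also have "\<dots> \<le> \<delta> ^ n * (real n powr q * (M powr q * \<delta> powr e * card TT * (9 * 17 ^ n / \<delta>)))"
    using \<delta> n by (intro mult_left_mono mult_right_mono powr_mono) auto
  also have "\<dots> = real n powr q * M powr q * \<delta> powr e * (9 * 17 ^ n / c0) * (c0 * (\<delta> ^ n / \<delta>) * card TT)"
    using c0 \<delta> by (simp add: field_simps)
  also have "\<delta> ^ n / \<delta> = \<delta> ^ (n - 1)" using n \<delta> by (cases n) auto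
  also have "real n powr q * M powr q * \<delta> powr e * (9 * 17 ^ n / c0) * (c0 * \<delta> ^ (n - 1) * card TT)
      \<le> real n powr q * M powr q * \<delta> powr e * D1 powr q * S"
  proof (intro mult_mono S)
    have "D1 powr 1 \<le> D1 powr q" using D1 q by (intro powr_mono) auto
    then show "9 * 17 ^ n / c0 \<le> D1 powr q" using D1 by simp
  qed (use c0 \<delta> in auto)
  also have "\<dots> = (n * M * D1) powr q * \<delta> powr e * S"
    by (simp add: powr_mult mult_ac)
  finally have X: "X \<le> (n * M * D1) powr q * \<delta> powr e * S" .
  have X0: "0 \<le> X" unfolding X_def \<Sigma>_def using \<delta> by (intro mult_nonneg_nonneg sum_nonneg) auto
  define I where "I = (\<integral>\<^sup>+x. ennreal (\<bar>\<Sum>T\<in>TT. indicator T (x :: real ^ 'n)\<bar> powr q) \<partial>lebesgue)"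
  have I: "I \<le> ennreal X"
    unfolding I_def X_def \<Sigma>_def n_def by (rule nn_integral_overlap_le[OF q half])
  then have "I \<noteq> \<infinity>" by (auto simp: top_unique)
  then have "Lp_norm (ennreal q) (\<lambda>x. \<Sum>T\<in>TT. indicator T x) = ennreal (enn2real I powr (1 / q))"
    using q by (simp add: Lp_norm_def I_def Let_def)
  also have "\<dots> \<le> ennreal (((n * M * D1) powr q * \<delta> powr e * S) powr (1 / q))"
  proof (intro ennreal_leI powr_mono2)
    show "enn2real I \<le> (n * M * D1) powr q * \<delta> powr e * S"
      using enn2real_leI[OF X0 I] X by linarith
  qed (use q in auto)
  also have "((n * M * D1) powr q * \<delta> powr e * S) powr (1 / q) = n * M * D1 * \<delta> powr (e / q) * S powr (1 / q)"
    using q n M D1 by (simp add: powr_mult powr_powr)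
  finally show ?thesis by (simp add: S_def n_def)
qed

end

section \<open>The maximal function estimate\<close>

text \<open>The foot is the point of the line that is nearest to the origin.\<close>

lemma norm_foot_le:
  assumes l: "l \<in> lines" and x: "x \<in> l"
  shows "norm (foot l) \<le> norm x"
proof -
  obtain t where t: "x = foot l + t *\<^sub>R unit_direction l" using line_eq_foot_direction[OF l] x by blast
  have "orthogonal (foot l) (t *\<^sub>R unit_direction l)" using foot(2)[OF l] by (simp add: orthogonal_clauses)
  then have "(norm x)\<^sup>2 = (norm (foot l))\<^sup>2 + (norm (t *\<^sub>R unit_direction l))\<^sup>2"
    unfolding t by (rule norm_add_Pythagorean)
  then have "(norm (foot l))\<^sup>2 \<le> (norm x)\<^sup>2" by simp
  then show ?thesis by (rule power2_le_imp_le) simp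
qed

text \<open>It follows that the axes of all tubes in the unit ball lie in a ball of radius \<open>4\<close>, so that the spacing
  hypothesis makes the family finite.\<close>

lemma line_dist_le_norms:
  assumes l: "l \<in> lines" "x \<in> l" and l': "l' \<in> lines" "x' \<in> l'"
  shows "line_dist l l' \<le> norm x + norm x' + 1"
proof -
  have "wedge_area (unit_direction l) (unit_direction l') \<le> sqrt 1"
    unfolding wedge_area_def using unit_direction(1)[OF l(1)] unit_direction(1)[OF l'(1)]
    by (intro real_sqrt_le_mono) (simp add: dot_square_norm)
  moreover have "norm (foot l - foot l') \<le> norm (foot l) + norm (foot l')" by (rule norm_triangle_ineq4)
  ultimately show ?thesis
    using norm_foot_le[OF l] norm_foot_le[OF l'] by (simp add: line_dist_def)
qed

lemma Lp_norm_zero: "Lp_norm p (\<lambda>x. 0) = 0"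
proof (cases "p = \<infinity>")
  case True
  have "esssup lebesgue (\<lambda>x::'a. 0 :: ennreal) \<le> 0" by (rule esssup_I) auto
  then show ?thesis using True by (simp add: Lp_norm_def)
next
  case False
  then show ?thesis by (simp add: Lp_norm_def Let_def)
qed

lemma one_divide_ennreal:
  assumes "0 < x"
  shows "1 / ennreal x = ennreal (1 / x)"
  using divide_ennreal[of 1 x] assms by simp

theorem theorem1p2:
  fixes \<epsilon> :: real
  assumes "CARD('n::finite) \<ge> 2" and "\<epsilon> > 0"
  shows "\<exists>C::real. C > 0 \<and>
    (\<forall>(d::nat) (\<beta>::real) (\<delta>::real) (TT :: (real ^ 'n) set set) (p::ennreal).
      1 \<le> d \<longrightarrow> d < CARD('n) \<longrightarrow> 0 \<le> \<beta> \<longrightarrow> \<beta> \<le> 1 \<longrightarrow> \<delta> > 0 \<longrightarrow>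
      (\<forall>T\<in>TT. is_tube \<delta> T \<and> T \<subseteq> ball 0 1) \<longrightarrow>
      (\<forall>r\<ge>\<delta>. \<forall>l\<in>lines.
         finite {T \<in> TT. coaxial_line T \<in> lines.mball l r} \<and>
         real (card {T \<in> TT. coaxial_line T \<in> lines.mball l r})
           \<le> (r / \<delta>) powr (2 * (real d - 1) + \<beta>)) \<longrightarrow>
      1 < p \<longrightarrow> 1 / p + 1 / ennreal (real d + \<beta>) = 1 \<longrightarrow>
      Lp_norm p (\<lambda>x. \<Sum>T\<in>TT. indicator T x)
        \<le> ennreal (C * \<delta> powr ((1 - real d) / (real d + \<beta>) - \<epsilon>) *
            (if p = \<infinity> then 1
             else (\<Sum>T\<in>TT. measure lebesgue T) powr (1 / enn2real p))))"
proof -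
  define n where "n = CARD('n)"
  define N where "N = n - 1"
  define A0 where "A0 = (58 * real n ^ 2) powr (2 * n)"
  define D1 where "D1 = max 1 (9 * 17 ^ n / (unit_ball_vol n / 2))"
  have n: "2 \<le> n" using assms by (simp add: n_def)
  have A0: "1 \<le> A0"
  proof -
    have "1 \<le> real n ^ 2" using n by (intro one_le_power) simp
    then have "1 \<le> 58 * real n ^ 2" by linarith
    then show ?thesis unfolding A0_def by (intro ge_one_powr_ge_zero) auto
  qed
  define disc where "disc d M \<longleftrightarrow> (\<forall>(I::'n set) \<sigma> q D (P::('n \<Rightarrow> int) set) t \<delta> (L::(real ^ 'n) set set) a v x.
    finite I \<longrightarrow> card I = N \<longrightarrow> 1 + 1 / real d \<le> q \<longrightarrow> \<sigma> * (q - 1) = 1 + (real d - 1) * (q - 1) \<longrightarrow>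
    0 \<le> D \<longrightarrow> finite P \<longrightarrow> (\<forall>p\<in>P. \<bar>t p\<bar> \<le> 1) \<longrightarrow> 0 < \<delta> \<longrightarrow> \<delta> \<le> 1 \<longrightarrow> finite L \<longrightarrow>
    (\<forall>l\<in>L. \<forall>i\<in>I. \<bar>a l i\<bar> \<le> 1 \<and> \<bar>v l i\<bar> \<le> 1) \<longrightarrow>
    spread I \<delta> D P t x \<longrightarrow> spaced I \<delta> A0 \<sigma> L a v \<longrightarrow>
    (\<Sum>p\<in>P. real (card {l \<in> L. incident I \<delta> a v t x l p}) powr q)
      \<le> M powr q * \<delta> powr (- (\<epsilon> * q) - (real d - 1) * (q - 1)) * card L * D)" for d M
  have "\<exists>M\<ge>1. disc d M" if "d \<in> {1..N}" for d
    unfolding disc_def using that assms(2) A0 by (intro discrete_Kakeya) auto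
  then obtain M where M: "\<And>d. d \<in> {1..N} \<Longrightarrow> 1 \<le> M d" "\<And>d. d \<in> {1..N} \<Longrightarrow> disc d (M d)" by metis
  \<comment> \<open>The constant must not depend on \<open>d\<close>, which takes finitely many values.\<close>
  define C where "C = 1 + (\<Sum>d=1..N. n * M d * D1)"
  have D1: "1 \<le> D1" by (simp add: D1_def)
  have term_nonneg: "0 \<le> n * M d * D1" if "d \<in> {1..N}" for d
    using M(1)[OF that] D1 by (intro mult_nonneg_nonneg) auto
  have C1: "1 \<le> C" unfolding C_def using sum_nonneg[of "{1..N}" "\<lambda>d. n * M d * D1"] term_nonneg by simp
  have CM: "n * M d * D1 \<le> C" if "d \<in> {1..N}" for d
    using member_le_sum[OF that, of "\<lambda>d. n * M d * D1"] term_nonneg unfolding C_def by fastforce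
  show ?thesis
  proof (rule exI[of _ C], intro conjI allI impI)
    show "C > 0" using C1 by simp
    fix d :: nat and \<beta> \<delta> :: real and TT :: "(real ^ 'n) set set" and p :: ennreal
    assume d: "1 \<le> d" "d < CARD('n)" and \<beta>: "0 \<le> \<beta>" "\<beta> \<le> 1" and \<delta>: "\<delta> > 0"
      and tubes: "\<forall>T\<in>TT. is_tube \<delta> T \<and> T \<subseteq> ball 0 1"
      and spacing: "\<forall>r\<ge>\<delta>. \<forall>l\<in>lines.
         finite {T \<in> TT. coaxial_line T \<in> lines.mball l r} \<and>
         real (card {T \<in> TT. coaxial_line T \<in> lines.mball l r}) \<le> (r / \<delta>) powr (2 * (real d - 1) + \<beta>)"
      and p: "1 < p" and conj: "1 / p + 1 / ennreal (real d + \<beta>) = 1"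
    define p' where "p' = real d + \<beta>"
    have p': "1 \<le> p'" using d \<beta> by (simp add: p'_def)
    have inv: "1 / ennreal p' = ennreal (1 / p')" using p' by (intro one_divide_ennreal) auto
    show "Lp_norm p (\<lambda>x. \<Sum>T\<in>TT. indicator T x)
        \<le> ennreal (C * \<delta> powr ((1 - real d) / (real d + \<beta>) - \<epsilon>) *
            (if p = \<infinity> then 1 else (\<Sum>T\<in>TT. measure lebesgue T) powr (1 / enn2real p)))"
    proof (cases "TT = {}")
      case True
      then show ?thesis by (simp add: Lp_norm_zero)
    next
      case False
      then obtain T0 where T0: "T0 \<in> TT" by blast
      have "\<forall>T\<in>TT. \<exists>A B. dist A B = 1 \<and> T = segment_nbhd \<delta> A B" using tubes by (simp add: is_tube_def)
      then obtain A B where AB: "\<And>T. T \<in> TT \<Longrightarrow> dist (A T) (B T) = 1"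
        and TAB: "\<And>T. T \<in> TT \<Longrightarrow> T = segment_nbhd \<delta> (A T) (B T)" by metis
      have in_ball: "T \<subseteq> ball 0 1" if "T \<in> TT" for T using tubes that by blast
      have half: "\<delta> \<le> 1 / 2" and A1: "norm (A T) \<le> 1" if "T \<in> TT" for T
        using tube_in_ball[OF AB[OF that] \<delta>] TAB[OF that] in_ball[OF that] by auto
      have half: "\<delta> \<le> 1 / 2" using half[OF T0] .
      have hull: "coaxial_line T = affine hull {A T, B T}" if "T \<in> TT" for T
        using coaxial_line_eq[OF AB[OF that] \<delta>] TAB[OF that] by simp
      have line: "coaxial_line T \<in> lines" "A T \<in> coaxial_line T" if "T \<in> TT" for T
      proof -
        have "A T \<noteq> B T" using AB[OF that] by auto
        then show "coaxial_line T \<in> lines" by (simp add: hull[OF that] lines_def aff_dim_2)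
        show "A T \<in> coaxial_line T" by (simp add: hull[OF that] hull_inc)
      qed
      have all: "{T \<in> TT. coaxial_line T \<in> lines.mball (coaxial_line T0) 4} = TT"
      proof -
        have "line_dist (coaxial_line T0) (coaxial_line T) < 4" if "T \<in> TT" for T
          using line_dist_le_norms[OF line[OF T0] line[OF that]] A1[OF T0] A1[OF that] by linarith
        then show ?thesis using line T0 by (auto simp: lines.in_mball)
      qed
      have "\<delta> \<le> 4" using half by simp
      from spacing[rule_format, OF this line(1)[OF T0]]
      have fin: "finite TT" and cardTT: "card TT \<le> (4 / \<delta>) powr (2 * (real d - 1) + \<beta>)"
        unfolding all by auto
      show ?thesis
      proof (cases "p = \<infinity>")
        case True
        \<comment> \<open>Here \<open>d + \<beta> = 1\<close>, and the spacing hypothesis with exponent \<open>0\<close> leaves at most one tube.\<close>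
        have "1 / p = 0" using True by simp
        then have "ennreal (1 / p') = 1" using conj inv by (simp add: p'_def)
        then have "1 / p' = 1" by (simp add: ennreal_eq_1)
        then have "p' = 1" by simp
        then have d1: "d = 1" "\<beta> = 0" using d \<beta> by (auto simp: p'_def)
        then have "card TT \<le> 1" using cardTT \<delta> by simp
        have "esssup lebesgue (\<lambda>x::real^'n. ennreal \<bar>\<Sum>T\<in>TT. indicator T x\<bar>) \<le> 1"
        proof (rule esssup_I)
          have "T \<in> sets lebesgue" if "T \<in> TT" for T
            using open_segment_nbhd TAB[OF that] by (metis lebesgue_openin openin_subtopology_self borel_open sets_completionI_sets sets_lborel)
          then show "(\<lambda>x::real^'n. ennreal \<bar>\<Sum>T\<in>TT. indicator T x\<bar>) \<in> borel_measurable lebesgue"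
            by (intro measurable_compose[OF _ measurable_ennreal] borel_measurable_abs borel_measurable_sum borel_measurable_indicator) auto
          have "\<bar>\<Sum>T\<in>TT. indicator T x\<bar> \<le> (1::real)" for x :: "real ^ 'n"
          proof -
            have "(\<Sum>T\<in>TT. indicator T x) \<le> (\<Sum>T\<in>TT. 1::real)" by (intro sum_mono) (simp add: indicator_def)
            moreover have "0 \<le> (\<Sum>T\<in>TT. indicator T x :: real)" by (simp add: sum_nonneg)
            ultimately show ?thesis using \<open>card TT \<le> 1\<close> by simp
          qed
          then show "AE x in lebesgue. ennreal \<bar>\<Sum>T\<in>TT. indicator T (x::real^'n)\<bar> \<le> 1" by simp
        qed
        also have "1 \<le> ennreal (C * \<delta> powr (- \<epsilon>))"
        proof -
          have "1 \<le> \<delta> powr (- \<epsilon>)" using powr_mono'[of "- \<epsilon>" 0 \<delta>] \<delta> half assms by simp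
          then have "1 * 1 \<le> C * \<delta> powr (- \<epsilon>)" using C1 by (intro mult_mono) auto
          then show ?thesis by simp
        qed
        finally show ?thesis using True d1 by (simp add: Lp_norm_def)
      next
        case False
        define q where "q = enn2real p"
        have pq: "p = ennreal q" using False by (simp add: q_def less_top)
        have q: "1 < q" using p unfolding pq by (metis ennreal_1 ennreal_less_iff zero_le_one)
        have "ennreal (1 / q + 1 / p') = 1"
          using conj inv one_divide_ennreal[of q] q p' by (simp add: pq p'_def[symmetric] ennreal_plus[symmetric] del: ennreal_plus)
        then have qp: "1 / q + 1 / p' = 1" by (simp add: ennreal_eq_1)
        define \<sigma> where "\<sigma> = 2 * (real d - 1) + \<beta>"
        have \<sigma>: "0 \<le> \<sigma>" "\<sigma> \<le> 2 * CARD('n)" using d \<beta> by (auto simp: \<sigma>_def)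
        have qp1: "(q - 1) * (p' - 1) = 1" using qp q p' by (simp add: field_simps)
        have p'1: "0 < p' - 1" using qp1 q by (metis diff_gt_0_iff_gt zero_less_mult_pos zero_less_one)
        have \<sigma>q: "\<sigma> * (q - 1) = 1 + (real d - 1) * (q - 1)"
        proof -
          have "\<sigma> * (q - 1) = (q - 1) * (p' - 1) + (real d - 1) * (q - 1)"
            by (simp add: \<sigma>_def p'_def algebra_simps)
          then show ?thesis by (simp add: qp1)
        qed
        have qd: "1 + 1 / real d \<le> q"
        proof -
          have "1 / real d \<le> 1 / (p' - 1)" using \<beta> p'1 d by (intro divide_left_mono) (auto simp: p'_def)
          also have "\<dots> = q - 1" using qp1 p'1 by (simp add: field_simps)
          finally show ?thesis by simp
        qed
        have "\<exists>i0. \<forall>i. \<bar>w $ i\<bar> \<le> \<bar>w $ i0\<bar>" for w :: "real ^ 'n"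
        proof -
          have "Max (range (\<lambda>i. \<bar>w $ i\<bar>)) \<in> range (\<lambda>i. \<bar>w $ i\<bar>)" by (intro Max_in) auto
          then obtain i0 where "Max (range (\<lambda>i. \<bar>w $ i\<bar>)) = \<bar>w $ i0\<bar>" by blast
          moreover have "\<bar>w $ i\<bar> \<le> Max (range (\<lambda>i. \<bar>w $ i\<bar>))" for i by (intro Max_ge) auto
          ultimately show ?thesis by auto
        qed
        then obtain j where j: "\<And>(w :: real ^ 'n) i. \<bar>w $ i\<bar> \<le> \<bar>w $ j w\<bar>" by metis
        interpret F: tube_family \<delta> \<sigma> TT A B "\<lambda>T. j (B T - A T)"
        proof
          fix r and l :: "(real ^ 'n) set" assume "\<delta> \<le> r" "l \<in> lines"
          then show "real (card {T \<in> TT. coaxial_line T \<in> lines.mball l r}) \<le> (r / \<delta>) powr \<sigma>"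
            using spacing unfolding \<sigma>_def by blast
        qed (fact \<delta> fin \<sigma> AB TAB in_ball | rule j)+
        define e where "e = - (\<epsilon> * q) - (real d - 1) * (q - 1)"
        have dN: "d \<in> {1..N}" using d by (simp add: N_def n_def)
        have "Lp_norm (ennreal q) (\<lambda>x. \<Sum>T\<in>TT. indicator T x)
          \<le> ennreal (CARD('n) * M d * max 1 (9 * 17 ^ CARD('n) / (unit_ball_vol (CARD('n)) / 2)) * \<delta> powr (e / q)
              * (\<Sum>T\<in>TT. measure lebesgue T) powr (1 / q))"
        proof (rule F.Lp_norm_overlap_le[OF q half _ M(1)[OF dN]])
          have "0 \<le> \<epsilon> * q" "0 \<le> (real d - 1) * (q - 1)" using d q assms(2) by auto
          then show "e \<le> 0" unfolding e_def by linarith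
          fix i0 :: 'n
          show "(\<Sum>z\<in>F.grid. real (card {T \<in> {T \<in> TT. j (B T - A T) = i0}. F.inc i0 T z}) powr q)
            \<le> M d powr q * (2 * \<delta>) powr e * card {T \<in> TT. j (B T - A T) = i0} * (9 * 17 ^ CARD('n) / \<delta>)"
            unfolding e_def
          proof (rule M(2)[OF dN, unfolded disc_def, rule_format])
            show "card (UNIV - {i0}) = N" by (simp add: N_def n_def card_Diff_singleton)
            show "spaced (UNIV - {i0}) (2 * \<delta>) A0 \<sigma> {T \<in> TT. j (B T - A T) = i0}
                (\<lambda>T i. F.a T $ i / 2) (\<lambda>T i. F.v T $ i)"
              using F.spaced_class[of i0] by (simp add: A0_def n_def)
            show "spread (UNIV - {i0}) (2 * \<delta>) (9 * 17 ^ CARD('n) / \<delta>) F.grid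
               (\<lambda>z. \<delta> * real_of_int (z i0) / 2) (\<lambda>z i. \<delta> * real_of_int (z i) / 2)"
              by (rule spread_grid[OF \<delta> F.finite_grid])
            show "\<bar>\<delta> * real_of_int (z i0) / 2\<bar> \<le> 1" if "z \<in> F.grid" for z
              using that by (simp add: F.grid_def abs_divide)
          qed (use qd \<sigma>q \<delta> half fin F.finite_grid F.line_facts(2,5) in auto)
        qed
        also have "\<dots> \<le> ennreal (C * \<delta> powr (e / q) * (\<Sum>T\<in>TT. measure lebesgue T) powr (1 / q))"
          using CM[OF dN] unfolding D1_def n_def by (intro ennreal_leI mult_right_mono) auto
        also have "e / q = (1 - real d) / (real d + \<beta>) - \<epsilon>"
        proof -
          have "(q - 1) / q = 1 / p'" using qp q by (simp add: field_simps)
          then have "(real d - 1) * (q - 1) / q = (real d - 1) / p'" by (metis times_divide_eq_right mult.right_neutral)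
          then show ?thesis using q by (simp add: e_def p'_def diff_divide_distrib minus_divide_left[symmetric])
        qed
        finally show ?thesis using q by (simp add: pq)
      qed
    qed
  qed
qed

end
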